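(* Let $w_1,\dots,w_n$ be positive integers, $n=d+1$, with $\gcd(w_1,\dots,w_n)=1$ and $w_i\mid(w_1+\cdots+w_n)$ for all $i$. Let $v_1,\dots,v_n$ be vectors generating $M\cong\mathbb{Z}^d$ with $w_1v_1+\cdots+w_nv_n=0$, let $\{v_1,\dots,v_n\}=A_1\sqcup\cdots\sqcup A_r$ be a partition into nonempty subsets, put $d_j:=\sum_{i:\,v_i\in A_j}w_i$ and assume $w_i\mid d_j$ for all $i,j$. For generic $a=(a_1,\dots,a_n)\in\mathbb{C}^n$ let $$f_j(t):=1-\sum_{i:\,v_i\in A_j}a_it^{v_i}\in\mathbb{C}[t_1^{\pm1},\dots,t_d^{\pm1}],\quad j=1,\dots,r,\qquad F:=t_{d+1}f_1+\cdots+t_{d+r}f_r .$$ Let $\overline{k}=(\overline{k_1},\dots,\overline{k_r})\in\mathbb{Z}_{\ge0}^r$ with $|\overline{k}|=\overline{k_1}+\cdots+\overline{k_r}=d$, and let $P(x_1,\dots,x_n)\in\mathbb{C}[x_1,\dots,x_n]$ be a $\overline{k}$-homogeneous polynomial. Then the $\overline{k}$-mixed toric residue satisfies $$R_P(a):=(-1)^d\,\mathrm{Res}_F^{\overline{k}}\left(t_{d+1}^{\overline{k_1}}\cdots t_{d+r}^{\overline{k_r}}\,P(a_1t^{v_1},\dots,a_nt^{v_n})\right)=\frac{\nu\cdot P(w_1,\dots,w_n)}{1-\mu y},$$ where $$\nu:=\frac1{w_1\cdots w_n},\qquad \mu:=\frac{d_1^{d_1}\cdots d_r^{d_r}}{w_1^{w_1}\cdots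 w_n^{w_n}},\qquad y:=a_1^{w_1}\cdots a_n^{w_n}.$$
   Context: $\overline{k}$-homogeneous: $P$ is homogeneous of degree $\overline{k_j}$ in the group of variables $x_i$ with $v_i\in A_j$, for each $j=1,\dots,r$. Put $\Delta_j:=\mathrm{conv}(\{0\}\cup A_j)\subset M_{\mathbb{R}}$. The condition $w_i\mid d_j$ for all $i,j$ means that $\Delta=\Delta_1+\cdots+\Delta_r$ is a nef-partition. Let $b_1,\dots,b_r$ be the standard basis of $\mathbb{Z}^r$, $\widetilde M=M\oplus\mathbb{Z}^r$, and $$\widetilde\Delta=\Delta_1*\cdots*\Delta_r:=\mathrm{conv}\big((\Delta_1\times\{b_1\})\cup\cdots\cup(\Delta_r\times\{b_r\})\big)$$ the $(d+r-1)$-dimensional Cayley polytope. Let $C\subset\widetilde M_{\mathbb{R}}$ be the $(d+r)$-dimensional cone over $\widetilde\Delta$. Let $S_{\widetilde\Delta}=\mathbb{C}[C\cap\widetilde M]$, viewed (via $M\cong\mathbb{Z}^d$) inside $\mathbb{C}[t_1^{\pm1},\dots,t_d^{\pm1},t_{d+1},\dots,t_{d+r}]$ and graded by $\mathbb{Z}^r_{\ge0}$ through the exponents of $t_{d+1},\dots,t_{d+r}$; $S^k_{\widetilde\Delta}$ denotes the degree-$k$ component and $S^{(l)}_{\widetilde\Delta}=\bigoplus_{|k|=l}S^k_{\widetilde\Delta}$. Let $I_{\widetilde\Delta}\subset S_{\widetilde\Delta}$ be the ideal spanned by monomials corresponding to lattice points in the interior of $C$, with the same gradings. In the nef-partition situation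 $I_{\widetilde\Delta}=t_{d+1}\cdots t_{d+r}S_{\widetilde\Delta}$. Set $F_i:=t_i\,\partial F/\partial t_i$, $i=1,\dots,d+r$. $F$ is called $\widetilde\Delta$-regular if $F_1,\dots,F_{d+r}$ is a regular sequence in $S_{\widetilde\Delta}$; "generic $a$" means in particular that $F$ is $\widetilde\Delta$-regular. Let $H_F:=\det\big(t_i\frac{\partial}{\partial t_i}\,t_j\frac{\partial}{\partial t_j}F\big)_{1\le i,j\le d+r}\in I^{(d+r)}_{\widetilde\Delta}$ be the Hessian. The toric residue $\mathrm{Res}_F:I^{(d+r)}_{\widetilde\Delta}\to\mathbb{C}$ is the unique $\mathbb{C}$-linear map that vanishes on the degree $d+r$ part of $\langle F_1,\dots,F_{d+r}\rangle I_{\widetilde\Delta}$ and satisfies $\mathrm{Res}_F(H_F)=\mathrm{Vol}(\widetilde\Delta)$, where $\mathrm{Vol}$ is the volume multiplied by $(d+r-1)!$. For $\overline{k}\in\mathbb{Z}_{\ge0}^r$ with $|\overline{k}|=d$, the $\overline{k}$-mixed toric residue is $\mathrm{Res}_F^{\overline{k}}:S^{\overline{k}}_{\widetilde\Delta}\to\mathbb{C}$, $g\mapsto\mathrm{Res}_F(t_{d+1}\cdots t_{d+r}\,g)$. *)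

theory Defs
  imports "HOL-Analysis.Analysis" "HOL-Library.Poly_Mapping"
begin

text \<open>
  The finite type \<open>'m\<close> indexes all \<open>d + r\<close> torus coordinates \<open>t\<^sub>1, \<dots>, t\<^bsub>d+r\<^esub>\<close>, and a set
  \<open>J\<close> of \<open>r\<close> indices singles out \<open>t\<^bsub>d+1\<^esub>, \<dots>, t\<^bsub>d+r\<^esub>\<close>. Thus \<open>int ^ 'm\<close> is the lattice
  \<open>M \<oplus> \<int>\<^sup>r\<close>, the summand \<open>M\<close> consists of the vectors vanishing on \<open>J\<close>, and \<open>axis j 1\<close> for
  \<open>j \<in> J\<close> are the basis vectors \<open>b\<^sub>1, \<dots>, b\<^sub>r\<close>. (A separate index type for \<open>M\<close> would exclude
  \<open>d = 0\<close>.)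
\<close>

type_synonym 'm laurent = "(int ^ 'm) \<Rightarrow>\<^sub>0 complex"

type_synonym 'n mpolynomial = "('n \<Rightarrow>\<^sub>0 nat) \<Rightarrow>\<^sub>0 complex"

definition M_lattice :: "'m set \<Rightarrow> (int ^ 'm) set" where
  "M_lattice J = {u. \<forall>j\<in>J. u $ j = 0}"

definition lconst :: "complex \<Rightarrow> 'm::finite laurent" where
  "lconst c = Poly_Mapping.single 0 c"

definition tvar :: "'m \<Rightarrow> 'm::finite laurent" where
  "tvar m = Poly_Mapping.single (axis m 1) 1"

text \<open>The operator \<open>t\<^sub>m \<partial>/\<partial>t\<^sub>m\<close>, which multiplies the coefficient of \<open>t\<^sup>u\<close> by \<open>u\<^sub>m\<close>.\<close>

definition log_deriv :: "'m \<Rightarrow> 'm::finite laurent \<Rightarrow> 'm laurent" where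
  "log_deriv m g = Poly_Mapping.mapp (\<lambda>u c. of_int (u $ m) * c) g"


subsection \<open>Cayley polytope and cone\<close>

definition real_vec :: "int ^ 'm \<Rightarrow> real ^ 'm" where
  "real_vec u = (\<chi> i. real_of_int (u $ i))"

definition Delta_part :: "('m \<Rightarrow> (int ^ 'm) set) \<Rightarrow> 'm \<Rightarrow> (real ^ 'm::finite) set" where
  "Delta_part A j = convex hull ({0} \<union> real_vec ` A j)"

definition cayley_polytope :: "'m set \<Rightarrow> ('m \<Rightarrow> (int ^ 'm) set) \<Rightarrow> (real ^ 'm::finite) set" where
  "cayley_polytope J A = convex hull (\<Union>j\<in>J. (\<lambda>p. p + axis j 1) ` Delta_part A j)"

definition cayley_cone :: "'m set \<Rightarrow> ('m \<Rightarrow> (int ^ 'm) set) \<Rightarrow> (real ^ 'm::finite) set" where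
  "cayley_cone J A = cone hull (cayley_polytope J A)"

text \<open>
  The \<open>(d+r-1)\<close>-dimensional volume of a polytope in the hyperplane \<open>\<Sum>\<^bsub>j\<in>J\<^esub> x\<^sub>j = 1\<close>, normalised
  by the lattice points of that hyperplane. The hyperplane is at lattice distance 1 from the
  origin, so the pyramid with apex 0 over the polytope has Lebesgue measure
  \<open>1/(d+r)\<close> times the volume of its base.
\<close>

definition hyperplane_volume :: "(real ^ 'm::finite) set \<Rightarrow> real" where
  "hyperplane_volume Q = real CARD('m) * measure lebesgue (convex hull (insert 0 Q))"

definition Vol :: "(real ^ 'm::finite) set \<Rightarrow> real" where
  "Vol Q = fact (CARD('m) - 1) * hyperplane_volume Q"


subsection \<open>The graded ring, its interior ideal, regular sequences\<close>

definition S_ring :: "'m set \<Rightarrow> ('m \<Rightarrow> (int ^ 'm) set) \<Rightarrow> 'm::finite laurent set" where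
  "S_ring J A = {g. \<forall>u\<in>Poly_Mapping.keys g. real_vec u \<in> cayley_cone J A}"

definition S_multidegree ::
    "'m set \<Rightarrow> ('m \<Rightarrow> (int ^ 'm) set) \<Rightarrow> ('m \<Rightarrow> nat) \<Rightarrow> 'm::finite laurent set" where
  "S_multidegree J A k =
     {g \<in> S_ring J A. \<forall>u\<in>Poly_Mapping.keys g. \<forall>j\<in>J. u $ j = int (k j)}"

definition I_ideal :: "'m set \<Rightarrow> ('m \<Rightarrow> (int ^ 'm) set) \<Rightarrow> 'm::finite laurent set" where
  "I_ideal J A = {g. \<forall>u\<in>Poly_Mapping.keys g. real_vec u \<in> interior (cayley_cone J A)}"

definition I_degree ::
    "'m set \<Rightarrow> ('m \<Rightarrow> (int ^ 'm) set) \<Rightarrow> nat \<Rightarrow> 'm::finite laurent set" where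
  "I_degree J A l =
     {g \<in> I_ideal J A. \<forall>u\<in>Poly_Mapping.keys g. (\<Sum>j\<in>J. u $ j) = int l}"

definition generated_ideal :: "'a::comm_ring_1 set \<Rightarrow> 'a list \<Rightarrow> 'a set" where
  "generated_ideal S xs =
     {\<Sum>l<length xs. h l * xs ! l | h. \<forall>l<length xs. h l \<in> S}"

definition regular_sequence :: "'a::comm_ring_1 set \<Rightarrow> 'a list \<Rightarrow> bool" where
  "regular_sequence S xs \<longleftrightarrow>
     set xs \<subseteq> S \<and>
     (\<forall>l<length xs. \<forall>g\<in>S. xs ! l * g \<in> generated_ideal S (take l xs)
        \<longrightarrow> g \<in> generated_ideal S (take l xs)) \<and>
     generated_ideal S xs \<noteq> S"

text \<open>
  The index type carries no order, so the \<open>t\<^sub>m \<partial>F/\<partial>t\<^sub>m\<close> are only required to form a regular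
  sequence in some order; as they are homogeneous of degree 1, the order is immaterial.
\<close>

definition Delta_regular ::
    "'m set \<Rightarrow> ('m \<Rightarrow> (int ^ 'm) set) \<Rightarrow> 'm::finite laurent \<Rightarrow> bool" where
  "Delta_regular J A F \<longleftrightarrow>
     (\<exists>ms. distinct ms \<and> set ms = UNIV \<and>
        regular_sequence (S_ring J A) (map (\<lambda>m. log_deriv m F) ms))"


subsection \<open>Toric residues\<close>

definition hessian :: "'m::finite laurent \<Rightarrow> 'm laurent" where
  "hessian F = det (\<chi> i j. log_deriv i (log_deriv j F))"

text \<open>The product ideal \<open>\<langle>F\<^sub>1, \<dots>, F\<^bsub>d+r\<^esub>\<rangle> I\<close>.\<close>

definition jacobian_I ::
    "'m set \<Rightarrow> ('m \<Rightarrow> (int ^ 'm) set) \<Rightarrow> 'm::finite laurent \<Rightarrow> 'm laurent set" where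
  "jacobian_I J A F = {\<Sum>m\<in>UNIV. log_deriv m F * h m | h. \<forall>m. h m \<in> I_ideal J A}"

text \<open>Here \<open>CARD('m) = d + r\<close>.\<close>

definition is_toric_residue ::
    "'m set \<Rightarrow> ('m \<Rightarrow> (int ^ 'm) set) \<Rightarrow> 'm::finite laurent \<Rightarrow> ('m laurent \<Rightarrow> complex) \<Rightarrow> bool" where
  "is_toric_residue J A F \<phi> \<longleftrightarrow>
     \<phi> \<in> extensional (I_degree J A CARD('m)) \<and>
     (\<forall>g\<in>I_degree J A CARD('m). \<forall>h\<in>I_degree J A CARD('m). \<phi> (g + h) = \<phi> g + \<phi> h) \<and>
     (\<forall>c. \<forall>g\<in>I_degree J A CARD('m). \<phi> (lconst c * g) = c * \<phi> g) \<and>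
     (\<forall>g\<in>jacobian_I J A F \<inter> I_degree J A CARD('m). \<phi> g = 0) \<and>
     \<phi> (hessian F) = of_real (Vol (cayley_polytope J A))"

definition toric_residue ::
    "'m set \<Rightarrow> ('m \<Rightarrow> (int ^ 'm) set) \<Rightarrow> 'm::finite laurent \<Rightarrow> 'm laurent \<Rightarrow> complex" where
  "toric_residue J A F = (THE \<phi>. is_toric_residue J A F \<phi>)"

definition mixed_toric_residue ::
    "'m set \<Rightarrow> ('m \<Rightarrow> (int ^ 'm) set) \<Rightarrow> 'm::finite laurent \<Rightarrow> ('m \<Rightarrow> nat)
      \<Rightarrow> 'm laurent \<Rightarrow> complex" where
  "mixed_toric_residue J A F k =
     (\<lambda>g\<in>S_multidegree J A k. toric_residue J A F ((\<Prod>j\<in>J. tvar j) * g))"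


subsection \<open>The data of the theorem\<close>

text \<open>Evaluation of a polynomial at a point of a \<open>\<complex>\<close>-algebra with structure map \<open>\<iota>\<close>.\<close>

definition mpoly_eval ::
    "(complex \<Rightarrow> 'b::comm_ring_1) \<Rightarrow> 'n::finite mpolynomial \<Rightarrow> ('n \<Rightarrow> 'b) \<Rightarrow> 'b" where
  "mpoly_eval \<iota> P x =
     (\<Sum>\<alpha>\<in>Poly_Mapping.keys P.
        \<iota> (Poly_Mapping.lookup P \<alpha>) * (\<Prod>i\<in>UNIV. x i ^ Poly_Mapping.lookup \<alpha> i))"

definition multihomogeneous ::
    "'m set \<Rightarrow> ('m \<Rightarrow> (int ^ 'm) set) \<Rightarrow> ('n::finite \<Rightarrow> int ^ 'm) \<Rightarrow> ('m \<Rightarrow> nat)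
      \<Rightarrow> 'n mpolynomial \<Rightarrow> bool" where
  "multihomogeneous J A v k P \<longleftrightarrow>
     (\<forall>\<alpha>\<in>Poly_Mapping.keys P. \<forall>j\<in>J. (\<Sum>i | v i \<in> A j. Poly_Mapping.lookup \<alpha> i) = k j)"

definition part_weight ::
    "('m \<Rightarrow> (int ^ 'm) set) \<Rightarrow> ('n::finite \<Rightarrow> int ^ 'm) \<Rightarrow> ('n \<Rightarrow> nat) \<Rightarrow> 'm \<Rightarrow> nat" where
  "part_weight A v w j = (\<Sum>i | v i \<in> A j. w i)"

definition f_poly ::
    "('m \<Rightarrow> (int ^ 'm) set) \<Rightarrow> ('n::finite \<Rightarrow> int ^ 'm) \<Rightarrow> ('n \<Rightarrow> complex)
      \<Rightarrow> 'm \<Rightarrow> 'm::finite laurent" where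
  "f_poly A v a j = 1 - (\<Sum>i | v i \<in> A j. Poly_Mapping.single (v i) (a i))"

definition F_poly ::
    "'m set \<Rightarrow> ('m \<Rightarrow> (int ^ 'm) set) \<Rightarrow> ('n::finite \<Rightarrow> int ^ 'm) \<Rightarrow> ('n \<Rightarrow> complex)
      \<Rightarrow> 'm::finite laurent" where
  "F_poly J A v a = (\<Sum>j\<in>J. tvar j * f_poly A v a j)"

end

theory Submission
  imports Defs
begin

text \<open>
  Put \<open>e\<^sub>i = v\<^sub>i + b\<^sub>j\<close> for \<open>v\<^sub>i \<in> A\<^sub>j\<close>. The \<open>d + r + 1\<close> vectors \<open>e\<^sub>1, \<dots>, e\<^sub>n, b\<^sub>1, \<dots>, b\<^sub>r\<close> generate the
  lattice \<open>M \<oplus> \<int>\<^sup>r\<close> and the cone \<open>C\<close>, and \<open>\<Sum> w\<^sub>i e\<^sub>i = \<Sum> d\<^sub>j b\<^sub>j\<close> spans their relations. The proof only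
  uses this circuit; it is written for generators \<open>g\<^sub>k\<close> with the relation \<open>\<Sum> \<rho>\<^sub>k g\<^sub>k = 0\<close>
  (so \<open>\<rho>\<close> is \<open>w\<^sub>i\<close> on \<open>e\<^sub>i\<close> and \<open>-d\<^sub>j\<close> on \<open>b\<^sub>j\<close>) and for \<open>F = \<Sum> a\<^sub>k t^g\<^sub>k\<close>.

  The toric residue is written down explicitly. A lattice point has integer coordinates \<open>c\<close> with
  respect to the generators, determined up to integer multiples of \<open>\<rho>\<close>. It lies in the interior of
  \<open>C\<close> iff \<open>c + s \<rho>\<close> is positive for some real \<open>s\<close>, and these \<open>s\<close> form an open interval. In degree at
  most \<open>d + r\<close> the interval contains no integer, because \<open>d + r + 1\<close> positive integer coordinates
  have a larger sum. So it lies between two consecutive integers, which selects one coordinate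
  vector \<open>c\<close>, called normal; and adding a generator \<open>g\<^sub>k\<close> to an interior point of degree
  \<open>d + r - 1\<close> just increases its normal coordinate \<open>c\<^sub>k\<close> by one (\<open>normal_step\<close>). Choose \<open>\<gamma>\<^sub>k\<close> with
  \<open>a\<^sub>k \<gamma>\<^sub>k = -\<rho>\<^sub>k\<close>. The functional that sends \<open>t^u\<close> to \<open>\<Prod> \<gamma>\<^sub>k^c\<^sub>k\<close>, with \<open>c\<close> the normal coordinates of
  \<open>u\<close>, then annihilates \<open>t^u F\<^sub>m\<close> for the logarithmic derivatives \<open>F\<^sub>m = t\<^sub>m \<partial>F/\<partial>t\<^sub>m\<close> and
  interior \<open>u\<close>, since the value is a multiple of the \<open>m\<close>-th coordinate of
  \<open>\<Sum> \<rho>\<^sub>k g\<^sub>k = 0\<close> (\<open>res_jacobian\<close>).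

  Up to a factor this is the only such functional (\<open>toric_residue_unique\<close>): any other one takes
  proportional values at \<open>u + g\<^sub>k\<close> and \<open>u + g\<^sub>l\<close>, and moves of this kind connect all interior points
  of degree \<open>d + r\<close> (\<open>interior_connected\<close>). This is where \<open>w\<^sub>i dvd d\<^sub>j\<close> and the coprimality of the
  weights enter.

  The factor is fixed by the Hessian. By the Cauchy-Binet formula and because the minor that omits
  \<open>g\<^sub>k\<close> equals \<open>\<plusminus>\<rho>\<^sub>k\<close>, the Hessian is \<open>\<Sum>\<^sub>k \<rho>\<^sub>k\<^sup>2 \<Prod>\<^bsub>l\<noteq>k\<^esub> a\<^sub>l t^g\<^sub>l\<close> (\<open>hessian_eq\<close>). For \<open>g\<^sub>k = e\<^sub>i\<close> the obvious
  coordinates are normal; for \<open>g\<^sub>k = b\<^sub>j\<close> they have to be shifted by \<open>\<rho>\<close>, which costs the factor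
  \<open>\<mu> y\<close>. Summation gives a multiple of \<open>(1 - \<mu> y) \<Sum> w\<^sub>i\<close>, whereas \<open>\<Sum> w\<^sub>i\<close> is also the volume of the
  polytope, which is triangulated by omitting one \<open>e\<^sub>i\<close> at a time (\<open>Vol_eq\<close>). The numerator of
  the theorem has normal coordinates that can be read off its monomials, and \<open>a\<^sub>i \<gamma>\<^sub>i = w\<^sub>i\<close> turns
  \<open>P(a\<^sub>1 t^v\<^sub>1, \<dots>)\<close> into \<open>P(w\<^sub>1, \<dots>)\<close>.

  Regularity of \<open>F\<close> is used to know that \<open>1 - \<mu> y\<close> and, for \<open>d > 0\<close>, all \<open>a\<^sub>i\<close> are nonzero. If one
  of these fails, the \<open>F\<^sub>m\<close> have a common zero on the torus or on an extremal ray of the cone, and the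
  relation between the generators provides a syzygy of the \<open>F\<^sub>m\<close> that is not a Koszul syzygy, which
  is impossible for a regular sequence (\<open>regular_no_torus_zero\<close>, \<open>regular_vertex_nonzero\<close>).
\<close>

abbreviation "single \<equiv> Poly_Mapping.single"
abbreviation "lookup \<equiv> Poly_Mapping.lookup"
abbreviation "keys \<equiv> Poly_Mapping.keys"


section \<open>Determinants and syzygies of regular sequences\<close>

text \<open>
  The Cauchy-Binet formula for one superfluous index. Expanding the rows leaves the maps from rows
  to \<open>K\<close> that are injective. Such a map omits exactly one \<open>k \<in> K\<close>, and those that omit \<open>k\<close> are
  \<open>b k \<circ> p\<close> for the permutations \<open>p\<close>.
\<close>

lemma det_product_one_extra:
  fixes X :: "'m::finite \<Rightarrow> 'k \<Rightarrow> 'a::comm_ring_1" and Y :: "'k \<Rightarrow> 'm \<Rightarrow> 'a"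
  assumes fin: "finite K" and card: "card K = CARD('m) + 1"
    and b: "\<And>k. k \<in> K \<Longrightarrow> bij_betw (b k) UNIV (K - {k})"
  shows "det (\<chi> i j. \<Sum>k\<in>K. X i k * Y k j)
    = (\<Sum>k\<in>K. det (\<chi> i j. X i (b k j)) * det (\<chi> i j. Y (b k i) j))"
proof -
  define D where "D f = (\<Prod>i\<in>UNIV. X i (f i)) * det (\<chi> i j. Y (f i) j)" for f :: "'m \<Rightarrow> 'k"
  define P where "P = {p. p permutes (UNIV :: 'm set)}"
  have PiE: "{f :: 'm \<Rightarrow> 'k. \<forall>i. f i \<in> K} = PiE UNIV (\<lambda>_. K)" by (auto simp: PiE_def Pi_def)
  have "det (\<chi> i j. \<Sum>k\<in>K. X i k * Y k j) = (\<Sum>p\<in>P. of_int (sign p) *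
      (\<Sum>f | \<forall>i. f i \<in> K. \<Prod>i\<in>UNIV. X i (f i) * Y (f i) (p i)))"
    unfolding PiE by (simp add: det_def P_def prod_sum_PiE fin)
  also have "\<dots> = (\<Sum>f | \<forall>i. f i \<in> K. D f)"
    by (simp add: D_def det_def P_def sum_distrib_left prod.distrib mult_ac
        sum.swap[where A = "{p. p permutes (UNIV :: 'm set)}"])
  also have "\<dots> = (\<Sum>f | (\<forall>i. f i \<in> K) \<and> inj f. D f)"
  proof (rule sum.mono_neutral_right)
    show "finite {f :: 'm \<Rightarrow> 'k. \<forall>i. f i \<in> K}" unfolding PiE using fin by (simp add: finite_PiE)
    show "\<forall>f\<in>{f. \<forall>i. f i \<in> K} - {f. (\<forall>i. f i \<in> K) \<and> inj f}. D f = 0"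
    proof
      fix f :: "'m \<Rightarrow> 'k" assume "f \<in> {f. \<forall>i. f i \<in> K} - {f. (\<forall>i. f i \<in> K) \<and> inj f}"
      then obtain i j where "i \<noteq> j" "f i = f j" by (auto simp: inj_def)
      then have "det (\<chi> i j. Y (f i) j) = 0"
        by (intro det_identical_rows[of i j]) (auto simp: row_def)
      then show "D f = 0" by (simp add: D_def)
    qed
  qed auto
  also have "{f. (\<forall>i. f i \<in> K) \<and> inj f} = (\<Union>k\<in>K. (\<lambda>p. b k \<circ> p) ` P)" (is "?L = ?R")
  proof (intro equalityI subsetI)
    fix f assume f: "f \<in> ?L"
    have "card (K - range f) = 1"
      using f card fin by (subst card_Diff_subset) (auto simp: card_image)
    then obtain k where k: "K - range f = {k}" by (auto simp: card_1_singleton_iff)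
    then have kK: "k \<in> K" and rf: "range f = K - {k}" using f by auto
    define p where "p = inv_into UNIV (b k) \<circ> f"
    have "bij_betw f UNIV (K - {k})" using f rf by (auto simp: bij_betw_def)
    then have "bij p" unfolding p_def
      using bij_betw_inv_into[OF b[OF kK]] by (rule bij_betw_trans)
    then have "p \<in> P" unfolding P_def by (intro CollectI bij_imp_permutes) auto
    moreover have "f = b k \<circ> p"
    proof
      fix i
      have "f i \<in> K - {k}" using rf by blast
      then show "f i = (b k \<circ> p) i"
        using bij_betw_inv_into_right[OF b[OF kK]] by (simp add: p_def)
    qed
    ultimately show "f \<in> ?R" using kK by blast
  next
    fix f assume "f \<in> ?R"
    then obtain k p where k: "k \<in> K" and p: "p permutes UNIV" and f: "f = b k \<circ> p"
      by (auto simp: P_def)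
    have "inj f" unfolding f using b[OF k] p
      by (meson bij_betw_imp_inj_on inj_compose permutes_inj)
    moreover have "f i \<in> K" for i using b[OF k] by (auto simp: f bij_betw_def)
    ultimately show "f \<in> ?L" by simp
  qed
  also have "(\<Sum>f\<in>\<dots>. D f) = (\<Sum>k\<in>K. \<Sum>f\<in>(\<lambda>p. b k \<circ> p) ` P. D f)"
  proof (rule sum.UNION_disjoint[OF fin])
    show "\<forall>k\<in>K. finite ((\<lambda>p. b k \<circ> p) ` P)" by (simp add: P_def finite_permutations)
    have rng: "range (b k \<circ> p) = K - {k}" if "k \<in> K" "p \<in> P" for k p
    proof -
      have "range (b k \<circ> p) = b k ` (p ` UNIV)" by (simp add: image_comp)
      also have "p ` UNIV = UNIV" using that(2) by (simp add: P_def permutes_surj)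
      finally show ?thesis using b[OF that(1)] by (simp add: bij_betw_def)
    qed
    show "\<forall>k\<in>K. \<forall>l\<in>K. k \<noteq> l \<longrightarrow> (\<lambda>p. b k \<circ> p) ` P \<inter> (\<lambda>p. b l \<circ> p) ` P = {}"
    proof (intro ballI impI equals0I)
      fix k l f assume "k \<in> K" "l \<in> K" "k \<noteq> l" "f \<in> (\<lambda>p. b k \<circ> p) ` P \<inter> (\<lambda>p. b l \<circ> p) ` P"
      then have "K - {k} = K - {l}" using rng[of k] rng[of l] by (metis IntE imageE)
      then show False using \<open>k \<in> K\<close> \<open>l \<in> K\<close> \<open>k \<noteq> l\<close> by blast
    qed
  qed
  also have "\<dots> = (\<Sum>k\<in>K. det (\<chi> i j. X i (b k j)) * det (\<chi> i j. Y (b k i) j))"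
  proof (rule sum.cong[OF refl])
    fix k assume k: "k \<in> K"
    have bi: "inj (b k)" using b[OF k] by (simp add: bij_betw_def)
    have "inj_on (\<lambda>p. b k \<circ> p) P"
      using bi by (auto simp: inj_on_def fun_eq_iff inj_def)
    then have "(\<Sum>f\<in>(\<lambda>p. b k \<circ> p) ` P. D f) = (\<Sum>p\<in>P. D (b k \<circ> p))"
      by (simp add: sum.reindex)
    also have "\<dots> = (\<Sum>p\<in>P. (of_int (sign p) * (\<Prod>i\<in>UNIV. X i (b k (p i))))
         * det (\<chi> i j. Y (b k i) j))"
    proof (rule sum.cong[OF refl])
      fix p assume "p \<in> P"
      then have "p permutes UNIV" by (simp add: P_def)
      from det_permute_rows[OF this, of "\<chi> i j. Y (b k i) j"]
      have "det (\<chi> i j. Y (b k (p i)) j) = of_int (sign p) * det (\<chi> i j. Y (b k i) j)"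
        by simp
      then show "D (b k \<circ> p) = (of_int (sign p) * (\<Prod>i\<in>UNIV. X i (b k (p i))))
         * det (\<chi> i j. Y (b k i) j)" by (simp add: D_def mult_ac)
    qed
    also have "\<dots> = det (\<chi> i j. X i (b k j)) * det (\<chi> i j. Y (b k i) j)"
      by (simp add: det_def[of "\<chi> i j. X i (b k j)"] P_def sum_distrib_right)
    finally show "(\<Sum>f\<in>(\<lambda>p. b k \<circ> p) ` P. D f)
      = det (\<chi> i j. X i (b k j)) * det (\<chi> i j. Y (b k i) j)" .
  qed
  finally show ?thesis .
qed

text \<open>
  The first Koszul homology of a regular sequence vanishes. By regularity the last coefficient of a
  syzygy is a combination \<open>\<Sum> c\<^sub>l x\<^sub>l\<close> of the earlier elements; moving it to the other terms leaves a
  shorter syzygy with coefficients \<open>h\<^sub>l + c\<^sub>l x\<^sub>L\<close>. The conclusion is symmetric in the elements, so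
  it survives reordering and linear changes of the sequence.
\<close>

lemma regular_sequence_koszul:
  fixes S :: "'a::comm_ring_1 set"
  assumes reg: "regular_sequence S xs"
    and S0: "0 \<in> S" and Sadd: "\<And>x y. x \<in> S \<Longrightarrow> y \<in> S \<Longrightarrow> x + y \<in> S"
    and Sneg: "\<And>x. x \<in> S \<Longrightarrow> - x \<in> S" and Smul: "\<And>x y. x \<in> S \<Longrightarrow> y \<in> S \<Longrightarrow> x * y \<in> S"
    and h: "\<And>l. l < length xs \<Longrightarrow> h l \<in> S"
    and syz: "(\<Sum>l<length xs. h l * xs ! l) = 0"
  shows "\<exists>B. (\<forall>k l. B k l \<in> S) \<and> (\<forall>k l. B k l = - B l k)
    \<and> (\<forall>l<length xs. h l = (\<Sum>k<length xs. B l k * xs ! k))"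
proof -
  have "L \<le> length xs \<Longrightarrow> (\<forall>l<L. h l \<in> S) \<Longrightarrow> (\<Sum>l<L. h l * xs ! l) = 0 \<Longrightarrow>
     \<exists>B. (\<forall>k l. B k l \<in> S) \<and> (\<forall>k l. B k l = - B l k)
       \<and> (\<forall>l<L. h l = (\<Sum>k<L. B l k * xs ! k))" for L h
  proof (induction L arbitrary: h)
    case 0
    show ?case by (rule exI[of _ "\<lambda>_ _. 0"]) (simp add: S0)
  next
    case (Suc L)
    have L: "L < length xs" using Suc.prems by simp
    have xsS: "xs ! L \<in> S" using reg nth_mem[OF L] unfolding regular_sequence_def by blast
    have "xs ! L * h L = (\<Sum>l<L. (- h l) * xs ! l)"
      using Suc.prems(3) by (simp add: sum_negf add_eq_0_iff mult.commute)
    also have "\<dots> \<in> generated_ideal S (take L xs)"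
      unfolding generated_ideal_def using Suc.prems(2) L
      by (intro CollectI exI[of _ "\<lambda>l. - h l"]) (auto simp: Sneg min_def)
    finally have "h L \<in> generated_ideal S (take L xs)"
      using reg L Suc.prems(2) by (auto simp: regular_sequence_def)
    then obtain c where c: "h L = (\<Sum>l<L. c l * xs ! l)" "\<forall>l<L. c l \<in> S"
      using L by (auto simp: generated_ideal_def min_def)
    have "(\<Sum>l<L. (h l + c l * xs ! L) * xs ! l) = (\<Sum>l<L. h l * xs ! l) + h L * xs ! L"
      by (simp add: c(1) algebra_simps sum.distrib sum_distrib_left sum_distrib_right)
    also have "\<dots> = 0" using Suc.prems(3) by simp
    finally have 0: "(\<Sum>l<L. (h l + c l * xs ! L) * xs ! l) = 0" .
    have "\<forall>l<L. h l + c l * xs ! L \<in> S"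
      using Suc.prems(2) c(2) Sadd Smul xsS by simp
    then obtain B where B: "\<forall>k l. B k l \<in> S" "\<forall>k l. B k l = - B l k"
       "\<forall>l<L. h l + c l * xs ! L = (\<Sum>k<L. B l k * xs ! k)"
      using Suc.IH[OF less_imp_le[OF L] _ 0] by blast
    define B' where "B' k l = (if k < L \<and> l < L then B k l
        else if k = L \<and> l < L then c l else if l = L \<and> k < L then - c k else 0)" for k l
    show ?case
    proof (intro exI[of _ B'] conjI allI impI)
      fix k l
      show "B' k l \<in> S" using B(1) c(2) S0 Sneg by (auto simp: B'_def)
      show "B' k l = - B' l k"
      proof (cases "k < L \<and> l < L")
        case True
        then have "B' k l = B k l" "B' l k = B l k" by (simp_all add: B'_def)
        then show ?thesis using B(2) by metis
      qed (auto simp: B'_def)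
    next
      fix l assume "l < Suc L"
      show "h l = (\<Sum>k<Suc L. B' l k * xs ! k)"
      proof (cases "l = L")
        case True
        then show ?thesis by (simp add: B'_def c(1))
      next
        case False
        with \<open>l < Suc L\<close> have l: "l < L" by simp
        then show ?thesis using B(3)[rule_format, OF l] by (simp add: B'_def eq_diff_eq)
      qed
    qed
  qed
  from this[of "length xs" h] h syz show ?thesis by simp
qed

section \<open>The lattice of a circuit\<close>

lemma real_vec_simps [simp]:
  "real_vec u $ i = real_of_int (u $ i)" "real_vec (u + v) = real_vec u + real_vec v"
  "real_vec (z *s u) = of_int z *\<^sub>R real_vec u" "real_vec 0 = 0"
  by (simp_all add: real_vec_def vec_eq_iff)

lemma real_vec_sum: "real_vec (sum f S) = (\<Sum>i\<in>S. real_vec (f i))"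
  by (induction S rule: infinite_finite_induct) simp_all

lemma real_vec_axis [simp]: "real_vec (axis m 1) = axis m 1"
  by (simp add: vec_eq_iff axis_def)

text \<open>
  In the application \<open>K\<close> indexes the points \<open>e\<^sub>i\<close> and \<open>b\<^sub>j\<close> that span the Cayley polytope, \<open>\<rho>\<close> is
  positive on the \<open>e\<^sub>i\<close> and negative on the \<open>b\<^sub>j\<close>, the divisibility condition is the nef condition, and the last
  condition but one is the coprimality of the weights.
\<close>

locale circuit =
  fixes J :: "'m::finite set" and A :: "'m \<Rightarrow> (int ^ 'm) set"
    and K :: "'k set" and g :: "'k \<Rightarrow> int ^ 'm" and \<rho> :: "'k \<Rightarrow> int"
  assumes finK: "finite K" and cardK: "card K = CARD('m) + 1"
    and generate: "\<And>u. \<exists>c. u = (\<Sum>k\<in>K. c k *s g k)"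
    and relation: "(\<Sum>k\<in>K. \<rho> k *s g k) = 0"
    and rho_nz: "\<And>k. k \<in> K \<Longrightarrow> \<rho> k \<noteq> 0"
    and deg_g: "\<And>k. k \<in> K \<Longrightarrow> (\<Sum>j\<in>J. g k $ j) = 1"
    and rho_dvd: "\<And>k l. k \<in> K \<Longrightarrow> l \<in> K \<Longrightarrow> \<rho> k > 0 \<Longrightarrow> \<rho> l < 0 \<Longrightarrow> \<rho> k dvd \<rho> l"
    and rho_gcd: "\<And>b. (\<And>k. k \<in> K \<Longrightarrow> \<rho> k > 0 \<Longrightarrow> b dvd \<rho> k) \<Longrightarrow> b dvd 1"
    and polytope: "cayley_polytope J A = convex hull (real_vec ` g ` K)"
begin

definition comb :: "('k \<Rightarrow> int) \<Rightarrow> int ^ 'm" where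
  "comb c = (\<Sum>k\<in>K. c k *s g k)"

definition rcomb :: "('k \<Rightarrow> real) \<Rightarrow> real ^ 'm" where
  "rcomb c = (\<Sum>k\<in>K. c k *\<^sub>R real_vec (g k))"

definition Pos :: "'k set" where "Pos = {k\<in>K. \<rho> k > 0}"
definition Neg :: "'k set" where "Neg = {k\<in>K. \<rho> k < 0}"

definition deg :: "int ^ 'm \<Rightarrow> int" where "deg u = (\<Sum>j\<in>J. u $ j)"

lemma real_vec_comb: "real_vec (comb c) = rcomb (\<lambda>k. of_int (c k))"
  by (simp add: comb_def rcomb_def real_vec_sum)

lemma comb_surj: "\<exists>c. u = comb c"
  using generate[of u] by (auto simp: comb_def)

lemma rcomb_linear:
  "rcomb (\<lambda>k. c k + c' k) = rcomb c + rcomb c'" "rcomb (\<lambda>k. c k - c' k) = rcomb c - rcomb c'"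
  "rcomb (\<lambda>k. s * c k) = s *\<^sub>R rcomb c" "rcomb (\<lambda>k. 0) = 0"
  by (simp_all add: rcomb_def algebra_simps sum.distrib sum_subtractf scaleR_sum_right)

lemma comb_linear:
  "comb (\<lambda>k. c k + c' k) = comb c + comb c'" "comb (\<lambda>k. c k - c' k) = comb c - comb c'"
  "comb (\<lambda>k. s * c k) = s *s comb c"
  by (simp_all add: comb_def vec_eq_iff sum_component algebra_simps sum.distrib sum_subtractf
      sum_distrib_left)

lemma rcomb_rho: "rcomb (\<lambda>k. of_int (\<rho> k)) = 0"
  using real_vec_comb[of \<rho>] relation by (simp add: comb_def)

lemma comb_rho: "comb \<rho> = 0"
  using relation by (simp add: comb_def)

lemma rcomb_shift: "rcomb (\<lambda>k. c k + s * of_int (\<rho> k)) = rcomb c"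
  by (simp add: rcomb_linear rcomb_rho)

lemma comb_shift: "comb (\<lambda>k. c k + s * \<rho> k) = comb c"
  by (simp add: comb_linear comb_rho)

lemma comb_single:
  assumes "k \<in> K" shows "comb (\<lambda>l. if l = k then s else 0) = s *s g k"
proof -
  have "comb (\<lambda>l. if l = k then s else 0) = (\<Sum>l\<in>K. if l = k then s *s g k else 0)"
    unfolding comb_def by (rule sum.cong) auto
  then show ?thesis using assms finK by simp
qed

lemma comb_add_gen:
  assumes "k \<in> K" shows "comb (c(k := c k + s)) = comb c + s *s g k"
proof -
  have "c(k := c k + s) = (\<lambda>l. c l + (if l = k then s else 0))" by auto
  then show ?thesis using assms by (simp only: comb_linear comb_single)
qed

lemma deg_add [simp]: "deg (u + v) = deg u + deg v"
  by (simp add: deg_def sum.distrib)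

lemma deg_comb: "deg (comb c) = (\<Sum>k\<in>K. c k)"
proof -
  have "deg (comb c) = (\<Sum>k\<in>K. c k * (\<Sum>j\<in>J. g k $ j))"
    unfolding deg_def comb_def sum_component by (subst sum.swap) (simp add: sum_distrib_left)
  then show ?thesis by (simp add: deg_g)
qed

lemma deg_gen: "k \<in> K \<Longrightarrow> deg (g k) = 1"
  by (simp add: deg_def deg_g)

lemma sum_rho: "(\<Sum>k\<in>K. \<rho> k) = 0"
  using deg_comb[of \<rho>] by (simp add: comb_rho deg_def)

lemma K_eq: "K = Pos \<union> Neg"
  using rho_nz by (fastforce simp: Pos_def Neg_def)

lemma Pos_Neg_disjoint: "Pos \<inter> Neg = {}"
  by (auto simp: Pos_def Neg_def)

lemma finPos: "finite Pos" and finNeg: "finite Neg"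
  using finK by (auto simp: Pos_def Neg_def)

lemma PosD: "k \<in> Pos \<Longrightarrow> k \<in> K \<and> \<rho> k > 0" and NegD: "k \<in> Neg \<Longrightarrow> k \<in> K \<and> \<rho> k < 0"
  by (auto simp: Pos_def Neg_def)

lemma K_nonempty: "K \<noteq> {}" using cardK by auto

lemma Pos_nonempty: "Pos \<noteq> {}"
proof
  assume "Pos = {}"
  then have "\<rho> k < 0" if "k \<in> K" for k using that K_eq NegD by blast
  then have "(\<Sum>k\<in>K. \<rho> k) < (\<Sum>k\<in>K. 0)"
    using K_nonempty finK by (intro sum_strict_mono) auto
  then show False by (simp add: sum_rho)
qed

lemma Neg_nonempty: "Neg \<noteq> {}"
proof
  assume "Neg = {}"
  then have "\<rho> k > 0" if "k \<in> K" for k using that K_eq PosD by blast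
  then have "(\<Sum>k\<in>K. 0) < (\<Sum>k\<in>K. \<rho> k)"
    using K_nonempty finK by (intro sum_strict_mono) auto
  then show False by (simp add: sum_rho)
qed

lemma rcomb_surj: "\<exists>C. \<forall>x. x = rcomb (\<lambda>k. \<Sum>m\<in>UNIV. x $ m * of_int (C m k))"
proof -
  have "\<exists>C. \<forall>m. axis m 1 = comb (C m)" by (intro choice allI comb_surj)
  then obtain C where C: "\<And>m. axis m 1 = comb (C m)" by blast
  have "x = rcomb (\<lambda>k. \<Sum>m\<in>UNIV. x $ m * of_int (C m k))" for x
  proof -
    have "x = (\<Sum>m\<in>UNIV. x $ m *\<^sub>R axis m 1)"
      by (simp add: vec_eq_iff sum_component axis_def if_distrib cong: if_cong)
    also have "\<dots> = (\<Sum>m\<in>UNIV. x $ m *\<^sub>R rcomb (\<lambda>k. of_int (C m k)))"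
      by (metis C real_vec_axis real_vec_comb)
    also have "\<dots> = rcomb (\<lambda>k. \<Sum>m\<in>UNIV. x $ m * of_int (C m k))"
      unfolding rcomb_def scaleR_sum_right scaleR_sum_left by (subst sum.swap) simp
    finally show ?thesis .
  qed
  then show ?thesis by blast
qed

text \<open>
  Without one generator there remain \<open>d + r\<close> vectors that still span, hence are independent. So a
  relation that vanishes at one index vanishes, and every relation is a multiple of \<open>\<rho>\<close>.
\<close>

lemma rcomb_eq_0D:
  assumes "rcomb q = 0"
  shows "\<exists>s. \<forall>k\<in>K. q k = s * of_int (\<rho> k)"
proof -
  obtain k0 where k0: "k0 \<in> K" using K_nonempty by auto
  define s where "s = q k0 / of_int (\<rho> k0)"
  define p where "p k = q k - s * of_int (\<rho> k)" for k
  define v where "v = (\<lambda>k. real_vec (g k))"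
  define K' where "K' = K - {k0}"
  have K': "finite K'" "card K' = CARD('m)" using finK cardK k0 by (auto simp: K'_def)
  have p0: "p k0 = 0" using rho_nz[OF k0] by (simp add: p_def s_def)
  have "rcomb p = 0" unfolding p_def using assms by (simp add: rcomb_linear rcomb_rho)
  then have sum0: "(\<Sum>k\<in>K'. p k *\<^sub>R v k) = 0"
    unfolding rcomb_def K'_def by (subst (asm) sum.remove[OF finK k0]) (simp add: p0 v_def)
  have "v k0 \<in> span (v ` K')"
  proof -
    have "of_int (\<rho> k0) *\<^sub>R v k0 = - (\<Sum>k\<in>K'. of_int (\<rho> k) *\<^sub>R v k)"
      using rcomb_rho unfolding rcomb_def K'_def v_def
      by (subst (asm) sum.remove[OF finK k0]) (simp add: add_eq_0_iff2)
    then have "v k0 = (1 / of_int (\<rho> k0)) *\<^sub>R (- (\<Sum>k\<in>K'. of_int (\<rho> k) *\<^sub>R v k))"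
      using rho_nz[OF k0] by (metis divide_self_if mult.commute of_int_eq_0_iff scaleR_one scaleR_scaleR times_divide_eq_right mult_1)
    also have "\<dots> \<in> span (v ` K')"
      by (intro span_scale span_neg span_sum span_base imageI)
    finally show ?thesis .
  qed
  then have vk: "v k \<in> span (v ` K')" if "k \<in> K" for k
    using that by (cases "k = k0") (auto intro: span_base simp: K'_def)
  obtain C where C: "\<And>x. x = rcomb (\<lambda>k. \<Sum>m\<in>UNIV. x $ m * of_int (C m k))"
    using rcomb_surj by blast
  have sp: "x \<in> span (v ` K')" for x
  proof -
    have "x = (\<Sum>k\<in>K. (\<Sum>m\<in>UNIV. x $ m * of_int (C m k)) *\<^sub>R v k)"
      by (subst C) (simp add: rcomb_def v_def)
    also have "\<dots> \<in> span (v ` K')" by (intro span_sum span_scale vk)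
    finally show ?thesis .
  qed
  then have sp': "UNIV \<subseteq> span (v ` K')" by blast
  have "CARD('m) \<le> card (v ` K')"
    using dim_le_card[OF sp'] K'(1) by simp
  then have cd: "card (v ` K') = CARD('m)" using card_image_le[OF K'(1), of v] K'(2) by simp
  then have inj: "inj_on v K'" using K' by (simp add: eq_card_imp_inj_on)
  have ind: "independent (v ` K')"
    using card_le_dim_spanning[OF _ sp'] K'(1) cd by simp
  have "\<forall>k\<in>K'. p k = 0"
  proof -
    have "(\<Sum>x\<in>v ` K'. p (inv_into K' v x) *\<^sub>R x) = 0"
      using sum0 by (simp add: sum.reindex[OF inj] inv_into_f_f[OF inj])
    then have "\<forall>x\<in>v ` K'. p (inv_into K' v x) = 0"
      using independentD[OF ind, of "v ` K'" "\<lambda>x. p (inv_into K' v x)"] K'(1) by auto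
    then show ?thesis by (simp add: inv_into_f_f[OF inj])
  qed
  then have "\<forall>k\<in>K. p k = 0" using p0 by (auto simp: K'_def)
  then show ?thesis by (intro exI[of _ s]) (simp add: p_def)
qed

text \<open>
  The denominator of \<open>s\<close> in lowest terms divides all positive \<open>\<rho> k\<close>.
\<close>

lemma integer_multiplier:
  fixes s :: real
  assumes "\<And>k. k \<in> Pos \<Longrightarrow> s * of_int (\<rho> k) \<in> \<int>"
  shows "s \<in> \<int>"
proof -
  obtain k0 where k0: "k0 \<in> Pos" using Pos_nonempty by auto
  obtain q0 where "s * of_int (\<rho> k0) = of_int q0" using assms[OF k0] by (auto elim: Ints_cases)
  then have "s = of_int q0 / of_int (\<rho> k0)" using PosD[OF k0] by (simp add: field_simps)
  then have "s \<in> \<rat>" by simp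
  then obtain p b where ab: "s = of_int p / of_int b" "b > 0" "coprime p b"
    by (metis Rats_cases')
  have "b dvd \<rho> k" if k: "k \<in> K" "\<rho> k > 0" for k
  proof -
    have "s * of_int (\<rho> k) \<in> \<int>" using assms k by (simp add: Pos_def)
    then obtain q where "s * of_int (\<rho> k) = of_int q" by (auto elim: Ints_cases)
    then have "of_int (b * q) = (of_int (p * \<rho> k) :: real)"
      using ab(1,2) by (simp add: field_simps)
    then have "b * q = p * \<rho> k" using of_int_eq_iff by blast
    then have "b dvd p * \<rho> k" by (metis dvd_triv_left)
    then show ?thesis using ab(3) by (simp add: coprime_commute coprime_dvd_mult_right_iff)
  qed
  then have "b dvd 1" by (intro rho_gcd)
  then have "b = 1" using ab(2) by simp
  then show ?thesis using ab(1) by simp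
qed

lemma comb_eq_0D:
  assumes "comb q = 0"
  shows "\<exists>s. \<forall>k\<in>K. q k = s * \<rho> k"
proof -
  have "rcomb (\<lambda>k. of_int (q k)) = 0" using real_vec_comb[of q] assms by simp
  from rcomb_eq_0D[OF this] obtain s
    where s: "\<And>k. k \<in> K \<Longrightarrow> of_int (q k) = s * (of_int (\<rho> k) :: real)"
    by blast
  have "s \<in> \<int>"
  proof (rule integer_multiplier)
    fix k assume "k \<in> Pos"
    then have "s * of_int (\<rho> k) = of_int (q k)" using s[of k] PosD[of k] by simp
    then show "s * of_int (\<rho> k) \<in> \<int>" by simp
  qed
  then obtain z where "s = of_int z" by (auto elim: Ints_cases)
  then have "\<forall>k\<in>K. q k = z * \<rho> k"
    using s by (simp flip: of_int_mult)
  then show ?thesis by blast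
qed

lemma comb_eqD:
  assumes "comb c = comb c'"
  shows "\<exists>s. \<forall>k\<in>K. c' k = c k + s * \<rho> k"
proof -
  have "comb (\<lambda>k. c' k - c k) = 0" using assms by (simp add: comb_linear)
  from comb_eq_0D[OF this] obtain s where "\<forall>k\<in>K. c' k - c k = s * \<rho> k" by blast
  then show ?thesis by (intro exI[of _ s]) (auto simp: algebra_simps)
qed

text \<open>
  The generators satisfy no other relation than \<open>\<rho>\<close>, so a linear functional can be prescribed on them
  subject to this relation only. It serves to replace the \<open>F\<^sub>m\<close> by combinations adapted to the
  generators.
\<close>

lemma functional_exists:
  fixes \<kappa> :: "'k \<Rightarrow> complex"
  assumes "(\<Sum>k\<in>K. of_int (\<rho> k) * \<kappa> k) = 0"
  shows "\<exists>c. \<forall>k\<in>K. (\<Sum>m\<in>UNIV. c m * of_int (g k $ m)) = \<kappa> k"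
proof -
  have "\<exists>C. \<forall>m. axis m 1 = comb (C m)" by (intro choice allI comb_surj)
  then obtain C where C: "\<And>m. axis m 1 = comb (C m)" by blast
  have "(\<Sum>m\<in>UNIV. (\<Sum>k\<in>K. of_int (C m k) * \<kappa> k) * of_int (g l $ m)) = \<kappa> l" if l: "l \<in> K" for l
  proof -
    define E where "E k = (\<Sum>m\<in>UNIV. g l $ m * C m k)" for k
    have "comb E = (\<Sum>m\<in>UNIV. g l $ m *s comb (C m))"
      by (simp add: comb_def vec_eq_iff sum_component E_def sum_distrib_left sum_distrib_right,
          subst sum.swap) (simp add: mult_ac)
    also have "\<dots> = (\<Sum>m\<in>UNIV. g l $ m *s axis m 1)" by (simp add: C)
    also have "\<dots> = g l"
      by (simp add: vec_eq_iff sum_component axis_def if_distrib cong: if_cong)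
    also have "g l = comb (\<lambda>k. if k = l then 1 else 0)"
      by (simp add: comb_single[OF l])
    finally obtain s where s: "\<forall>k\<in>K. E k = (if k = l then 1 else 0) + s * \<rho> k"
      using comb_eqD[of "\<lambda>k. if k = l then 1 else 0" E] by force
    have "(\<Sum>m\<in>UNIV. (\<Sum>k\<in>K. of_int (C m k) * \<kappa> k) * of_int (g l $ m)) = (\<Sum>k\<in>K. of_int (E k) * \<kappa> k)"
      unfolding E_def of_int_sum sum_distrib_right
      by (subst sum.swap) (simp add: mult_ac)
    also have "\<dots> = (\<Sum>k\<in>K. (if k = l then \<kappa> k else 0) + of_int s * (of_int (\<rho> k) * \<kappa> k))"
      using s by (intro sum.cong) (auto simp: algebra_simps)
    also have "\<dots> = \<kappa> l"
      using l finK assms by (simp add: sum.distrib sum_distrib_left[symmetric])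
    finally show ?thesis .
  qed
  then show ?thesis by (intro exI[of _ "\<lambda>m. \<Sum>k\<in>K. of_int (C m k) * \<kappa> k"]) blast
qed

end

section \<open>Lattice points of the cone and their normal coordinates\<close>

context circuit
begin

definition pcone :: "(real ^ 'm) set" where
  "pcone = {rcomb c | c. \<forall>k\<in>K. c k \<ge> 0}"

lemma real_vec_gen: "k \<in> K \<Longrightarrow> real_vec (g k) = rcomb (\<lambda>l. if l = k then 1 else 0)"
  using real_vec_comb[of "\<lambda>l. if l = k then 1 else 0"] comb_single[of k 1]
  by (simp add: if_distrib[of real_of_int] cong: if_cong)

lemma gen_in_pcone: "k \<in> K \<Longrightarrow> real_vec (g k) \<in> pcone"
  unfolding pcone_def using real_vec_gen[of k] by fastforce

lemma cayley_cone_eq: "cayley_cone J A = pcone"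
proof
  have conv: "convex pcone"
  proof (rule convexI)
    fix x y and u v :: real
    assume "x \<in> pcone" "y \<in> pcone" and uv: "u \<ge> 0" "v \<ge> 0"
    then obtain c c' where c: "x = rcomb c" "\<forall>k\<in>K. c k \<ge> 0" "y = rcomb c'" "\<forall>k\<in>K. c' k \<ge> 0"
      by (auto simp: pcone_def)
    have "u *\<^sub>R x + v *\<^sub>R y = rcomb (\<lambda>k. u * c k + v * c' k)" by (simp add: c rcomb_linear)
    then show "u *\<^sub>R x + v *\<^sub>R y \<in> pcone"
      unfolding pcone_def using c uv by fastforce
  qed
  have "convex hull (real_vec ` g ` K) \<subseteq> pcone"
    using gen_in_pcone by (intro hull_minimal conv) blast
  moreover have "s *\<^sub>R x \<in> pcone" if s: "s \<ge> 0" and x: "x \<in> pcone" for s x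
  proof -
    obtain c where c: "x = rcomb c" "\<forall>k\<in>K. c k \<ge> 0" using x by (auto simp: pcone_def)
    then have "s *\<^sub>R x = rcomb (\<lambda>k. s * c k)" by (simp add: rcomb_linear)
    then show ?thesis using c s unfolding pcone_def by fastforce
  qed
  ultimately show "cayley_cone J A \<subseteq> pcone"
    unfolding cayley_cone_def polytope cone_hull_expl by blast
next
  show "pcone \<subseteq> cayley_cone J A"
  proof
    fix x assume "x \<in> pcone"
    then obtain c where c: "x = rcomb c" "\<forall>k\<in>K. c k \<ge> 0" by (auto simp: pcone_def)
    define s where "s = (\<Sum>k\<in>K. c k)"
    show "x \<in> cayley_cone J A"
    proof (cases "s = 0")
      case True
      then have "\<forall>k\<in>K. c k = 0" using c finK by (simp add: s_def sum_nonneg_eq_0_iff)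
      then have "x = 0" by (simp add: c(1) rcomb_def)
      moreover obtain k where "k \<in> K" using K_nonempty by auto
      then have "real_vec (g k) \<in> cayley_polytope J A" unfolding polytope by (simp add: hull_inc)
      ultimately show ?thesis unfolding cayley_cone_def cone_hull_expl
        by (intro CollectI exI[of _ 0] exI[of _ "real_vec (g k)"]) auto
    next
      case False
      then have s: "s > 0" using c sum_nonneg[of K c] by (simp add: s_def order_le_less)
      have "(\<Sum>k\<in>K. (c k / s) *\<^sub>R real_vec (g k)) \<in> convex hull (real_vec ` g ` K)"
        using c s finK by (intro convex_sum convex_convex_hull)
          (auto simp: hull_inc simp flip: sum_divide_distrib s_def)
      moreover have "x = s *\<^sub>R (\<Sum>k\<in>K. (c k / s) *\<^sub>R real_vec (g k))"
        using s by (simp add: c(1) rcomb_def scaleR_sum_right)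
      ultimately show ?thesis unfolding cayley_cone_def polytope cone_hull_expl
        using s by (intro CollectI exI[of _ s] exI[of _ "\<Sum>k\<in>K. (c k / s) *\<^sub>R real_vec (g k)"]) auto
    qed
  qed
qed

text \<open>
  A point with positive coordinates is interior since the coordinates of nearby points can be chosen
  to depend continuously on the point; conversely, a small multiple of the sum of all generators
  can be subtracted from an interior point.
\<close>

lemma interior_pcone: "interior pcone = {rcomb c | c. \<forall>k\<in>K. c k > 0}"
proof (intro equalityI subsetI)
  fix x assume "x \<in> interior pcone"
  then obtain e where e: "e > 0" "ball x e \<subseteq> pcone" by (auto simp: mem_interior)
  define G where "G = rcomb (\<lambda>k. 1)"
  define t where "t = e / 2 / (1 + norm G)"
  have n: "0 < 1 + norm G" by (simp add: add_pos_nonneg)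
  have t: "t > 0" using e(1) n by (simp add: t_def)
  have "t * norm G \<le> t * (1 + norm G)" using t by simp
  also have "\<dots> = e / 2"
    unfolding t_def by (rule nonzero_eq_divide_eq[THEN iffD1]) (use n in auto)
  also have "\<dots> < e" using e(1) by simp
  finally have "x - t *\<^sub>R G \<in> ball x e" using t by (simp add: dist_norm)
  then have "x - t *\<^sub>R G \<in> pcone" using e(2) by blast
  then obtain c where c: "x - t *\<^sub>R G = rcomb c" "\<forall>k\<in>K. c k \<ge> 0" by (auto simp: pcone_def)
  have "x = rcomb (\<lambda>k. c k + t * 1)"
    using c(1) unfolding rcomb_linear G_def by (simp add: algebra_simps)
  moreover have "\<forall>k\<in>K. c k + t * 1 > 0" using c(2) t by (auto simp: add_nonneg_pos)
  ultimately show "x \<in> {rcomb c | c. \<forall>k\<in>K. c k > 0}" by blast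
next
  fix x assume "x \<in> {rcomb c | c. \<forall>k\<in>K. c k > 0}"
  then obtain c where c: "x = rcomb c" "\<forall>k\<in>K. c k > 0" by auto
  obtain C where C: "\<And>x. x = rcomb (\<lambda>k. \<Sum>m\<in>UNIV. x $ m * of_int (C m k))"
    using rcomb_surj by blast
  define c' where "c' y k = c k + (\<Sum>m\<in>UNIV. (y - x) $ m * of_int (C m k))" for y k
  have c': "y = rcomb (c' y)" for y
    using C[of "y - x"] c(1) unfolding c'_def rcomb_linear by (simp add: algebra_simps)
  have "open (\<Inter>k\<in>K. {y. 0 < c' y k})"
    unfolding c'_def using finK by (intro open_INT ballI open_Collect_less continuous_intros) auto
  moreover have "(\<Inter>k\<in>K. {y. 0 < c' y k}) \<subseteq> pcone"
    using c' K_nonempty unfolding pcone_def by (fastforce intro: less_imp_le)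
  moreover have "x \<in> (\<Inter>k\<in>K. {y. 0 < c' y k})" using c(2) by (simp add: c'_def)
  ultimately show "x \<in> interior pcone" using interior_maximal by blast
qed

definition inC :: "int ^ 'm \<Rightarrow> bool" where "inC u \<longleftrightarrow> real_vec u \<in> cayley_cone J A"
definition inI :: "int ^ 'm \<Rightarrow> bool" where "inI u \<longleftrightarrow> real_vec u \<in> interior (cayley_cone J A)"

lemma rcomb_eqD:
  assumes "rcomb c = rcomb c'" shows "\<exists>s. \<forall>k\<in>K. c' k = c k + s * of_int (\<rho> k)"
proof -
  have "rcomb (\<lambda>k. c' k - c k) = 0" using assms by (simp add: rcomb_linear)
  from rcomb_eq_0D[OF this] obtain s where "\<forall>k\<in>K. c' k - c k = s * of_int (\<rho> k)" by blast
  then show ?thesis by (intro exI[of _ s]) (auto simp: algebra_simps)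
qed

lemma inC_comb: "inC (comb c) \<longleftrightarrow> (\<exists>s::real. \<forall>k\<in>K. of_int (c k) + s * of_int (\<rho> k) \<ge> 0)"
proof
  assume "inC (comb c)"
  then obtain c' where "rcomb (\<lambda>k. of_int (c k)) = rcomb c'" "\<forall>k\<in>K. c' k \<ge> 0"
    by (auto simp: inC_def cayley_cone_eq pcone_def real_vec_comb)
  then show "\<exists>s::real. \<forall>k\<in>K. of_int (c k) + s * of_int (\<rho> k) \<ge> 0"
    using rcomb_eqD by fastforce
next
  assume "\<exists>s::real. \<forall>k\<in>K. of_int (c k) + s * of_int (\<rho> k) \<ge> 0"
  then obtain s where "\<forall>k\<in>K. of_int (c k) + s * of_int (\<rho> k) \<ge> (0::real)" by blast
  then show "inC (comb c)"
    unfolding inC_def cayley_cone_eq pcone_def real_vec_comb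
    using rcomb_shift[of "\<lambda>k. of_int (c k)" s, symmetric] by blast
qed

lemma inI_comb: "inI (comb c) \<longleftrightarrow> (\<exists>s::real. \<forall>k\<in>K. of_int (c k) + s * of_int (\<rho> k) > 0)"
proof
  assume "inI (comb c)"
  then obtain c' where "rcomb (\<lambda>k. of_int (c k)) = rcomb c'" "\<forall>k\<in>K. c' k > 0"
    by (auto simp: inI_def cayley_cone_eq interior_pcone real_vec_comb)
  then show "\<exists>s::real. \<forall>k\<in>K. of_int (c k) + s * of_int (\<rho> k) > 0"
    using rcomb_eqD by fastforce
next
  assume "\<exists>s::real. \<forall>k\<in>K. of_int (c k) + s * of_int (\<rho> k) > 0"
  then obtain s where "\<forall>k\<in>K. of_int (c k) + s * of_int (\<rho> k) > (0::real)" by blast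
  then show "inI (comb c)"
    unfolding inI_def cayley_cone_eq interior_pcone real_vec_comb
    using rcomb_shift[of "\<lambda>k. of_int (c k)" s, symmetric] by blast
qed

lemma inC_0: "inC 0"
  using inC_comb[of "\<lambda>k. 0"] by (auto simp: comb_def intro: exI[of _ 0])

lemma inC_gen: "k \<in> K \<Longrightarrow> inC (g k)"
  using gen_in_pcone by (simp add: inC_def cayley_cone_eq)

lemma inC_add:
  assumes "inC u" "inC v" shows "inC (u + v)"
proof -
  obtain c c' where c: "u = comb c" "v = comb c'" using comb_surj by metis
  from assms obtain s s' :: real where
    s: "\<forall>k\<in>K. of_int (c k) + s * of_int (\<rho> k) \<ge> 0" "\<forall>k\<in>K. of_int (c' k) + s' * of_int (\<rho> k) \<ge> 0"
    unfolding c inC_comb by blast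
  have "\<forall>k\<in>K. of_int (c k + c' k) + (s + s') * of_int (\<rho> k) \<ge> 0"
    using s by (force simp: algebra_simps)
  then show ?thesis unfolding c comb_linear(1)[symmetric] inC_comb by blast
qed

lemma inI_add:
  assumes "inI u" "inC v" shows "inI (u + v)"
proof -
  obtain c c' where c: "u = comb c" "v = comb c'" using comb_surj by metis
  from assms obtain s s' :: real where
    s: "\<forall>k\<in>K. of_int (c k) + s * of_int (\<rho> k) > 0" "\<forall>k\<in>K. of_int (c' k) + s' * of_int (\<rho> k) \<ge> 0"
    unfolding c inC_comb inI_comb by blast
  have "\<forall>k\<in>K. of_int (c k + c' k) + (s + s') * of_int (\<rho> k) > 0"
    using s by (force simp: algebra_simps)
  then show ?thesis unfolding c comb_linear(1)[symmetric] inI_comb by blast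
qed

text \<open>
  The inequalities say \<open>0 \<le> max (-c\<^sub>k / \<rho>\<^sub>k) < 1\<close>, the maximum being over the positive part of the
  circuit: the shifts \<open>s\<close> that make the positive part of \<open>c + s \<rho>\<close> positive begin in \<open>[0, 1)\<close>.
\<close>

definition normal :: "('k \<Rightarrow> int) \<Rightarrow> bool" where
  "normal c \<longleftrightarrow> (\<forall>k\<in>Pos. c k > - \<rho> k) \<and> (\<exists>k\<in>Pos. c k \<le> 0)"

lemma normal_exists: "\<exists>c. u = comb c \<and> normal c"
proof -
  obtain c where c: "u = comb c" using comb_surj by blast
  define f where "f k = (- c k) div \<rho> k" for k
  define t where "t = Max (f ` Pos)"
  have t1: "f k \<le> t" if "k \<in> Pos" for k using that finPos by (simp add: t_def)
  have "t \<in> f ` Pos" unfolding t_def using finPos Pos_nonempty by (intro Max_in) auto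
  then obtain k0 where k0: "k0 \<in> Pos" "t = f k0" by auto
  have fl: "f k * \<rho> k \<le> - c k" "- c k < f k * \<rho> k + \<rho> k" if "k \<in> Pos" for k
  proof -
    have "\<rho> k > 0" using that PosD by blast
    from pos_mod_bound[OF this, of "- c k"] pos_mod_sign[OF this, of "- c k"]
    show "f k * \<rho> k \<le> - c k" "- c k < f k * \<rho> k + \<rho> k"
      using div_mult_mod_eq[of "- c k" "\<rho> k"] unfolding f_def by linarith+
  qed
  have "c k + t * \<rho> k > - \<rho> k" if "k \<in> Pos" for k
  proof -
    have "f k * \<rho> k \<le> t * \<rho> k" using t1[OF that] PosD[OF that] by (simp add: mult_right_mono)
    then show ?thesis using fl[OF that] by linarith
  qed
  moreover have "c k0 + t * \<rho> k0 \<le> 0" using fl(1)[OF k0(1)] k0(2) by simp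
  ultimately have "normal (\<lambda>k. c k + t * \<rho> k)" using k0(1) unfolding normal_def by blast
  then show ?thesis using c comb_shift[of c t] by metis
qed

lemma normal_unique:
  assumes "comb c = comb c'" "normal c" "normal c'" "k \<in> K" shows "c k = c' k"
proof -
  have less: "s \<le> 0" if s: "\<forall>k\<in>K. c' k = c k + s * \<rho> k" and n: "normal c" "normal c'" for s c c'
  proof (rule ccontr)
    assume "\<not> s \<le> 0"
    obtain k where k: "k \<in> Pos" "c' k \<le> 0" using n(2) by (auto simp: normal_def)
    have "\<rho> k > 0" using PosD[OF k(1)] by simp
    then have "\<rho> k \<le> s * \<rho> k" using \<open>\<not> s \<le> 0\<close> by (simp add: mult_le_cancel_right1)
    moreover have "c k > - \<rho> k" using n(1) k(1) by (auto simp: normal_def)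
    ultimately show False using s[rule_format, of k] k(2) PosD[OF k(1)] by linarith
  qed
  obtain s where s: "\<forall>k\<in>K. c' k = c k + s * \<rho> k" using comb_eqD[OF assms(1)] by blast
  then have "\<forall>k\<in>K. c k = c' k + (- s) * \<rho> k" by simp
  then have "s = 0" using less[OF s assms(2,3)] less[of c c' "- s"] assms(2,3) by force
  then show ?thesis using s assms(4) by simp
qed

text \<open>
  If normality were lost, all coordinates on the positive part would have become positive. Those
  on the negative part are positive anyway, because the shift \<open>s\<close> that exhibits interiority is
  positive. Then \<open>d + r + 1\<close> positive integers would add up to \<open>d + r\<close>.
\<close>

lemma normal_step:
  assumes "normal c" "inI (comb c)" "deg (comb c) + 1 = int CARD('m)" "l \<in> K"
  shows "normal (c(l := c l + 1))"
proof (rule ccontr)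
  define c' where "c' = c(l := c l + 1)"
  assume "\<not> normal (c(l := c l + 1))"
  then have "\<not> normal c'" by (simp add: c'_def)
  moreover have "\<forall>k\<in>Pos. c' k > - \<rho> k" using assms(1) by (auto simp: c'_def normal_def)
  ultimately have "\<not> (\<exists>k\<in>Pos. c' k \<le> 0)" unfolding normal_def by blast
  then have pos: "c' k \<ge> 1" if "k \<in> Pos" for k
    using that by force
  obtain s :: real where s: "\<And>k. k \<in> K \<Longrightarrow> of_int (c k) + s * of_int (\<rho> k) > 0"
    using assms(2) unfolding inI_comb by blast
  obtain k where k: "k \<in> Pos" "c k \<le> 0" using assms(1) by (auto simp: normal_def)
  have "s * of_int (\<rho> k) > 0" using s[of k] k PosD[OF k(1)] by linarith
  then have "s > 0" using PosD[OF k(1)] by (simp add: zero_less_mult_iff)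
  have neg: "c' k \<ge> 1" if "k \<in> Neg" for k
  proof -
    have "s * of_int (\<rho> k) < 0" using \<open>s > 0\<close> NegD[OF that] by (simp add: mult_pos_neg)
    then have "of_int (c k) > (0 :: real)" using s[of k] NegD[OF that] by linarith
    then have "c k > 0" by simp
    then show ?thesis by (auto simp: c'_def)
  qed
  have "(\<Sum>k\<in>K. 1) \<le> (\<Sum>k\<in>K. c' k)"
    using pos neg K_eq by (intro sum_mono) blast
  moreover have "(\<Sum>k\<in>K. c' k) = int CARD('m)"
    using assms(3) comb_add_gen[OF assms(4), of c 1] deg_gen[OF assms(4)]
    unfolding c'_def deg_comb[symmetric] by simp
  ultimately show False using cardK by simp
qed

end

section \<open>A functional that annihilates the Jacobian ideal\<close>

definition lin_ext :: "('a \<Rightarrow> complex) \<Rightarrow> ('a \<Rightarrow>\<^sub>0 complex) \<Rightarrow> complex" where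
  "lin_ext f h = (\<Sum>u\<in>keys h. lookup h u * f u)"

lemma lin_ext_superset:
  assumes "finite X" "keys h \<subseteq> X"
  shows "lin_ext f h = (\<Sum>u\<in>X. lookup h u * f u)"
  unfolding lin_ext_def using assms by (intro sum.mono_neutral_left) (auto simp: in_keys_iff)

lemma lin_ext_add: "lin_ext f (h + h') = lin_ext f h + lin_ext f h'"
proof -
  let ?X = "keys h \<union> keys h'"
  have "keys (h + h') \<subseteq> ?X" by (rule keys_add)
  then show ?thesis
    using lin_ext_superset[of ?X] by (simp add: lookup_add algebra_simps sum.distrib)
qed

lemma lin_ext_0 [simp]: "lin_ext f 0 = 0"
  by (simp add: lin_ext_def)

lemma lin_ext_sum: "lin_ext f (sum h S) = (\<Sum>i\<in>S. lin_ext f (h i))"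
  by (induction S rule: infinite_finite_induct) (simp_all add: lin_ext_add)

lemma lin_ext_single [simp]: "lin_ext f (single u c) = c * f u"
  by (simp add: lin_ext_def)

lemma monomial_expansion:
  "h = (\<Sum>u\<in>keys h. single u (lookup h u))"
proof (rule poly_mapping_eqI)
  fix k
  show "lookup h k = lookup
      (\<Sum>u\<in>keys h. single u (lookup h u)) k"
    by (cases "k \<in> keys h") (auto simp: lookup_sum lookup_single when_def in_keys_iff)
qed

lemma keys_sum_monomials:
  assumes "u \<in> keys (\<Sum>\<alpha>\<in>X. single (f \<alpha>) (c \<alpha>))"
  shows "\<exists>\<alpha>\<in>X. u = f \<alpha>"
proof (rule ccontr)
  assume "\<not> ?thesis"
  then have "lookup (\<Sum>\<alpha>\<in>X. single (f \<alpha>) (c \<alpha>)) u = 0"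
    unfolding lookup_sum by (intro sum.neutral) (auto simp: lookup_single when_def)
  then show False using assms by (simp add: in_keys_iff)
qed

lemma lin_ext_single_mult:
  "lin_ext f (single v c * h)
     = (\<Sum>u\<in>keys h. c * lookup h u * f (v + u))"
proof -
  have "single v c * h
    = (\<Sum>u\<in>keys h. single (v + u) (c * lookup h u))"
    using arg_cong[OF monomial_expansion[of h], of "(*) (single v c)"]
    by (simp only: sum_distrib_left mult_single)
  then show ?thesis by (simp add: lin_ext_sum)
qed

lemma lin_ext_lconst_mult: "lin_ext f (lconst c * h) = c * lin_ext f h"
  unfolding lconst_def lin_ext_single_mult by (simp add: lin_ext_def sum_distrib_left mult_ac)

lemma lookup_log_deriv:
  "lookup (log_deriv m h) u = of_int (u $ m) * lookup h u"
  by (simp add: log_deriv_def lookup_mapp when_def in_keys_iff)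

lemma log_deriv_sum: "log_deriv m (sum h S) = (\<Sum>i\<in>S. log_deriv m (h i))"
  by (rule poly_mapping_eqI) (simp add: lookup_log_deriv lookup_sum sum_distrib_left)

lemma log_deriv_single:
  "log_deriv m (single u c) = single u (of_int (u $ m) * c)"
  by (rule poly_mapping_eqI) (simp add: lookup_log_deriv lookup_single when_def)

context circuit
begin

lemma sum_K: "(\<Sum>k\<in>K. f k) = (\<Sum>k\<in>Pos. f k) + (\<Sum>k\<in>Neg. f k)"
  using sum.union_disjoint[OF finPos finNeg Pos_Neg_disjoint, of f] by (simp only: K_eq[symmetric])

lemma prod_K: "(\<Prod>k\<in>K. f k) = (\<Prod>k\<in>Pos. f k) * (\<Prod>k\<in>Neg. f k)"
  using prod.union_disjoint[OF finPos finNeg Pos_Neg_disjoint, of f] by (simp only: K_eq[symmetric])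

lemma card_K: "card K = card Pos + card Neg"
  using card_Un_disjoint[OF finPos finNeg Pos_Neg_disjoint] by (simp only: K_eq[symmetric])

end

locale circuit_polynomial = circuit J A K g \<rho>
  for J :: "'m::finite set" and A and K :: "'k set" and g and \<rho> +
  fixes a :: "'k \<Rightarrow> complex"
begin

definition F :: "'m laurent" where
  "F = (\<Sum>k\<in>K. single (g k) (a k))"

lemma log_deriv_F:
  "log_deriv m F = (\<Sum>k\<in>K. single (g k) (of_int (g k $ m) * a k))"
  by (simp add: F_def log_deriv_sum log_deriv_single)

lemma S_ring_iff: "h \<in> S_ring J A \<longleftrightarrow> (\<forall>u\<in>keys h. inC u)"
  by (simp add: S_ring_def inC_def)

lemma I_ideal_iff: "h \<in> I_ideal J A \<longleftrightarrow> (\<forall>u\<in>keys h. inI u)"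
  by (simp add: I_ideal_def inI_def)

lemma I_degree_iff:
  "h \<in> I_degree J A l \<longleftrightarrow> (\<forall>u\<in>keys h. inI u \<and> deg u = int l)"
  by (auto simp: I_degree_def I_ideal_def inI_def deg_def)

end

text \<open>
  If the positive part of the circuit is a single index, which is the case \<open>d = 0\<close>, the coefficient
  there may vanish although \<open>F\<close> is regular. The normal coordinate at this index is then always 0, so
  any nonzero \<open>\<gamma>\<close> will do.
\<close>

locale circuit_residue = circuit_polynomial J A K g \<rho> a
  for J :: "'m::finite set" and A and K :: "'k set" and g and \<rho> and a +
  fixes \<gamma> :: "'k \<Rightarrow> complex"
  assumes gamma_nz: "\<And>k. k \<in> K \<Longrightarrow> \<gamma> k \<noteq> 0"
    and a_gamma_Neg: "\<And>k. k \<in> Neg \<Longrightarrow> a k * \<gamma> k = - of_int (\<rho> k)"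
    and a_gamma_Pos: "\<And>k. k \<in> Pos \<Longrightarrow> card Pos > 1 \<Longrightarrow> a k * \<gamma> k = - of_int (\<rho> k)"
begin

definition wt :: "int ^ 'm \<Rightarrow> complex" where
  "wt u = (let c = SOME c. u = comb c \<and> normal c in \<Prod>k\<in>K. \<gamma> k powi c k)"

lemma wt_comb:
  assumes "normal c" shows "wt (comb c) = (\<Prod>k\<in>K. \<gamma> k powi c k)"
proof -
  define c' where "c' = (SOME c'. comb c = comb c' \<and> normal c')"
  have "comb c = comb c' \<and> normal c'"
    unfolding c'_def by (rule someI[of _ c]) (simp add: assms)
  then have "c k = c' k" if "k \<in> K" for k using normal_unique[OF _ assms] that by blast
  then show ?thesis by (simp add: wt_def Let_def flip: c'_def)
qed

lemma wt_nz: "wt u \<noteq> 0"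
proof -
  obtain c where c: "u = comb c" "normal c" using normal_exists by blast
  show ?thesis unfolding c(1) wt_comb[OF c(2)] using gamma_nz finK by (simp add: power_int_not_zero)
qed

lemma wt_step:
  assumes "inI u" "deg u + 1 = int CARD('m)" "l \<in> K"
  shows "wt (u + g l) = wt u * \<gamma> l"
proof -
  obtain c where c: "u = comb c" "normal c" using normal_exists by blast
  have n: "normal (c(l := c l + 1))" using normal_step[OF c(2)] assms unfolding c(1) by blast
  have "u + g l = comb (c(l := c l + 1))" using comb_add_gen[OF assms(3), of c 1] by (simp add: c(1))
  then have "wt (u + g l) = (\<Prod>k\<in>K. \<gamma> k powi (c(l := c l + 1)) k)" using wt_comb[OF n] by simp
  also have "\<dots> = \<gamma> l powi (c l + 1) * (\<Prod>k\<in>K - {l}. \<gamma> k powi c k)"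
    by (subst prod.remove[OF finK assms(3)]) simp
  also have "\<gamma> l powi (c l + 1) = \<gamma> l powi (c l) * \<gamma> l"
    using gamma_nz[OF assms(3)] by (simp add: power_int_add_1)
  finally show ?thesis
    unfolding c(1) wt_comb[OF c(2)] by (subst prod.remove[OF finK assms(3)]) (simp add: mult_ac)
qed

lemma rho_1: 
  assumes "card Pos = 1" "k \<in> Pos" shows "\<rho> k = 1"
proof -
  have "Pos = {k}" using assms by (auto simp: card_1_singleton_iff)
  then have "l = k" if "l \<in> K" "\<rho> l > 0" for l using that unfolding Pos_def by blast
  then have "\<rho> k dvd 1" by (intro rho_gcd) simp
  then show ?thesis using PosD[OF assms(2)] by simp
qed

text \<open>
  There is no interior point of degree \<open>d + r - 1\<close> when the positive part is a single index: the
  normal coordinate of such a point is 0 there and at least 1 at the remaining \<open>d + r\<close> generators.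
\<close>

lemma a_gamma:
  assumes "inI u" "deg u + 1 = int CARD('m)" "k \<in> K"
  shows "a k * \<gamma> k = - of_int (\<rho> k)"
proof (cases "k \<in> Neg")
  case False
  then have k: "k \<in> Pos" using assms(3) K_eq by blast
  have "card Pos \<noteq> 1"
  proof
    assume 1: "card Pos = 1"
    then obtain k0 where k0: "Pos = {k0}" by (auto simp: card_1_singleton_iff)
    have r: "\<rho> k0 = 1" using rho_1[OF 1] k0 by simp
    obtain c where c: "u = comb c" "normal c" using normal_exists by blast
    have ck0: "c k0 = 0" using c(2) k0 r by (auto simp: normal_def)
    obtain s :: real where s: "\<And>k. k \<in> K \<Longrightarrow> of_int (c k) + s * of_int (\<rho> k) > 0"
      using assms(1) unfolding c(1) inI_comb by blast
    have "s > 0" using s[of k0] k0 r ck0 PosD[of k0] by auto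
    have "c k \<ge> 1" if "k \<in> Neg" for k
    proof -
      have "s * of_int (\<rho> k) < 0" using \<open>s > 0\<close> NegD[OF that] by (simp add: mult_pos_neg)
      then have "of_int (c k) > (0 :: real)" using s[of k] NegD[OF that] by linarith
      then show ?thesis by auto
    qed
    then have "(\<Sum>k\<in>Neg. 1) \<le> (\<Sum>k\<in>Neg. c k)" by (intro sum_mono) auto
    moreover have "(\<Sum>k\<in>K. c k) = c k0 + (\<Sum>k\<in>Neg. c k)"
      by (simp add: sum_K k0)
    moreover have "card K = 1 + card Neg"
      by (simp add: card_K 1)
    ultimately show False using assms(2) cardK ck0 by (simp add: c(1) deg_comb)
  qed
  moreover have "card Pos \<noteq> 0" using finPos Pos_nonempty by simp
  ultimately have "card Pos > 1" by linarith
  then show ?thesis using a_gamma_Pos k by simp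
qed (use a_gamma_Neg in simp)

definition res :: "'m laurent \<Rightarrow> complex" where
  "res = lin_ext (\<lambda>u. if deg u = int CARD('m) then wt u else 0)"

lemma sum_a_gamma:
  assumes "\<And>k. k \<in> K \<Longrightarrow> a k * \<gamma> k = - of_int (\<rho> k)"
  shows "(\<Sum>k\<in>K. of_int (g k $ m) * a k * \<gamma> k) = 0"
proof -
  have "(\<Sum>k\<in>K. of_int (g k $ m) * a k * \<gamma> k) = - of_int ((\<Sum>k\<in>K. \<rho> k *s g k) $ m)"
    unfolding sum_component of_int_sum sum_negf[symmetric]
    by (intro sum.cong refl) (use assms in \<open>simp add: mult.assoc\<close>)
  then show ?thesis using relation by simp
qed

text \<open>
  On \<open>t^u F\<^sub>m\<close> with \<open>u\<close> interior of degree \<open>d + r - 1\<close> the functional takes the value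
  \<open>wt u \<cdot> \<Sum> g\<^sub>k\<^sub>m a\<^sub>k \<gamma>\<^sub>k\<close>, which vanishes by the relation between the generators.
\<close>

lemma res_jacobian:
  assumes "h \<in> I_ideal J A" shows "res (log_deriv m F * h) = 0"
proof -
  define f where "f u = (if deg u = int CARD('m) then wt u else 0)" for u
  have "res (log_deriv m F * h) = (\<Sum>k\<in>K. \<Sum>u\<in>keys h.
      of_int (g k $ m) * a k * lookup h u * f (g k + u))"
    unfolding res_def log_deriv_F sum_distrib_right lin_ext_sum lin_ext_single_mult f_def ..
  also have "\<dots> = (\<Sum>u\<in>keys h. \<Sum>k\<in>K.
      of_int (g k $ m) * a k * lookup h u * f (g k + u))"
    by (rule sum.swap)
  also have "\<dots> = 0"
  proof (rule sum.neutral, rule ballI)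
    fix u assume "u \<in> keys h"
    then have u: "inI u" using assms by (simp add: I_ideal_iff)
    show "(\<Sum>k\<in>K. of_int (g k $ m) * a k * lookup h u * f (g k + u)) = 0"
    proof (cases "deg u + 1 = int CARD('m)")
      case True
      have "f (g k + u) = wt u * \<gamma> k" if "k \<in> K" for k
        using that True wt_step[OF u True that] by (simp add: f_def deg_gen add.commute)
      then have "(\<Sum>k\<in>K. of_int (g k $ m) * a k * lookup h u * f (g k + u))
        = lookup h u * wt u * (\<Sum>k\<in>K. of_int (g k $ m) * a k * \<gamma> k)"
        unfolding sum_distrib_left by (intro sum.cong refl) simp
      then show ?thesis using sum_a_gamma[of m] a_gamma[OF u True] by simp
    next
      case False
      then have "f (g k + u) = 0" if "k \<in> K" for k using that by (simp add: f_def deg_gen)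
      then show ?thesis by simp
    qed
  qed
  finally show ?thesis .
qed

end

section \<open>Connectedness of the interior points of degree d + r\<close>

context circuit
begin

text \<open>
  The coordinates of the points that are interior by means of all shifts slightly larger than \<open>\<sigma>\<close>.
\<close>

definition chamber :: "real \<Rightarrow> ('k \<Rightarrow> int) \<Rightarrow> bool" where
  "chamber \<sigma> c \<longleftrightarrow> (\<forall>k\<in>Pos. of_int (c k) + \<sigma> * of_int (\<rho> k) \<ge> 0)
     \<and> (\<forall>k\<in>Neg. of_int (c k) + \<sigma> * of_int (\<rho> k) > 0)"

lemma chamber_inI:
  assumes "chamber \<sigma> c" shows "inI (comb c)"
proof -
  define e where "e = Min ((\<lambda>k. (of_int (c k) + \<sigma> * of_int (\<rho> k)) / - of_int (\<rho> k)) ` Neg)"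
  have "e \<in> (\<lambda>k. (of_int (c k) + \<sigma> * of_int (\<rho> k)) / - of_int (\<rho> k)) ` Neg"
    unfolding e_def using finNeg Neg_nonempty by (intro Min_in) auto
  then obtain k0 where k0: "k0 \<in> Neg" "e = (of_int (c k0) + \<sigma> * of_int (\<rho> k0)) / - of_int (\<rho> k0)"
    by blast
  have e: "e > 0" unfolding k0(2)
    using assms k0(1) NegD[OF k0(1)] by (intro divide_pos_pos) (auto simp: chamber_def)
  have "of_int (c k) + (\<sigma> + e / 2) * of_int (\<rho> k) > 0" if "k \<in> K" for k
  proof (cases "k \<in> Pos")
    case True
    then have "e / 2 * of_int (\<rho> k) > 0" using e PosD by (intro mult_pos_pos) auto
    then show ?thesis using assms True by (force simp: chamber_def algebra_simps)
  next
    case False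
    then have k: "k \<in> Neg" using K_eq that by blast
    then have r: "\<rho> k < 0" using NegD by blast
    have "e \<le> (of_int (c k) + \<sigma> * of_int (\<rho> k)) / - of_int (\<rho> k)"
      unfolding e_def using k finNeg by (intro Min_le) auto
    then have "e * - of_int (\<rho> k) \<le> of_int (c k) + \<sigma> * of_int (\<rho> k)"
      using r by (subst (asm) pos_le_divide_eq) auto
    moreover have "e / 2 * - of_int (\<rho> k) < e * - of_int (\<rho> k)"
      using e r by (intro mult_strict_right_mono) auto
    ultimately show ?thesis by (simp add: algebra_simps)
  qed
  then show ?thesis unfolding inI_comb by blast
qed

context
  fixes f :: "int ^ 'm \<Rightarrow> 'b"
  assumes f_exchange: "\<And>u k l. inI u \<Longrightarrow> deg u + 1 = int CARD('m) \<Longrightarrow> k \<in> K \<Longrightarrow> l \<in> K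
     \<Longrightarrow> f (u + g k) = f (u + g l)"
begin

text \<open>
  Two points of the same degree in a chamber are joined by exchanging one generator at a time: the
  chamber is defined by lower bounds, which are respected by lowering a coordinate of \<open>c\<close> that exceeds
  the corresponding one of \<open>c'\<close>.
\<close>

lemma chamber_connected:
  assumes "chamber \<sigma> c" "chamber \<sigma> c'" "sum c K = int CARD('m)" "sum c' K = int CARD('m)"
  shows "f (comb c) = f (comb c')"
  using assms(1,3)
proof (induction "\<Sum>k\<in>K. nat \<bar>c k - c' k\<bar>" arbitrary: c rule: less_induct)
  case less
  show ?case
  proof (cases "\<forall>k\<in>K. c k = c' k")
    case True
    then show ?thesis by (simp add: comb_def)
  next
    case False
    have "\<exists>k\<in>K. c k > c' k"
    proof (rule ccontr)
      assume "\<not> (\<exists>k\<in>K. c k > c' k)"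
      then have "sum c K < sum c' K"
        using False finK by (intro sum_strict_mono_ex1) (auto simp: not_less le_less)
      then show False using less.prems assms by simp
    qed
    then obtain k where k: "k \<in> K" "c k > c' k" by blast
    have "\<exists>k\<in>K. c k < c' k"
    proof (rule ccontr)
      assume "\<not> (\<exists>k\<in>K. c k < c' k)"
      then have "sum c' K < sum c K"
        using False finK by (intro sum_strict_mono_ex1) (auto simp: not_less le_less)
      then show False using less.prems assms by simp
    qed
    then obtain l where l: "l \<in> K" "c l < c' l" by blast
    define c1 where "c1 = c(k := c k + -1)"
    define c2 where "c2 = c1(l := c1 l + 1)"
    have "k \<noteq> l" using k l by auto
    have ck: "of_int (c k + -1) \<ge> (of_int (c' k) :: real)" using k by simp
    have ch1: "chamber \<sigma> c1"
      unfolding chamber_def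
    proof (intro conjI ballI)
      fix i assume i: "i \<in> Pos"
      then have "of_int (c i) + \<sigma> * of_int (\<rho> i) \<ge> 0" "of_int (c' i) + \<sigma> * of_int (\<rho> i) \<ge> 0"
        using less.prems assms by (auto simp: chamber_def)
      then show "of_int (c1 i) + \<sigma> * of_int (\<rho> i) \<ge> 0" using ck by (cases "i = k") (auto simp: c1_def)
    next
      fix i assume i: "i \<in> Neg"
      then have "of_int (c i) + \<sigma> * of_int (\<rho> i) > 0" "of_int (c' i) + \<sigma> * of_int (\<rho> i) > 0"
        using less.prems assms by (auto simp: chamber_def)
      then show "of_int (c1 i) + \<sigma> * of_int (\<rho> i) > 0" using ck by (cases "i = k") (auto simp: c1_def)
    qed
    have comb1: "comb c = comb c1 + g k"
      unfolding c1_def comb_add_gen[OF k(1)] by (simp add: vec_eq_iff)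
    have comb2: "comb c2 = comb c1 + g l"
      unfolding c2_def comb_add_gen[OF l(1)] by simp
    have dg: "deg (comb c1) + 1 = int CARD('m)"
    proof -
      have "int CARD('m) = deg (comb c)" using less.prems(2) deg_comb[of c] by simp
      then show ?thesis unfolding comb1 using deg_gen[OF k(1)] by simp
    qed
    have "f (comb c) = f (comb c2)"
      unfolding comb1 comb2 using chamber_inI[OF ch1] dg k(1) l(1) by (rule f_exchange)
    also have "\<dots> = f (comb c')"
    proof (rule less.hyps)
      show "sum c2 K = int CARD('m)"
        using dg deg_gen[OF l(1)] deg_comb[of c2] unfolding comb2 by simp
      have mono: "c1 i \<le> c2 i" for i by (simp add: c2_def)
      show "chamber \<sigma> c2"
        unfolding chamber_def
      proof (intro conjI ballI)
        fix i assume "i \<in> Pos"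
        then show "of_int (c2 i) + \<sigma> * of_int (\<rho> i) \<ge> 0"
          using ch1 mono[of i] by (force simp: chamber_def)
      next
        fix i assume "i \<in> Neg"
        then show "of_int (c2 i) + \<sigma> * of_int (\<rho> i) > 0"
          using ch1 mono[of i] by (force simp: chamber_def)
      qed
      show "(\<Sum>i\<in>K. nat \<bar>c2 i - c' i\<bar>) < (\<Sum>i\<in>K. nat \<bar>c i - c' i\<bar>)"
      proof (rule sum_strict_mono_ex1[OF finK])
        show "\<forall>i\<in>K. nat \<bar>c2 i - c' i\<bar> \<le> nat \<bar>c i - c' i\<bar>"
          using k l \<open>k \<noteq> l\<close> by (auto simp: c2_def c1_def)
        show "\<exists>i\<in>K. nat \<bar>c2 i - c' i\<bar> < nat \<bar>c i - c' i\<bar>"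
          using k l \<open>k \<noteq> l\<close> by (intro bexI[of _ k]) (auto simp: c2_def c1_def)
      qed
    qed
    finally show ?thesis .
  qed
qed

text \<open>
  Let \<open>\<sigma> > 0\<close> be a place where some coordinate \<open>\<sigma> \<rho>\<^sub>k\<close> on the positive part is an integer. By the
  divisibility condition \<open>\<sigma> \<rho>\<^sub>l\<close> is then an integer on the whole negative part. The point \<open>q\<close> with
  coordinates \<open>1 - \<lceil>\<sigma> \<rho>\<^sub>k\<rceil>\<close> and \<open>1 - \<sigma> \<rho>\<^sub>l\<close> lies in the chambers on both sides of \<open>\<sigma>\<close>. Its degree
  is \<open>d + r + 1 - \<Sum> (\<lceil>\<sigma> \<rho>\<^sub>k\<rceil> - \<sigma> \<rho>\<^sub>k)\<close>, and the sum is positive, since by coprimality not all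
  \<open>\<sigma> \<rho>\<^sub>k\<close> are integers when \<open>0 < \<sigma> < 1\<close>. So the degree is at most \<open>d + r\<close>, and raising one
  coordinate turns \<open>q\<close> into a common point of degree \<open>d + r\<close>. Repeating this leads to \<open>\<sigma> = 0\<close>.
\<close>

lemma wall_crossing:
  assumes l0: "l0 \<in> Neg"
    and \<sigma>: "0 \<le> \<sigma>" "\<sigma> < 1" "\<exists>k\<in>Pos. \<sigma> * of_int (\<rho> k) \<in> \<int>"
    and c: "chamber \<sigma> c" "sum c K = int CARD('m)"
  shows "f (comb c) = f (comb (\<lambda>k. if k = l0 then int (card Pos) else if k \<in> Neg then 1 else 0))"
    (is "_ = f (comb ?b)")
  using \<sigma> c
proof (induction "\<Sum>k\<in>Pos. nat \<lfloor>\<sigma> * of_int (\<rho> k)\<rfloor>" arbitrary: \<sigma> c rule: less_induct)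
  case less
  have l0': "l0 \<notin> Pos" using l0 Pos_Neg_disjoint by blast
  show ?case
  proof (cases "\<sigma> = 0")
    case True
    have "chamber 0 ?b" using Pos_Neg_disjoint l0' finPos Pos_nonempty
      by (auto simp: chamber_def card_gt_0_iff)
    moreover have "sum ?b K = int CARD('m)"
    proof -
      have "sum ?b Pos = sum (\<lambda>k. 0) Pos"
        using Pos_Neg_disjoint l0' by (intro sum.cong) auto
      moreover have "sum ?b Neg = int (card Pos) + (\<Sum>k\<in>Neg - {l0}. 1)"
        by (subst sum.remove[OF finNeg l0]) (auto intro!: sum.cong)
      moreover have "card Neg = Suc (card (Neg - {l0}))" using finNeg l0 by (rule card.remove)
      ultimately show ?thesis using cardK by (simp add: sum_K card_K)
    qed
    ultimately show ?thesis using chamber_connected less.prems(4,5) True by blast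
  next
    case False
    then have \<sigma>: "0 < \<sigma>" "\<sigma> < 1" using less.prems by auto
    obtain k1 where k1: "k1 \<in> Pos" "\<sigma> * of_int (\<rho> k1) \<in> \<int>" using less.prems by blast
    have "\<sigma> * of_int (\<rho> l) \<in> \<int>" if "l \<in> Neg" for l
    proof -
      have "\<rho> k1 dvd \<rho> l" using rho_dvd k1(1) that PosD NegD by blast
      then obtain z where "\<rho> l = \<rho> k1 * z" by blast
      then have "\<sigma> * of_int (\<rho> l) = (\<sigma> * of_int (\<rho> k1)) * of_int z" by simp
      then show ?thesis using k1(2) by (metis Ints_mult Ints_of_int)
    qed
    then have S: "of_int \<lfloor>\<sigma> * of_int (\<rho> l)\<rfloor> = \<sigma> * of_int (\<rho> l)" if "l \<in> Neg" for l
      using that by (metis Ints_cases floor_of_int)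
    \<comment> \<open>The smallest integer coordinates that satisfy the bounds on both sides of the wall \<open>\<sigma>\<close>.\<close>
    define q0 where "q0 k = (if k \<in> Pos then 1 - \<lceil>\<sigma> * of_int (\<rho> k)\<rceil> else 1 - \<lfloor>\<sigma> * of_int (\<rho> k)\<rfloor>)" for k
    have sum_q0: "sum q0 K = int (card K) - (\<Sum>k\<in>Pos. \<lceil>\<sigma> * of_int (\<rho> k)\<rceil>) - (\<Sum>k\<in>Neg. \<lfloor>\<sigma> * of_int (\<rho> k)\<rfloor>)"
    proof -
      have "sum q0 Pos = (\<Sum>k\<in>Pos. 1 - \<lceil>\<sigma> * of_int (\<rho> k)\<rceil>)"
        by (intro sum.cong) (auto simp: q0_def)
      moreover have "sum q0 Neg = (\<Sum>k\<in>Neg. 1 - \<lfloor>\<sigma> * of_int (\<rho> k)\<rfloor>)"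
        using Pos_Neg_disjoint by (intro sum.cong) (auto simp: q0_def)
      ultimately show ?thesis by (simp add: sum_K card_K sum_subtractf)
    qed
    have "\<exists>k\<in>Pos. \<sigma> * of_int (\<rho> k) \<notin> \<int>"
    proof (rule ccontr)
      assume "\<not> ?thesis"
      then have "\<sigma> \<in> \<int>" using integer_multiplier by blast
      then show False using \<sigma> by (auto elim!: Ints_cases)
    qed
    then obtain k2 where k2: "k2 \<in> Pos" "\<sigma> * of_int (\<rho> k2) \<notin> \<int>" by blast
    have "(\<Sum>k\<in>Pos. \<sigma> * of_int (\<rho> k)) < (\<Sum>k\<in>Pos. of_int \<lceil>\<sigma> * of_int (\<rho> k)\<rceil>)"
    proof (rule sum_strict_mono_ex1[OF finPos])
      have "\<sigma> * of_int (\<rho> k2) \<noteq> of_int \<lceil>\<sigma> * of_int (\<rho> k2)\<rceil>" using k2(2) by (metis Ints_of_int)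
      then show "\<exists>k\<in>Pos. \<sigma> * of_int (\<rho> k) < of_int \<lceil>\<sigma> * of_int (\<rho> k)\<rceil>"
        using k2(1) le_of_int_ceiling[of "\<sigma> * of_int (\<rho> k2)"] by (intro bexI[of _ k2]) linarith+
    qed auto
    moreover have "(\<Sum>k\<in>Pos. \<sigma> * of_int (\<rho> k)) = - (\<Sum>k\<in>Neg. \<sigma> * of_int (\<rho> k))"
    proof -
      have "(\<Sum>k\<in>K. \<sigma> * of_int (\<rho> k)) = \<sigma> * of_int (\<Sum>k\<in>K. \<rho> k)" by (simp add: sum_distrib_left)
      then show ?thesis by (simp add: sum_rho sum_K[of "\<lambda>k. \<sigma> * of_int (\<rho> k)"])
    qed
    moreover have "(\<Sum>k\<in>Neg. \<sigma> * of_int (\<rho> k)) = of_int (\<Sum>k\<in>Neg. \<lfloor>\<sigma> * of_int (\<rho> k)\<rfloor>)"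
      unfolding of_int_sum by (rule sum.cong[OF refl]) (rule S[symmetric])
    ultimately have "of_int (- (\<Sum>k\<in>Neg. \<lfloor>\<sigma> * of_int (\<rho> k)\<rfloor>)) < (of_int (\<Sum>k\<in>Pos. \<lceil>\<sigma> * of_int (\<rho> k)\<rceil>) :: real)"
      by simp
    then have "- (\<Sum>k\<in>Neg. \<lfloor>\<sigma> * of_int (\<rho> k)\<rfloor>) < (\<Sum>k\<in>Pos. \<lceil>\<sigma> * of_int (\<rho> k)\<rceil>)"
      by (simp only: of_int_less_iff)
    then have e: "sum q0 K \<le> int CARD('m)" using sum_q0 cardK by simp
    define q where "q = q0(l0 := q0 l0 + (int CARD('m) - sum q0 K))"
    have l0K: "l0 \<in> K" using NegD[OF l0] by blast
    have sum_q: "sum q K = int CARD('m)"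
      unfolding q_def by (simp add: sum.remove[OF finK l0K] cong: if_cong)
    have qPos: "(of_int (q k) :: real) = 1 - of_int \<lceil>\<sigma> * of_int (\<rho> k)\<rceil>" if "k \<in> Pos" for k
      using that l0' by (auto simp: q_def q0_def)
    have qNeg: "of_int (q k) \<ge> 1 - \<sigma> * of_int (\<rho> k)" if "k \<in> Neg" for k
    proof -
      have "q k \<ge> 1 - \<lfloor>\<sigma> * of_int (\<rho> k)\<rfloor>"
        using that e Pos_Neg_disjoint l0' by (auto simp: q_def q0_def)
      then have "of_int (q k) \<ge> (of_int (1 - \<lfloor>\<sigma> * of_int (\<rho> k)\<rfloor>) :: real)" by (simp only: of_int_le_iff)
      then show ?thesis using S[OF that] by simp
    qed
    have "chamber \<sigma> q"
      unfolding chamber_def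
    proof (intro conjI ballI)
      fix k assume "k \<in> Pos"
      then show "0 \<le> of_int (q k) + \<sigma> * of_int (\<rho> k)"
        using qPos[of k] of_int_ceiling_le_add_one[of "\<sigma> * of_int (\<rho> k)"] by linarith
    next
      fix k assume "k \<in> Neg"
      then show "0 < of_int (q k) + \<sigma> * of_int (\<rho> k)" using qNeg[of k] by linarith
    qed
    then have "f (comb c) = f (comb q)"
      using chamber_connected less.prems(4,5) sum_q by blast
    also have "\<dots> = f (comb ?b)"
    proof -
      \<comment> \<open>The shifts admitted by \<open>q\<close> start at \<open>\<tau> < \<sigma>\<close>, which is the next wall to consider.\<close>
      define h where "h k = (of_int \<lceil>\<sigma> * of_int (\<rho> k)\<rceil> - 1) / (of_int (\<rho> k) :: real)" for k
      define \<tau> where "\<tau> = Max (h ` Pos)"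
      have "\<tau> \<in> h ` Pos" unfolding \<tau>_def using finPos Pos_nonempty by (intro Max_in) auto
      then obtain k3 where k3: "k3 \<in> Pos" "\<tau> = h k3" by blast
      have hle: "h k \<le> \<tau>" if "k \<in> Pos" for k unfolding \<tau>_def using finPos that by auto
      have rp: "(0::real) < of_int (\<rho> k)" if "k \<in> Pos" for k using PosD[OF that] by simp
      have ints: "\<tau> * of_int (\<rho> k3) = of_int (\<lceil>\<sigma> * of_int (\<rho> k3)\<rceil> - 1)"
        using rp[OF k3(1)] by (simp add: k3(2) h_def)
      have "0 < \<lceil>\<sigma> * of_int (\<rho> k3)\<rceil>" using \<sigma>(1) rp[OF k3(1)] by simp
      then have "\<tau> * of_int (\<rho> k3) \<ge> 0" unfolding ints by simp
      then have \<tau>0: "\<tau> \<ge> 0" using rp[OF k3(1)] by (simp add: zero_le_mult_iff)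
      have "\<tau> * of_int (\<rho> k3) < \<sigma> * of_int (\<rho> k3)" unfolding ints by linarith
      then have \<tau>\<sigma>: "\<tau> < \<sigma>" using rp[OF k3(1)] by simp
      show ?thesis
      proof (rule less.hyps)
        show "0 \<le> \<tau>" "\<tau> < 1" using \<tau>0 \<tau>\<sigma> \<sigma> by auto
        show "\<exists>k\<in>Pos. \<tau> * of_int (\<rho> k) \<in> \<int>" using k3(1) ints by (metis Ints_of_int)
        show "sum q K = int CARD('m)" by (rule sum_q)
        show "chamber \<tau> q"
          unfolding chamber_def
        proof (intro conjI ballI)
          fix k assume k: "k \<in> Pos"
          have "h k * of_int (\<rho> k) \<le> \<tau> * of_int (\<rho> k)"
            using hle[OF k] rp[OF k] by (intro mult_right_mono) auto
          moreover have "h k * of_int (\<rho> k) = of_int \<lceil>\<sigma> * of_int (\<rho> k)\<rceil> - 1"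
            using rp[OF k] by (simp add: h_def)
          ultimately show "0 \<le> of_int (q k) + \<tau> * of_int (\<rho> k)" using qPos[OF k] by linarith
        next
          fix k assume k: "k \<in> Neg"
          have "\<sigma> * of_int (\<rho> k) < \<tau> * of_int (\<rho> k)"
            using \<tau>\<sigma> NegD[OF k] by simp
          then show "0 < of_int (q k) + \<tau> * of_int (\<rho> k)" using qNeg[OF k] by linarith
        qed
        show "(\<Sum>k\<in>Pos. nat \<lfloor>\<tau> * of_int (\<rho> k)\<rfloor>) < (\<Sum>k\<in>Pos. nat \<lfloor>\<sigma> * of_int (\<rho> k)\<rfloor>)"
        proof (rule sum_strict_mono_ex1[OF finPos])
          show "\<forall>k\<in>Pos. nat \<lfloor>\<tau> * of_int (\<rho> k)\<rfloor> \<le> nat \<lfloor>\<sigma> * of_int (\<rho> k)\<rfloor>"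
            using \<tau>\<sigma> rp by (intro ballI nat_mono floor_mono mult_right_mono) (auto intro: less_imp_le)
          obtain z where z: "\<sigma> * of_int (\<rho> k1) = of_int z" using k1(2) by (auto elim: Ints_cases)
          have "\<tau> * of_int (\<rho> k1) < of_int z" unfolding z[symmetric] using \<tau>\<sigma> rp[OF k1(1)] by simp
          then have "\<lfloor>\<tau> * of_int (\<rho> k1)\<rfloor> < z" by (simp add: floor_less_iff)
          moreover have "0 < \<sigma> * of_int (\<rho> k1)" using \<sigma>(1) rp[OF k1(1)] by simp
          then have "0 < z" unfolding z by simp
          ultimately show "\<exists>k\<in>Pos. nat \<lfloor>\<tau> * of_int (\<rho> k)\<rfloor> < nat \<lfloor>\<sigma> * of_int (\<rho> k)\<rfloor>"
            using k1(1) z by (intro bexI[of _ k1]) auto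
        qed
      qed
    qed
    finally show ?thesis .
  qed
qed

lemma interior_connected:
  assumes "l0 \<in> Neg" "inI p" "deg p = int CARD('m)"
  shows "f p = f (comb (\<lambda>k. if k = l0 then int (card Pos) else if k \<in> Neg then 1 else 0))"
proof -
  obtain c where c: "p = comb c" "normal c" using normal_exists by blast
  define h where "h k = - of_int (c k) / (of_int (\<rho> k) :: real)" for k
  define L where "L = Max (h ` Pos)"
  have "L \<in> h ` Pos" unfolding L_def using finPos Pos_nonempty by (intro Max_in) auto
  then obtain k3 where k3: "k3 \<in> Pos" "L = h k3" by blast
  have hle: "h k \<le> L" if "k \<in> Pos" for k unfolding L_def using finPos that by auto
  have rp: "(0::real) < of_int (\<rho> k)" if "k \<in> Pos" for k using PosD[OF that] by simp
  have hk: "h k * of_int (\<rho> k) = - of_int (c k)" if "k \<in> Pos" for k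
    using rp[OF that] by (simp add: h_def)
  have Lk: "L * of_int (\<rho> k3) = - of_int (c k3)" using hk[OF k3(1)] k3(2) by simp
  obtain s :: real where s: "\<And>k. k \<in> K \<Longrightarrow> of_int (c k) + s * of_int (\<rho> k) > 0"
    using assms(2) unfolding c(1) inI_comb by blast
  have "L * of_int (\<rho> k3) < s * of_int (\<rho> k3)" using s[of k3] PosD[OF k3(1)] Lk by auto
  then have Ls: "L < s" using rp[OF k3(1)] by simp
  show ?thesis unfolding c(1)
  proof (rule wall_crossing[OF assms(1)])
    obtain k where k: "k \<in> Pos" "c k \<le> 0" using c(2) by (auto simp: normal_def)
    then have "0 \<le> h k" using rp[OF k(1)] by (simp add: h_def divide_nonpos_pos)
    then show "0 \<le> L" using hle[OF k(1)] by linarith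
    have "- c k3 < \<rho> k3" using c(2) k3(1) by (auto simp: normal_def)
    then have "(of_int (- c k3) :: real) < of_int (\<rho> k3)" by (simp only: of_int_less_iff)
    then have "L * of_int (\<rho> k3) < 1 * of_int (\<rho> k3)" unfolding Lk by simp
    then show "L < 1" using rp[OF k3(1)] mult_less_cancel_right_pos by blast
    show "\<exists>k\<in>Pos. L * of_int (\<rho> k) \<in> \<int>" using Lk k3(1) by (metis Ints_minus Ints_of_int)
    show "sum c K = int CARD('m)" using assms(3) by (simp add: c(1) deg_comb)
    show "chamber L c"
      unfolding chamber_def
    proof (intro conjI ballI)
      fix k assume k: "k \<in> Pos"
      have "h k * of_int (\<rho> k) \<le> L * of_int (\<rho> k)"
        using hle[OF k] rp[OF k] by (intro mult_right_mono) auto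
      then show "0 \<le> of_int (c k) + L * of_int (\<rho> k)" using hk[OF k] by linarith
    next
      fix k assume k: "k \<in> Neg"
      have "s * of_int (\<rho> k) < L * of_int (\<rho> k)" using Ls NegD[OF k] by simp
      moreover have "0 < of_int (c k) + s * of_int (\<rho> k)" using s NegD[OF k] by blast
      ultimately show "0 < of_int (c k) + L * of_int (\<rho> k)" by linarith
    qed
  qed
qed

end

end

section \<open>Uniqueness of the toric residue\<close>

context circuit_residue
begin

lemma res_linear: "res (h + h') = res h + res h'" "res (lconst c * h) = c * res h"
  by (simp_all add: res_def lin_ext_add lin_ext_lconst_mult)

lemma I_degree_single: "inI u \<Longrightarrow> deg u = int l \<Longrightarrow> single u c \<in> I_degree J A l"
  by (simp add: I_degree_iff)

lemma toric_residue_lin: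
  assumes "is_toric_residue J A F \<phi>" "h \<in> I_degree J A CARD('m)"
  shows "\<phi> h = lin_ext (\<lambda>u. \<phi> (single u 1)) h"
proof -
  let ?I = "I_degree J A CARD('m)"
  have add: "\<phi> (x + y) = \<phi> x + \<phi> y" if "x \<in> ?I" "y \<in> ?I" for x y
    using assms(1) that by (simp add: is_toric_residue_def)
  have scale: "\<phi> (lconst c * x) = c * \<phi> x" if "x \<in> ?I" for c x
    using assms(1) that by (simp add: is_toric_residue_def)
  have 0: "0 \<in> ?I" by (simp add: I_degree_iff)
  have phi0: "\<phi> 0 = 0" using scale[OF 0, of 0] by simp
  have I_sum: "sum f U \<in> ?I" if "\<And>u. u \<in> U \<Longrightarrow> f u \<in> ?I" for f :: "int ^ 'm \<Rightarrow> 'm laurent" and U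
    using that
  proof (induction U rule: infinite_finite_induct)
    case (insert u U)
    then have "f u \<in> ?I" "sum f U \<in> ?I" by auto
    then show ?case using insert(1,2) keys_add[of "f u" "sum f U"]
      unfolding I_degree_iff by (simp add: subset_iff) blast
  qed (use 0 in auto)
  have single: "\<phi> (single u c) = c * \<phi> (single u 1)"
    if "inI u" "deg u = int CARD('m)" for u c
    using scale[OF I_degree_single[OF that, of 1], of c] by (simp add: lconst_def mult_single)
  have "\<phi> (\<Sum>u\<in>U. single u (lookup h u))
     = (\<Sum>u\<in>U. lookup h u * \<phi> (single u 1))"
    if "U \<subseteq> keys h" for U
  proof -
    have "finite U" using that by (rule finite_subset) simp
    then show ?thesis using that
    proof (induction U)
      case (insert u U)
      have *: "inI x" "deg x = int CARD('m)" if "x \<in> insert u U" for x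
        using assms(2) insert.prems that by (auto simp: I_degree_iff)
      have "(\<Sum>u\<in>U. single u (lookup h u)) \<in> ?I"
        using * by (intro I_sum I_degree_single) auto
      then have "\<phi> (single u (lookup h u)
          + (\<Sum>u\<in>U. single u (lookup h u)))
        = \<phi> (single u (lookup h u))
          + \<phi> (\<Sum>u\<in>U. single u (lookup h u))"
        using * by (intro add I_degree_single) auto
      moreover have "\<phi> (single u (lookup h u))
          = lookup h u * \<phi> (single u 1)"
        by (rule single) (use * in auto)
      moreover have "\<phi> (\<Sum>u\<in>U. single u (lookup h u))
          = (\<Sum>u\<in>U. lookup h u * \<phi> (single u 1))"
        using insert.IH insert.prems by blast
      ultimately show ?case by (simp only: sum.insert[OF insert.hyps(1,2)])
    qed (simp add: phi0)
  qed
  from this[OF order_refl] show ?thesis unfolding monomial_expansion[symmetric] lin_ext_def .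
qed

text \<open>
  A functional on the generators that vanishes except at \<open>g\<^sub>k\<close> and \<open>g\<^sub>l\<close> yields a combination of the
  \<open>t^u F\<^sub>m\<close> that involves the monomials \<open>t^(u + g\<^sub>k)\<close> and \<open>t^(u + g\<^sub>l)\<close> only.
\<close>

lemma toric_residue_exchange:
  assumes "is_toric_residue J A F \<phi>" "inI u" "deg u + 1 = int CARD('m)" "k \<in> K" "l \<in> K"
  shows "\<phi> (single (u + g k) 1) / wt (u + g k)
       = \<phi> (single (u + g l) 1) / wt (u + g l)"
proof (cases "k = l")
  case False
  define \<psi> where "\<psi> p = \<phi> (single p 1)" for p
  define \<kappa> where "\<kappa> i = (if i = k then of_int (\<rho> l) else if i = l then - of_int (\<rho> k) else 0 :: complex)" for i
  have two: "(\<Sum>i\<in>K. F i * \<kappa> i) = F k * of_int (\<rho> l) - F l * of_int (\<rho> k)" for F :: "'k \<Rightarrow> complex"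
  proof -
    have "(\<Sum>i\<in>K. F i * \<kappa> i) = (\<Sum>i\<in>{k, l}. F i * \<kappa> i)"
      using assms(4,5) finK by (intro sum.mono_neutral_right) (auto simp: \<kappa>_def)
    then show ?thesis using False by (simp add: \<kappa>_def)
  qed
  have "(\<Sum>i\<in>K. of_int (\<rho> i) * \<kappa> i) = 0" unfolding two by simp
  from functional_exists[OF this] obtain c
    where c: "\<And>i. i \<in> K \<Longrightarrow> (\<Sum>m\<in>UNIV. c m * of_int (g i $ m)) = \<kappa> i" by blast
  define h where "h = (\<Sum>m\<in>UNIV. log_deriv m F * single u (c m))"
  have h: "h = (\<Sum>i\<in>K. single (u + g i) (a i * \<kappa> i))"
  proof -
    have "h = (\<Sum>m\<in>UNIV. \<Sum>i\<in>K. single (u + g i) (a i * (c m * of_int (g i $ m))))"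
      unfolding h_def log_deriv_F sum_distrib_right mult_single by (simp add: ac_simps)
    also have "\<dots> = (\<Sum>i\<in>K. \<Sum>m\<in>UNIV. single (u + g i) (a i * (c m * of_int (g i $ m))))"
      by (rule sum.swap)
    also have "\<dots> = (\<Sum>i\<in>K. single (u + g i) (\<Sum>m\<in>UNIV. a i * (c m * of_int (g i $ m))))"
      by (intro sum.cong refl poly_mapping_eqI) (simp add: lookup_sum lookup_single when_def)
    finally show ?thesis by (simp add: c flip: sum_distrib_left)
  qed
  have keys: "p \<in> (\<lambda>i. u + g i) ` K" if "p \<in> keys h" for p
    using keys_sum_monomials[OF that[unfolded h]] by blast
  have hI: "h \<in> I_degree J A CARD('m)"
    using keys inI_add[OF assms(2) inC_gen] assms(3) by (fastforce simp: I_degree_iff deg_gen)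
  have "\<forall>m. single u (c m) \<in> I_ideal J A" using assms(2) by (simp add: I_ideal_iff)
  then have "h \<in> jacobian_I J A F" unfolding jacobian_I_def h_def
    by (intro CollectI exI[of _ "\<lambda>m. single u (c m)"]) simp
  then have "\<phi> h = 0" using assms(1) hI by (simp add: is_toric_residue_def)
  moreover have "\<psi> = (\<lambda>p. \<phi> (single p 1))" by (simp add: \<psi>_def fun_eq_iff)
  ultimately have "lin_ext \<psi> h = 0" using toric_residue_lin[OF assms(1) hI] by simp
  then have "(\<Sum>i\<in>K. (a i * \<psi> (u + g i)) * \<kappa> i) = 0" unfolding h lin_ext_sum lin_ext_single by (simp add: mult_ac)
  then have eq: "a k * \<psi> (u + g k) * of_int (\<rho> l) = a l * \<psi> (u + g l) * of_int (\<rho> k)"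
    unfolding two by simp
  have ag: "a k = - of_int (\<rho> k) / \<gamma> k" "a l = - of_int (\<rho> l) / \<gamma> l"
    using a_gamma[OF assms(2,3)] gamma_nz assms(4,5) by (simp_all add: field_simps)
  have "\<psi> (u + g k) / \<gamma> k = \<psi> (u + g l) / \<gamma> l"
    using eq rho_nz[OF assms(4)] rho_nz[OF assms(5)] gamma_nz[OF assms(4)] gamma_nz[OF assms(5)]
    unfolding ag by (simp add: field_simps)
  then show ?thesis
    unfolding wt_step[OF assms(2,3,4)] wt_step[OF assms(2,3,5)] \<psi>_def mult.commute[of "wt u"]
      divide_divide_eq_left[symmetric] by (rule arg_cong)
qed simp

lemma toric_residue_unique:
  assumes "is_toric_residue J A F \<phi>"
  obtains C where "\<And>h. h \<in> I_degree J A CARD('m) \<Longrightarrow> \<phi> h = C * res h"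
proof -
  obtain l0 where l0: "l0 \<in> Neg" using Neg_nonempty by blast
  define C where "C = (\<lambda>p. \<phi> (single p 1) / wt p)
    (comb (\<lambda>k. if k = l0 then int (card Pos) else if k \<in> Neg then 1 else 0))"
  have *: "\<phi> (single p 1) = C * wt p" if "inI p" "deg p = int CARD('m)" for p
    using interior_connected[of "\<lambda>p. \<phi> (single p 1) / wt p", OF toric_residue_exchange[OF assms] l0 that]
      wt_nz[of p] unfolding C_def by (simp add: nonzero_divide_eq_eq)
  have "\<phi> h = C * res h" if "h \<in> I_degree J A CARD('m)" for h
  proof -
    have "\<phi> h = (\<Sum>u\<in>keys h. C * (lookup h u * (if deg u = int CARD('m) then wt u else 0)))"
      unfolding toric_residue_lin[OF assms that] lin_ext_def
      using that * by (intro sum.cong) (auto simp: I_degree_iff)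
    then show ?thesis by (simp add: res_def lin_ext_def sum_distrib_left)
  qed
  then show ?thesis using that by blast
qed

text \<open>
  Existence comes from the explicit functional, uniqueness from its scaling at the Hessian.
\<close>

theorem toric_residue_eq:
  assumes H: "hessian F \<in> I_degree J A CARD('m)" "res (hessian F) \<noteq> 0"
    and h: "h \<in> I_degree J A CARD('m)"
  shows "toric_residue J A F h = Vol (cayley_polytope J A) / res (hessian F) * res h"
proof -
  let ?I = "I_degree J A CARD('m)"
  define V where "V = complex_of_real (Vol (cayley_polytope J A)) / res (hessian F)"
  define \<phi> where "\<phi> = (\<lambda>h\<in>?I. V * res h)"
  have cl: "x + y \<in> ?I" if "x \<in> ?I" "y \<in> ?I" for x y
    using that keys_add[of x y] unfolding I_degree_iff by blast
  have cs: "lconst c * x \<in> ?I" if "x \<in> ?I" for c x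
  proof -
    have "keys (lconst c * x) \<subseteq> keys x"
      using keys_mult[of "lconst c" x] by (auto simp: lconst_def split: if_splits)
    then show ?thesis using that unfolding I_degree_iff by blast
  qed
  have jac: "res x = 0" if x: "x \<in> jacobian_I J A F" for x
  proof -
    obtain h where h: "x = (\<Sum>m\<in>UNIV. log_deriv m F * h m)" "\<And>m. h m \<in> I_ideal J A"
      using x by (auto simp: jacobian_I_def)
    have "res x = (\<Sum>m\<in>UNIV. res (log_deriv m F * h m))" unfolding h(1) res_def lin_ext_sum ..
    then show ?thesis using res_jacobian h(2) by simp
  qed
  have "is_toric_residue J A F \<phi>"
  proof -
    have "V * res (hessian F) = complex_of_real (Vol (cayley_polytope J A))"
      using H(2) by (simp add: V_def)
    then show ?thesis unfolding is_toric_residue_def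
      by (auto simp: \<phi>_def H(1) res_linear cl cs jac distrib_left mult.left_commute)
  qed
  moreover have "\<psi> = \<phi>" if psi: "is_toric_residue J A F \<psi>" for \<psi>
  proof -
    obtain C where C: "\<And>h. h \<in> ?I \<Longrightarrow> \<psi> h = C * res h" using toric_residue_unique[OF psi] by blast
    have "\<psi> (hessian F) = Vol (cayley_polytope J A)" using psi by (simp add: is_toric_residue_def)
    then have "C = V" using C[OF H(1)] H(2) by (simp add: V_def field_simps)
    moreover have "\<psi> \<in> extensional ?I" using psi by (simp add: is_toric_residue_def)
    ultimately show ?thesis using C by (intro extensionalityI[of _ ?I]) (auto simp: \<phi>_def)
  qed
  ultimately have "toric_residue J A F = \<phi>" unfolding toric_residue_def by (rule the_equality)
  then show ?thesis using h by (simp add: \<phi>_def V_def)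
qed

end

section \<open>The Hessian\<close>

lemma det_of_int: "det (\<chi> i j. (of_int (M i j) :: 'a::comm_ring_1)) = of_int (det (\<chi> i j. M i j))"
  by (simp add: det_def)

lemma prod_single:
  "finite S \<Longrightarrow> (\<Prod>i\<in>S. single (u i) (c i :: 'b::comm_semiring_1))
     = single (\<Sum>i\<in>S. u i) (\<Prod>i\<in>S. c i)"
  by (induction S rule: finite_induct) (simp_all add: mult_single)

lemma det_rows_bij:
  fixes x :: "'k \<Rightarrow> int ^ 'm::finite"
  assumes "bij_betw b UNIV S" "bij_betw b' UNIV S"
  shows "\<bar>det (\<chi> i. x (b i))\<bar> = \<bar>det (\<chi> i. x (b' i))\<bar>"
proof -
  define p where "p = inv_into UNIV b \<circ> b'"
  have "bij p" unfolding p_def using assms(2) bij_betw_inv_into[OF assms(1)] by (rule bij_betw_trans)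
  then have "p permutes UNIV" by (intro bij_imp_permutes) auto
  from det_permute_rows[OF this, of "\<chi> i. x (b i)"]
  have "det (\<chi> i. x (b (p i))) = sign p * det (\<chi> i. x (b i))" by simp
  moreover have "b (p i) = b' i" for i
    using bij_betw_inv_into_right[OF assms(1)] assms(2) by (auto simp: p_def bij_betw_def)
  ultimately have "det (\<chi> i. x (b' i)) = sign p * det (\<chi> i. x (b i))" by simp
  then show ?thesis by (simp add: abs_mult sign_def)
qed

context circuit
begin

definition enum :: "'k \<Rightarrow> 'm \<Rightarrow> 'k" where
  "enum k = (SOME b. bij_betw b UNIV (K - {k}))"

lemma bij_enum:
  assumes "k \<in> K" shows "bij_betw (enum k) UNIV (K - {k})"
proof -
  have "card (K - {k}) = CARD('m)" using cardK finK assms by simp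
  then obtain b :: "'m \<Rightarrow> 'k" where "bij_betw b UNIV (K - {k})"
    using finite_same_card_bij[of "UNIV :: 'm set" "K - {k}"] finK by auto
  then show ?thesis unfolding enum_def by (rule someI[where P="\<lambda>b. bij_betw b UNIV (K - {k})"])
qed

definition minor :: "'k \<Rightarrow> int" where
  "minor k = det (\<chi> i. g (enum k i))"

text \<open>
  Cramer's rule: in the minor that omits \<open>g\<^sub>l\<close>, replace the row \<open>g\<^sub>k\<close> by the vanishing combination
  \<open>\<Sum> \<rho>\<^sub>j g\<^sub>j\<close>. By linearity only \<open>j = k\<close> and \<open>j = l\<close> contribute.
\<close>

lemma minor_ratio:
  assumes k: "k \<in> K" and l: "l \<in> K" and "k \<noteq> l"
  shows "\<bar>\<rho> k\<bar> * \<bar>minor l\<bar> = \<bar>\<rho> l\<bar> * \<bar>minor k\<bar>"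
proof -
  have "k \<in> range (enum l)" using bij_enum[OF l] k \<open>k \<noteq> l\<close> by (auto simp: bij_betw_def)
  then obtain i0 where i0: "enum l i0 = k" by blast
  define M where "M x = det (\<chi> i. if i = i0 then x else g (enum l i))" for x
  have inj: "inj (enum l)" using bij_enum[OF l] by (simp add: bij_betw_def)
  have "(\<Sum>j\<in>K. \<rho> j * M (g j)) = (\<Sum>j\<in>K. M (\<rho> j *s g j))"
    by (simp add: M_def det_row_mul)
  also have "\<dots> = M (\<Sum>j\<in>K. \<rho> j *s g j)"
    unfolding M_def using det_linear_row_sum[OF finK, of i0 "\<lambda>i j. \<rho> j *s g j" "\<lambda>i. g (enum l i)"] by simp
  also have "\<dots> = 0" unfolding relation M_def
    by (rule det_zero_row[of i0]) (simp add: row_def vec_eq_iff)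
  finally have 0: "(\<Sum>j\<in>K. \<rho> j * M (g j)) = 0" .
  have van: "M (g j) = 0" if "j \<in> K" "j \<noteq> k" "j \<noteq> l" for j
  proof -
    have "j \<in> range (enum l)" using bij_enum[OF l] that by (auto simp: bij_betw_def)
    then obtain i where i: "enum l i = j" by blast
    then have "i \<noteq> i0" using i0 that by auto
    then show ?thesis unfolding M_def
      by (intro det_identical_rows[of i i0]) (auto simp: row_def vec_eq_iff i)
  qed
  have "(\<Sum>j\<in>K. \<rho> j * M (g j)) = (\<Sum>j\<in>{k, l}. \<rho> j * M (g j))"
    using k l finK van by (intro sum.mono_neutral_right) auto
  then have "\<rho> k * M (g k) = - (\<rho> l * M (g l))" using 0 \<open>k \<noteq> l\<close> by simp
  moreover have "M (g k) = minor l"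
    unfolding M_def minor_def by (rule arg_cong[where f=det]) (auto simp: vec_eq_iff i0)
  moreover have "\<bar>M (g l)\<bar> = \<bar>minor k\<bar>"
  proof -
    define b where "b = (enum l)(i0 := l)"
    have "bij_betw b UNIV (K - {k})"
    proof (rule bij_betw_imageI)
      have "l \<notin> range (enum l)" using bij_enum[OF l] by (auto simp: bij_betw_def)
      then show "inj b" using inj unfolding b_def by (intro inj_on_fun_updI) auto
      have "range b = insert l (enum l ` (UNIV - {i0}))" by (auto simp: b_def)
      also have "enum l ` (UNIV - {i0}) = range (enum l) - {k}"
        using inj i0 by (auto simp: inj_def)
      also have "range (enum l) = K - {l}" using bij_enum[OF l] by (simp add: bij_betw_def)
      finally show "range b = K - {k}" using l \<open>k \<noteq> l\<close> by auto
    qed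
    from det_rows_bij[OF this bij_enum[OF k], of g]
    have "\<bar>det (\<chi> i. g (b i))\<bar> = \<bar>minor k\<bar>" by (simp add: minor_def)
    moreover have "(\<chi> i. g (b i)) = (\<chi> i. if i = i0 then g l else g (enum l i))"
      by (simp add: b_def vec_eq_iff)
    ultimately show ?thesis by (simp add: M_def)
  qed
  ultimately show ?thesis by (metis abs_minus_cancel abs_mult)
qed

text \<open>
  The minors are proportional to \<open>\<rho>\<close>. They have no common divisor because the generators generate
  the lattice: expressing the unit vectors by generators and applying the Cauchy-Binet formula
  writes 1 as a combination of minors. Since \<open>\<rho>\<close> has no common divisor either, the factor is \<open>\<plusminus>1\<close>.
\<close>

lemma abs_minor:
  assumes k: "k \<in> K" shows "\<bar>minor k\<bar> = \<bar>\<rho> k\<bar>"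
proof -
  have ratio: "\<bar>\<rho> l\<bar> * \<bar>minor k\<bar> = \<bar>\<rho> k\<bar> * \<bar>minor l\<bar>" if "l \<in> K" for l
    using minor_ratio[OF that k] by (cases "k = l") auto
  have "\<exists>C. \<forall>m. axis m 1 = comb (C m)" by (intro choice allI comb_surj)
  then obtain C where C: "\<And>m. axis m 1 = comb (C m)" by blast
  have "(\<chi> i j. \<Sum>l\<in>K. C i l * g l $ j) = (mat 1 :: int ^ 'm ^ 'm)"
  proof -
    have "(\<Sum>l\<in>K. C i l * g l $ j) = (if i = j then 1 else 0)" for i j
    proof -
      have "(\<Sum>l\<in>K. C i l * g l $ j) = comb (C i) $ j" by (simp add: comb_def sum_component)
      then show ?thesis unfolding C[symmetric] by (simp add: axis_def)
    qed
    then show ?thesis by (simp add: mat_def vec_eq_iff)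
  qed
  then have "det (\<chi> i j. \<Sum>l\<in>K. C i l * g l $ j) = (1 :: int)" by simp
  then have one: "(\<Sum>l\<in>K. det (\<chi> i j. C i (enum l j)) * minor l) = 1"
    by (simp add: det_product_one_extra[OF finK cardK bij_enum] minor_def vec_lambda_eta)
  have "minor k dvd \<rho> k * (\<Sum>l\<in>K. det (\<chi> i j. C i (enum l j)) * minor l)"
    unfolding sum_distrib_left
  proof (rule dvd_sum)
    fix l assume "l \<in> K"
    from ratio[OF this] have "\<bar>minor k\<bar> dvd \<bar>\<rho> k * minor l\<bar>" by (metis abs_mult dvd_triv_right)
    then have "minor k dvd \<rho> k * minor l" by simp
    then show "minor k dvd \<rho> k * (det (\<chi> i j. C i (enum l j)) * minor l)"
      by (metis dvd_mult mult.left_commute)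
  qed
  then have 1: "minor k dvd \<rho> k" using one by simp
  define s where "s = (of_int \<bar>minor k\<bar> :: real) / of_int \<bar>\<rho> k\<bar>"
  have nz: "of_int \<bar>\<rho> k\<bar> \<noteq> (0::real)" using rho_nz[OF k] by simp
  have "s \<in> \<int>"
  proof (rule integer_multiplier)
    fix l assume l: "l \<in> Pos"
    have "of_int (\<bar>\<rho> l\<bar> * \<bar>minor k\<bar>) = (of_int (\<bar>\<rho> k\<bar> * \<bar>minor l\<bar>) :: real)"
      using PosD[OF l] by (subst ratio) simp_all
    then have "s * of_int (\<rho> l) = of_int \<bar>minor l\<bar>"
      using nz PosD[OF l] by (simp add: s_def field_simps)
    then show "s * of_int (\<rho> l) \<in> \<int>" by simp
  qed
  then obtain z where "s = of_int z" by (auto elim: Ints_cases)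
  then have "of_int \<bar>minor k\<bar> = (of_int (z * \<bar>\<rho> k\<bar>) :: real)" using nz by (simp add: s_def field_simps)
  then have "\<bar>minor k\<bar> = z * \<bar>\<rho> k\<bar>" by (simp only: of_int_eq_iff)
  then have "\<bar>\<rho> k\<bar> dvd \<bar>minor k\<bar>" by simp
  then have "\<rho> k dvd minor k" by simp
  from zdvd_antisym_abs[OF 1 this] show ?thesis .
qed

definition total :: int where "total = (\<Sum>k\<in>Pos. \<rho> k)"

lemma total_pos: "total > 0"
  unfolding total_def using finPos Pos_nonempty PosD by (intro sum_pos) auto

lemma sum_Neg: "(\<Sum>k\<in>Neg. \<rho> k) = - total"
  using sum_rho unfolding total_def sum_K[of \<rho>] by simp

text \<open>
  The shift that exhibits interiority is slightly positive or slightly negative according to the sign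
  of \<open>\<rho> k\<close>.
\<close>

lemma hessian_point:
  assumes k: "k \<in> K"
  shows "inI (\<Sum>l\<in>K - {k}. g l)" "deg (\<Sum>l\<in>K - {k}. g l) = int CARD('m)"
    "(\<Sum>l\<in>K - {k}. g l) = comb (\<lambda>l. if l = k then 0 else 1)"
proof -
  let ?c = "\<lambda>l. if l = k then 0 else 1 :: int"
  have "comb ?c = (\<Sum>l\<in>K - {k}. ?c l *s g l)"
    unfolding comb_def by (subst sum.remove[OF finK k]) simp
  also have "\<dots> = (\<Sum>l\<in>K - {k}. g l)" by (intro sum.cong) auto
  finally show c: "(\<Sum>l\<in>K - {k}. g l) = comb ?c" by simp
  show "deg (\<Sum>l\<in>K - {k}. g l) = int CARD('m)"
    unfolding c deg_comb using cardK by (simp add: sum.remove[OF finK k] card_Diff_singleton[OF k])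
  show "inI (\<Sum>l\<in>K - {k}. g l)"
  proof (cases "k \<in> Pos")
    case True
    then have "chamber 0 ?c" using Pos_Neg_disjoint by (auto simp: chamber_def)
    then show ?thesis unfolding c by (rule chamber_inI)
  next
    case False
    define s :: real where "s = - 1 / (1 + of_int total)"
    have t: "(0::real) < 1 + of_int total" using total_pos by simp
    have "of_int (?c l) + s * of_int (\<rho> l) > 0" if "l \<in> K" for l
    proof (cases "l \<in> Pos")
      case True
      have "\<rho> l \<le> total" unfolding total_def using finPos True PosD
        by (intro member_le_sum) (auto intro: less_imp_le)
      then have "of_int (\<rho> l) < (1 + of_int total :: real)" by simp
      then have "of_int (\<rho> l) / (1 + of_int total) < (1::real)" using t by simp
      then show ?thesis using True False by (auto simp: s_def)
    next
      case l: False
      then have "\<rho> l < 0" using that K_eq NegD by blast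
      then have "s * of_int (\<rho> l) > 0" using t by (intro mult_neg_neg) (auto simp: s_def)
      then show ?thesis by (cases "l = k") auto
    qed
    then show ?thesis unfolding c inI_comb by blast
  qed
qed

end

context circuit_polynomial
begin

text \<open>
  The matrix of second derivatives is \<open>\<Sum> a\<^sub>k t^g\<^sub>k g\<^sub>k g\<^sub>k\<^sup>T\<close>, a product of a matrix of size
  \<open>(d + r) \<times> (d + r + 1)\<close> with a transposed one.
\<close>

lemma hessian_eq:
  "hessian F = (\<Sum>k\<in>K. single (\<Sum>l\<in>K - {k}. g l) ((of_int (\<rho> k))\<^sup>2 * (\<Prod>l\<in>K - {k}. a l)))"
proof -
  define z where "z k = single (g k) (a k)" for k
  have entry: "log_deriv i (log_deriv j F) = (\<Sum>k\<in>K. (of_int (g k $ i) * z k) * of_int (g k $ j))" for i j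
    unfolding log_deriv_F log_deriv_sum log_deriv_single z_def
    by (simp add: mult_single mult_ac flip: single_of_int)
  have "hessian F = det (\<chi> i j. \<Sum>k\<in>K. (of_int (g k $ i) * z k) * of_int (g k $ j))"
    by (simp add: hessian_def entry)
  also have "\<dots> = (\<Sum>k\<in>K. det (\<chi> i j. of_int (g (enum k j) $ i) * z (enum k j))
      * det (\<chi> i j. of_int (g (enum k i) $ j)))"
    by (rule det_product_one_extra[OF finK cardK bij_enum])
  also have "\<dots> = (\<Sum>k\<in>K. of_int ((minor k)\<^sup>2) * (\<Prod>l\<in>K - {k}. z l))"
  proof (rule sum.cong[OF refl])
    fix k assume k: "k \<in> K"
    have m: "det (\<chi> i j. of_int (g (enum k i) $ j)) = (of_int (minor k) :: 'm laurent)"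
      by (simp add: det_of_int minor_def vec_lambda_eta)
    have "(\<chi> i j. of_int (g (enum k j) $ i) * z (enum k j))
        = transpose (\<chi> i. z (enum k i) *s (\<chi> j. of_int (g (enum k i) $ j)))"
      by (simp add: transpose_def vec_eq_iff mult.commute)
    then have "det (\<chi> i j. of_int (g (enum k j) $ i) * z (enum k j))
        = (\<Prod>i\<in>UNIV. z (enum k i)) * of_int (minor k)"
      by (simp add: det_transpose det_rows_mul m)
    also have "(\<Prod>i\<in>UNIV. z (enum k i)) = (\<Prod>l\<in>K - {k}. z l)"
      by (rule prod.reindex_bij_betw[OF bij_enum[OF k]])
    finally show "det (\<chi> i j. of_int (g (enum k j) $ i) * z (enum k j))
      * det (\<chi> i j. of_int (g (enum k i) $ j)) = of_int ((minor k)\<^sup>2) * (\<Prod>l\<in>K - {k}. z l)"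
      by (simp add: m power2_eq_square mult_ac)
  qed
  also have "\<dots> = (\<Sum>k\<in>K. single (\<Sum>l\<in>K - {k}. g l) ((of_int (\<rho> k))\<^sup>2 * (\<Prod>l\<in>K - {k}. a l)))"
  proof (rule sum.cong[OF refl])
    fix k assume k: "k \<in> K"
    have "(minor k)\<^sup>2 = (\<rho> k)\<^sup>2" using abs_minor[OF k] by (simp add: abs_eq_iff power2_eq_iff)
    then show "of_int ((minor k)\<^sup>2) * (\<Prod>l\<in>K - {k}. z l)
      = single (\<Sum>l\<in>K - {k}. g l) ((of_int (\<rho> k))\<^sup>2 * (\<Prod>l\<in>K - {k}. a l))"
      unfolding z_def using finK
      by (simp add: prod_single mult_single flip: single_of_int)
  qed
  finally show ?thesis .
qed

lemma hessian_in_I: "hessian F \<in> I_degree J A CARD('m)"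
  unfolding I_degree_iff hessian_eq
  by (rule ballI, drule keys_sum_monomials) (use hessian_point in blast)

end

context circuit_residue
begin

text \<open>
  This is \<open>\<mu> y\<close> in the application. It is also the factor by which \<open>\<Prod> \<gamma>\<^sub>k^c\<^sub>k\<close> changes when \<open>\<rho>\<close> is
  subtracted from \<open>c\<close>, provided that \<open>a\<^sub>k \<gamma>\<^sub>k = -\<rho>\<^sub>k\<close> for all \<open>k\<close>.
\<close>

definition \<Lambda> :: complex where
  "\<Lambda> = (\<Prod>k\<in>Pos. (a k / - of_int (\<rho> k)) ^ nat (\<rho> k)) * (\<Prod>k\<in>Neg. \<gamma> k ^ nat (- \<rho> k))"

definition R :: complex where "R = (\<Prod>k\<in>K. - of_int (\<rho> k))"

lemma R_remove: "k \<in> K \<Longrightarrow> (of_int (\<rho> k))\<^sup>2 * (\<Prod>l\<in>K - {k}. - of_int (\<rho> l)) = - of_int (\<rho> k) * R"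
  unfolding R_def by (simp add: prod.remove[OF finK, of k "\<lambda>k. - of_int (\<rho> k)"] power2_eq_square)

text \<open>
  The term that omits \<open>g\<^sub>k\<close> contributes \<open>-\<rho>\<^sub>k R\<close> if \<open>\<rho>\<^sub>k > 0\<close>. If \<open>\<rho>\<^sub>k < 0\<close>, its coordinates become normal
  on subtracting \<open>\<rho>\<close>, and the contribution is \<open>-\<rho>\<^sub>k R \<Lambda>\<close>. The positive and the negative \<open>\<rho>\<^sub>k\<close> have
  opposite sums.
\<close>

lemma res_hessian: "res (hessian F) = - R * of_int total * (1 - \<Lambda>)"
proof -
  have "res (hessian F) = (\<Sum>k\<in>K. (of_int (\<rho> k))\<^sup>2 * (\<Prod>l\<in>K - {k}. a l) * wt (\<Sum>l\<in>K - {k}. g l))"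
    unfolding hessian_eq res_def lin_ext_sum lin_ext_single using hessian_point(2) by simp
  also have "\<dots> = (\<Sum>k\<in>Pos. - of_int (\<rho> k) * R) + (\<Sum>k\<in>Neg. - of_int (\<rho> k) * R * \<Lambda>)"
    unfolding sum_K
  proof (intro arg_cong2[where f="(+)"] sum.cong refl)
    fix k assume k: "k \<in> Pos"
    then have kK: "k \<in> K" using PosD by blast
    have n: "normal (\<lambda>l. if l = k then 0 else 1)"
      using k PosD by (fastforce simp: normal_def)
    have "wt (\<Sum>l\<in>K - {k}. g l) = (\<Prod>l\<in>K - {k}. \<gamma> l)"
      unfolding hessian_point(3)[OF kK] wt_comb[OF n] by (simp add: prod.remove[OF finK kK])
    moreover have "a l * \<gamma> l = - of_int (\<rho> l)" if "l \<in> K - {k}" for l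
    proof (cases "l \<in> Neg")
      case False
      then have "l \<in> Pos" "l \<noteq> k" using that K_eq by blast+
      then have "card Pos > 1" using finPos k card_le_Suc0_iff_eq[OF finPos] by (metis One_nat_def not_le)
      then show ?thesis using a_gamma_Pos \<open>l \<in> Pos\<close> by blast
    qed (rule a_gamma_Neg)
    ultimately show "(of_int (\<rho> k))\<^sup>2 * (\<Prod>l\<in>K - {k}. a l) * wt (\<Sum>l\<in>K - {k}. g l) = - of_int (\<rho> k) * R"
      using R_remove[OF kK] by (simp add: mult.assoc flip: prod.distrib)
  next
    fix k assume k: "k \<in> Neg"
    then have kK: "k \<in> K" "k \<notin> Pos" using NegD Pos_Neg_disjoint by blast+
    \<comment> \<open>The coordinates \<open>1\<close> and \<open>0\<close> are positive on the whole positive part, so they are shifted by \<open>-\<rho>\<close>.\<close>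
    define c where "c l = (if l = k then 0 else 1) + (-1) * \<rho> l" for l
    have n: "normal c" using kK(2) Pos_nonempty PosD unfolding normal_def c_def by force
    have "(\<Sum>l\<in>K - {k}. g l) = comb c"
      unfolding hessian_point(3)[OF kK(1)] c_def comb_shift ..
    then have "wt (\<Sum>l\<in>K - {k}. g l) = (\<Prod>l\<in>K. \<gamma> l powi c l)"
      using wt_comb[OF n] by simp
    also have "\<dots> = (\<Prod>l\<in>Pos. \<gamma> l powi (1 - \<rho> l)) * ((\<Prod>l\<in>Neg - {k}. \<gamma> l) * (\<Prod>l\<in>Neg. \<gamma> l ^ nat (- \<rho> l)))"
    proof -
      have "(\<Prod>l\<in>Pos. \<gamma> l powi c l) = (\<Prod>l\<in>Pos. \<gamma> l powi (1 - \<rho> l))"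
        using kK(2) by (intro prod.cong) (auto simp: c_def)
      moreover have "(\<Prod>l\<in>Neg. \<gamma> l powi c l) = (\<Prod>l\<in>Neg. (if l = k then 1 else \<gamma> l) * \<gamma> l ^ nat (- \<rho> l))"
      proof (rule prod.cong[OF refl])
        fix l assume l: "l \<in> Neg"
        then have nz: "\<gamma> l \<noteq> 0" using NegD gamma_nz by blast
        have "\<gamma> l powi (- \<rho> l) = \<gamma> l ^ nat (- \<rho> l)"
          using NegD[OF l] by (simp add: power_int_def)
        moreover have "\<gamma> l powi (1 + - \<rho> l) = \<gamma> l powi 1 * \<gamma> l powi (- \<rho> l)"
          using nz by (intro power_int_add) simp
        ultimately show "\<gamma> l powi c l = (if l = k then 1 else \<gamma> l) * \<gamma> l ^ nat (- \<rho> l)"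
          by (cases "l = k") (simp_all add: c_def)
      qed
      moreover have "(\<Prod>l\<in>Neg. (if l = k then 1 else \<gamma> l)) = (\<Prod>l\<in>Neg - {k}. \<gamma> l)"
        by (subst prod.remove[OF finNeg k]) (auto intro!: prod.cong)
      ultimately show ?thesis by (simp only: prod_K prod.distrib)
    qed
    finally have w: "wt (\<Sum>l\<in>K - {k}. g l) = (\<Prod>l\<in>Pos. \<gamma> l powi (1 - \<rho> l))
        * ((\<Prod>l\<in>Neg - {k}. \<gamma> l) * (\<Prod>l\<in>Neg. \<gamma> l ^ nat (- \<rho> l)))" .
    have split: "(\<Prod>l\<in>K - {k}. h l) = (\<Prod>l\<in>Pos. h l) * (\<Prod>l\<in>Neg - {k}. h l)" for h :: "'k \<Rightarrow> complex"
    proof -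
      have "K - {k} = Pos \<union> (Neg - {k})" using K_eq kK(2) by blast
      moreover have "Pos \<inter> (Neg - {k}) = {}" using Pos_Neg_disjoint by blast
      ultimately show ?thesis using finPos finNeg by (simp add: prod.union_disjoint)
    qed
    have P: "(\<Prod>l\<in>Pos. a l) * (\<Prod>l\<in>Pos. \<gamma> l powi (1 - \<rho> l))
        = (\<Prod>l\<in>Pos. - of_int (\<rho> l)) * (\<Prod>l\<in>Pos. (a l / - of_int (\<rho> l)) ^ nat (\<rho> l))"
      unfolding prod.distrib[symmetric]
    proof (rule prod.cong[OF refl])
      fix l assume l: "l \<in> Pos"
      then have r: "\<rho> l > 0" and g0: "\<gamma> l \<noteq> 0" using PosD gamma_nz by auto
      show "a l * \<gamma> l powi (1 - \<rho> l) = - of_int (\<rho> l) * (a l / - of_int (\<rho> l)) ^ nat (\<rho> l)"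
      proof (cases "card Pos > 1")
        case True
        then have ag: "a l * \<gamma> l = - of_int (\<rho> l)" using a_gamma_Pos l by blast
        then have inv: "a l / - of_int (\<rho> l) = inverse (\<gamma> l)" using g0 r by (simp add: field_simps)
        have "\<gamma> l powi (- \<rho> l) = inverse (\<gamma> l) ^ nat (\<rho> l)"
          using r by (simp add: power_int_def)
        moreover have "\<gamma> l powi (1 + - \<rho> l) = \<gamma> l powi 1 * \<gamma> l powi (- \<rho> l)"
          using g0 by (intro power_int_add) simp
        ultimately have "a l * \<gamma> l powi (1 - \<rho> l) = (a l * \<gamma> l) * inverse (\<gamma> l) ^ nat (\<rho> l)"
          by simp
        then show ?thesis unfolding ag inv .
      next
        case False
        moreover have "card Pos \<noteq> 0" using finPos l by auto
        ultimately have "card Pos = 1" by linarith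
        then show ?thesis using rho_1 l by simp
      qed
    qed
    have N: "(\<Prod>l\<in>Neg - {k}. a l) * (\<Prod>l\<in>Neg - {k}. \<gamma> l) = (\<Prod>l\<in>Neg - {k}. - of_int (\<rho> l))"
      unfolding prod.distrib[symmetric] by (intro prod.cong) (auto simp: a_gamma_Neg)
    have "(\<Prod>l\<in>K - {k}. a l) * wt (\<Sum>l\<in>K - {k}. g l)
      = ((\<Prod>l\<in>Pos. a l) * (\<Prod>l\<in>Pos. \<gamma> l powi (1 - \<rho> l)))
        * ((\<Prod>l\<in>Neg - {k}. a l) * (\<Prod>l\<in>Neg - {k}. \<gamma> l)) * (\<Prod>l\<in>Neg. \<gamma> l ^ nat (- \<rho> l))"
      unfolding w split by (simp only: mult_ac)
    also have "\<dots> = (\<Prod>l\<in>K - {k}. - of_int (\<rho> l)) * \<Lambda>"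
      unfolding P N split \<Lambda>_def by (simp only: mult_ac)
    finally show "(of_int (\<rho> k))\<^sup>2 * (\<Prod>l\<in>K - {k}. a l) * wt (\<Sum>l\<in>K - {k}. g l) = - of_int (\<rho> k) * R * \<Lambda>"
      unfolding R_remove[OF kK(1), symmetric] by (simp only: mult.assoc)
  qed
  also have "\<dots> = - of_int total * R + of_int total * R * \<Lambda>"
  proof -
    have "(\<Sum>k\<in>Pos. of_int (\<rho> k)) = (of_int total :: complex)" by (simp add: total_def)
    moreover have "(\<Sum>k\<in>Neg. of_int (\<rho> k)) = (- of_int total :: complex)"
      using arg_cong[OF sum_Neg, of "of_int :: int \<Rightarrow> complex"] by simp
    ultimately show ?thesis by (simp add: sum_negf flip: sum_distrib_right)
  qed
  finally show ?thesis by (simp add: algebra_simps)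
qed

end

section \<open>The volume of the Cayley polytope\<close>

text \<open>
  A copy of a finite type that carries a well-order, as \<open>measure_linear_image\<close> requires of its
  index type. Relabelling the coordinates carries the volume of a simplex over to every finite type.
\<close>

typedef ('m::finite) ordered_index = "{..<CARD('m)}"
  by (rule exI[of _ 0]) simp

instantiation ordered_index :: (finite) linorder
begin

definition "x \<le> y \<longleftrightarrow> Rep_ordered_index x \<le> Rep_ordered_index y"
definition "x < y \<longleftrightarrow> Rep_ordered_index x < Rep_ordered_index y"

instance
  by standard (auto simp: less_eq_ordered_index_def less_ordered_index_def Rep_ordered_index_inject)

end

instance ordered_index :: (finite) wellorder
proof
  fix P :: "'a ordered_index \<Rightarrow> bool" and a
  assume *: "\<And>x. (\<And>y. y < x \<Longrightarrow> P y) \<Longrightarrow> P x"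
  show "P a"
    by (induction a rule: measure_induct_rule[where f = Rep_ordered_index])
      (use * in \<open>simp add: less_ordered_index_def\<close>)
qed

lemma UNIV_ordered_index: "(UNIV :: 'm::finite ordered_index set) = Abs_ordered_index ` {..<CARD('m)}"
  by (rule type_definition.Abs_image[OF type_definition_ordered_index, symmetric])

instance ordered_index :: (finite) finite
  by standard (simp add: UNIV_ordered_index)

lemma card_ordered_index: "CARD('m::finite ordered_index) = CARD('m)"
  by (simp add: type_definition.card[OF type_definition_ordered_index])

lemma det_reindex:
  fixes f :: "'n::finite \<Rightarrow> 'm::finite" and M :: "'m \<Rightarrow> 'm \<Rightarrow> 'a::comm_ring_1"
  assumes f: "bij f"
  shows "det (\<chi> i j. M (f i) (f j)) = det (\<chi> i j. M i j)"
proof -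
  have f': "bij (inv f)" using f by (rule bij_imp_bij_inv)
  have "(\<Sum>p | p permutes UNIV. of_int (sign p) * (\<Prod>i\<in>UNIV. M (f i) (f (p i))))
    = (\<Sum>p | p permutes UNIV. of_int (sign p) * (\<Prod>i\<in>UNIV. M i (p i)))"
  proof (rule sum.reindex_bij_witness[of _ "map_permutation UNIV (inv f)" "map_permutation UNIV f"])
    fix p :: "'n \<Rightarrow> 'n" assume "p \<in> {p. p permutes UNIV}"
    then have p: "p permutes UNIV" by simp
    show "map_permutation UNIV (inv f) (map_permutation UNIV f p) = p"
      using f p by (intro map_permutation_compose_inv[where B=UNIV]) (auto simp: bij_is_inj)
    show "map_permutation UNIV f p \<in> {p. p permutes UNIV}"
      using f p by (auto intro: map_permutation_permutes)
    have "(\<Prod>i\<in>UNIV. M i (map_permutation UNIV f p i))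
        = (\<Prod>i\<in>UNIV. M (f i) (map_permutation UNIV f p (f i)))"
      by (rule prod.reindex_bij_betw[OF f, symmetric])
    also have "\<dots> = (\<Prod>i\<in>UNIV. M (f i) (f (p i)))"
      using f by (simp add: map_permutation_apply bij_is_inj)
    finally show "of_int (sign (map_permutation UNIV f p)) * (\<Prod>i\<in>UNIV. M i (map_permutation UNIV f p i))
        = of_int (sign p) * (\<Prod>i\<in>UNIV. M (f i) (f (p i)))"
      using f p by (simp add: sign_map_permutation bij_is_inj)
  next
    fix p :: "'m \<Rightarrow> 'm" assume "p \<in> {p. p permutes UNIV}"
    then have p: "p permutes UNIV" by simp
    show "map_permutation UNIV f (map_permutation UNIV (inv f) p) = p"
      using f f' p by (intro map_permutation_compose_inv[where B=UNIV]) (auto simp: bij_is_surj surj_f_inv_f)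
    show "map_permutation UNIV (inv f) p \<in> {p. p permutes UNIV}"
      using f' p by (auto intro: map_permutation_permutes)
  qed
  then show ?thesis by (simp add: det_def)
qed

lemma prod_Basis_cart: "(\<Prod>b\<in>Basis. x \<bullet> b) = (\<Prod>i\<in>UNIV. (x :: real ^ 'n) $ i)"
proof -
  have B: "Basis = range (\<lambda>i. axis i 1 :: real ^ 'n)" by (auto simp: Basis_vec_def)
  have inj: "inj (\<lambda>i. axis i 1 :: real ^ 'n)" by (auto simp: inj_def axis_eq_axis)
  show ?thesis unfolding B prod.reindex[OF inj] by (simp add: inner_axis)
qed

text \<open>
  Relabelling the coordinates permutes the sides of boxes and so preserves Lebesgue measure.
\<close>

lemma measure_reindex:
  fixes f :: "'n::finite \<Rightarrow> 'm::finite" and S :: "(real ^ 'm) set"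
  assumes f: "bij f" and S: "compact S"
  shows "measure lebesgue ((\<lambda>x. \<chi> i. x $ f i) ` S) = measure lebesgue S"
proof -
  define T where "T = (\<lambda>x :: real ^ 'm. (\<chi> i. x $ f i) :: real ^ 'n)"
  define T' where "T' = (\<lambda>y :: real ^ 'n. (\<chi> i. y $ inv f i) :: real ^ 'm)"
  have TT': "T (T' y) = y" and T'T: "T' (T x) = x" for x y
    using f by (simp_all add: T_def T'_def vec_eq_iff bij_is_surj surj_f_inv_f bij_is_inj)
  have cT: "continuous_on A T" for A unfolding T_def by (intro continuous_intros)
  then have mT: "T \<in> borel_measurable borel" by (intro borel_measurable_continuous_onI)
  have "lborel = distr lborel borel T"
  proof (rule lborel_eqI)
    fix l u :: "real ^ 'n" assume le: "\<And>b. b \<in> Basis \<Longrightarrow> l \<bullet> b \<le> u \<bullet> b"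
    have le': "l $ i \<le> u $ i" for i using le[of "axis i 1"] by (simp add: inner_axis axis_in_Basis_iff)
    have vim: "T -` box l u = box (T' l) (T' u)"
    proof (intro equalityI subsetI)
      fix x assume "x \<in> T -` box l u"
      then have "l $ inv f i < x $ f (inv f i) \<and> x $ f (inv f i) < u $ inv f i" for i
        by (auto simp: mem_box_cart T_def)
      then show "x \<in> box (T' l) (T' u)"
        using f by (simp add: mem_box_cart T'_def bij_is_surj surj_f_inv_f)
    next
      fix x assume "x \<in> box (T' l) (T' u)"
      then have "l $ inv f (f i) < x $ f i \<and> x $ f i < u $ inv f (f i)" for i
        by (auto simp: mem_box_cart T'_def)
      then show "x \<in> T -` box l u" using f by (simp add: mem_box_cart T_def bij_is_inj)
    qed
    have "emeasure (distr lborel borel T) (box l u) = emeasure lborel (box (T' l) (T' u))"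
      using mT by (subst emeasure_distr) (auto simp: vim)
    also have "\<dots> = ennreal (\<Prod>b\<in>Basis. (T' u - T' l) \<bullet> b)"
    proof (rule emeasure_lborel_box)
      fix b :: "real ^ 'm" assume "b \<in> Basis"
      then show "T' l \<bullet> b \<le> T' u \<bullet> b" using le' by (auto simp: Basis_vec_def inner_axis T'_def)
    qed
    also have "(\<Prod>b\<in>Basis. (T' u - T' l) \<bullet> b) = (\<Prod>i\<in>UNIV. (u - l) $ inv f i)"
      unfolding prod_Basis_cart by (simp add: T'_def)
    also have "\<dots> = (\<Prod>i\<in>UNIV. (u - l) $ i)"
      by (rule prod.reindex_bij_betw[OF bij_imp_bij_inv[OF f], of "\<lambda>i. (u - l) $ i"])
    finally show "emeasure (distr lborel borel T) (box l u) = ennreal (\<Prod>b\<in>Basis. (u - l) \<bullet> b)"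
      unfolding prod_Basis_cart .
  qed simp
  have "compact (T ` S)" using S cT by (rule compact_continuous_image[rotated])
  then have bT: "T ` S \<in> sets borel" by (simp add: borel_compact)
  have bS: "S \<in> sets borel" using S by (simp add: borel_compact)
  have "measure lebesgue (T ` S) = measure lborel (T ` S)" using bT by (simp add: measure_completion)
  also have "\<dots> = measure (distr lborel borel T) (T ` S)" using \<open>lborel = _\<close> by simp
  also have "\<dots> = measure lborel (T -` (T ` S))"
    using mT bT by (simp add: measure_distr)
  also have "T -` (T ` S) = S" using T'T by (auto) (metis T'T)
  also have "measure lborel S = measure lebesgue S" using bS by (simp add: measure_completion)
  finally show ?thesis by (simp add: T_def)
qed

lemma simplex_measure_ordered:
  fixes W :: "'n::{finite,wellorder} \<Rightarrow> real ^ 'n::_"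
  shows "measure lebesgue (convex hull (insert 0 (range W))) = \<bar>det (\<chi> i. W i)\<bar> / fact CARD('n)"
proof -
  define M where "M = transpose (\<chi> i. W i)"
  define std where "std = (convex hull insert 0 Basis :: (real ^ 'n::_) set)"
  have "M *v axis i 1 = W i" for i
    by (simp add: M_def matrix_vector_mult_basis column_def transpose_def vec_eq_iff)
  then have "(\<lambda>x. M *v x) ` Basis = range W"
    by (auto simp: Basis_vec_def image_iff)
  then have im: "convex hull (insert 0 (range W)) = (\<lambda>x. M *v x) ` std"
    unfolding std_def convex_hull_linear_image[OF matrix_vector_mul_linear] image_insert by simp
  have c: "compact std" unfolding std_def by (intro finite_imp_compact_convex_hull) auto
  have "measure lebesgue ((\<lambda>x. M *v x) ` std) = \<bar>det M\<bar> * measure lebesgue std"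
    using c by (subst measure_linear_image) (auto intro: lmeasurable_compact)
  also have "measure lebesgue std = 1 / fact CARD('n)"
    using c by (simp add: measure_completion borel_compact std_def content_std_simplex)
  finally show ?thesis unfolding im by (simp add: M_def det_transpose)
qed

lemma simplex_measure:
  fixes V :: "'m::finite \<Rightarrow> real ^ 'm"
  shows "measure lebesgue (convex hull (insert 0 (range V))) = \<bar>det (\<chi> i. V i)\<bar> / fact CARD('m)"
proof -
  obtain f :: "'m ordered_index \<Rightarrow> 'm" where f: "bij f"
    using finite_same_card_bij[of "UNIV :: 'm ordered_index set" "UNIV :: 'm set"]
    by (auto simp: card_ordered_index)
  define T where "T = (\<lambda>x :: real ^ 'm. (\<chi> i. x $ f i) :: real ^ 'm ordered_index)"
  have linT: "linear T" unfolding T_def by (intro linearI) (simp_all add: vec_eq_iff)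
  have "measure lebesgue (convex hull (insert 0 (range V)))
      = measure lebesgue (T ` (convex hull (insert 0 (range V))))"
    unfolding T_def using f by (intro measure_reindex[symmetric] finite_imp_compact_convex_hull) auto
  also have "T ` (convex hull (insert 0 (range V))) = convex hull (insert 0 (range (\<lambda>i. T (V (f i)))))"
  proof -
    have "T 0 = 0" by (simp add: T_def vec_eq_iff)
    moreover have "T ` range V = range (\<lambda>i. T (V (f i)))"
      using bij_is_surj[OF f] by (metis image_image)
    ultimately show ?thesis unfolding convex_hull_linear_image[OF linT] image_insert by simp
  qed
  also have "measure lebesgue \<dots> = \<bar>det (\<chi> i. T (V (f i)))\<bar> / fact CARD('m)"
    unfolding simplex_measure_ordered card_ordered_index ..
  also have "det (\<chi> i. T (V (f i))) = det (\<chi> i j. V (f i) $ f j)" by (simp add: T_def)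
  also have "\<dots> = det (\<chi> i. V i)"
    using det_reindex[OF f, of "\<lambda>i j. V i $ j"] by (simp add: vec_lambda_eta)
  finally show ?thesis .
qed

context circuit
begin

lemma hull_gens:
  assumes "S \<subseteq> K"
  shows "convex hull (insert 0 (real_vec ` g ` S))
    = {rcomb c | c. (\<forall>k\<in>K. c k \<ge> 0) \<and> (\<forall>k\<in>K - S. c k = 0) \<and> (\<Sum>k\<in>K. c k) \<le> 1}" (is "?L = ?R")
proof
  have conv: "convex ?R"
  proof (rule convexI)
    fix x y and u v :: real
    assume "x \<in> ?R" "y \<in> ?R" and uv: "u \<ge> 0" "v \<ge> 0" "u + v = 1"
    then obtain c c' where c: "x = rcomb c" "\<forall>k\<in>K. c k \<ge> 0" "\<forall>k\<in>K - S. c k = 0" "(\<Sum>k\<in>K. c k) \<le> 1"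
      and c': "y = rcomb c'" "\<forall>k\<in>K. c' k \<ge> 0" "\<forall>k\<in>K - S. c' k = 0" "(\<Sum>k\<in>K. c' k) \<le> 1"
      by blast
    have "(\<Sum>k\<in>K. u * c k + v * c' k) = u * (\<Sum>k\<in>K. c k) + v * (\<Sum>k\<in>K. c' k)"
      by (simp add: sum.distrib sum_distrib_left)
    also have "\<dots> \<le> u * 1 + v * 1" using c c' uv by (intro add_mono mult_left_mono) auto
    finally have "(\<Sum>k\<in>K. u * c k + v * c' k) \<le> 1" using uv by simp
    moreover have "u *\<^sub>R x + v *\<^sub>R y = rcomb (\<lambda>k. u * c k + v * c' k)"
      by (simp add: c c' rcomb_linear)
    ultimately show "u *\<^sub>R x + v *\<^sub>R y \<in> ?R" using c c' uv by fastforce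
  qed
  have "0 \<in> ?R" using rcomb_linear(4) by (intro CollectI exI[of _ "\<lambda>k. 0"]) simp
  moreover have "real_vec (g k) \<in> ?R" if "k \<in> S" for k
    using that assms finK real_vec_gen[of k]
    by (intro CollectI exI[of _ "\<lambda>l. if l = k then 1 else 0"]) auto
  ultimately show "?L \<subseteq> ?R" by (intro hull_minimal conv) auto
next
  show "?R \<subseteq> ?L"
  proof
    fix x assume "x \<in> ?R"
    then obtain c where c: "x = rcomb c" "\<forall>k\<in>K. c k \<ge> 0" "\<forall>k\<in>K - S. c k = 0" "(\<Sum>k\<in>K. c k) \<le> 1"
      by blast
    have finS: "finite S" using assms finK by (rule finite_subset)
    define s where "s = (\<Sum>k\<in>S. c k)"
    have sK: "(\<Sum>k\<in>K. c k) = s" unfolding s_def using c(3) assms finK by (intro sum.mono_neutral_right) auto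
    have x: "x = (\<Sum>k\<in>S. c k *\<^sub>R real_vec (g k))"
      unfolding c(1) rcomb_def using c(3) assms finK by (intro sum.mono_neutral_right) auto
    have s0: "s \<ge> 0" unfolding s_def using c(2) assms by (intro sum_nonneg) auto
    have zero: "0 \<in> ?L" by (simp add: hull_inc)
    show "x \<in> ?L"
    proof (cases "s = 0")
      case True
      then have "\<forall>k\<in>S. c k = 0" using c(2) assms finS unfolding s_def
        by (subst (asm) sum_nonneg_eq_0_iff) auto
      then show ?thesis using zero x by simp
    next
      case False
      then have s: "s > 0" using s0 by simp
      have "(\<Sum>k\<in>S. (c k / s) *\<^sub>R real_vec (g k)) \<in> ?L"
        using c(2) assms s finS by (intro convex_sum convex_convex_hull)
          (auto simp: hull_inc simp flip: sum_divide_distrib s_def)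
      then have "(1 - s) *\<^sub>R 0 + s *\<^sub>R (\<Sum>k\<in>S. (c k / s) *\<^sub>R real_vec (g k)) \<in> ?L"
        using zero s c(4) sK by (intro convexD[OF convex_convex_hull]) auto
      then show ?thesis using s by (simp add: x scaleR_sum_right)
    qed
  qed
qed

lemma measure_facet_simplex:
  assumes k: "k \<in> K"
  shows "measure lebesgue (convex hull (insert 0 (real_vec ` g ` (K - {k})))) = of_int \<bar>\<rho> k\<bar> / fact CARD('m)"
proof -
  have "real_vec ` g ` (K - {k}) = range (\<lambda>i. real_vec (g (enum k i)))"
    using bij_enum[OF k] unfolding bij_betw_def by (metis image_image)
  moreover have "det (\<chi> i. real_vec (g (enum k i))) = of_int (minor k)"
    using det_of_int[of "\<lambda>i j. g (enum k i) $ j", where ?'a=real]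
    by (simp add: minor_def real_vec_def vec_lambda_eta)
  ultimately show ?thesis using abs_minor[OF k] by (simp add: simplex_measure flip: of_int_abs)
qed

text \<open>
  The hull of the origin and the generators is the union of the simplices that omit one generator
  \<open>g\<^sub>k\<close> with \<open>\<rho>\<^sub>k > 0\<close>: subtract from nonnegative coordinates the largest multiple of \<open>\<rho>\<close> that
  leaves them nonnegative, which does not change their sum. A common point of two of the simplices has two
  vanishing coordinates, so the overlaps lie in proper subspaces.
\<close>

theorem Vol_eq: "Vol (cayley_polytope J A) = of_int total"
proof -
  define T where "T k = convex hull (insert 0 (real_vec ` g ` (K - {k})))" for k
  have T: "T k = {rcomb c | c. (\<forall>l\<in>K. c l \<ge> 0) \<and> c k = 0 \<and> (\<Sum>l\<in>K. c l) \<le> 1}" if "k \<in> K" for k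
  proof -
    have "K - (K - {k}) = {k}" using that by blast
    then show ?thesis unfolding T_def by (subst hull_gens) auto
  qed
  have sum_shift: "(\<Sum>k\<in>K. c k + s * of_int (\<rho> k)) = (\<Sum>k\<in>K. c k)" for c and s :: real
    using sum_rho by (simp add: sum.distrib flip: sum_distrib_left of_int_sum)
  have "convex hull (insert 0 (cayley_polytope J A)) = convex hull (insert 0 (real_vec ` g ` K))"
    unfolding polytope by (rule hull_insert[symmetric])
  also have "\<dots> = (\<Union>k\<in>Pos. T k)"
  proof (intro equalityI subsetI)
    fix x assume "x \<in> convex hull (insert 0 (real_vec ` g ` K))"
    then obtain c where c: "x = rcomb c" "\<forall>k\<in>K. c k \<ge> 0" "(\<Sum>k\<in>K. c k) \<le> 1"
      using hull_gens[OF order_refl] by auto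
    define h where "h k = c k / of_int (\<rho> k)" for k
    define s where "s = Min (h ` Pos)"
    have "s \<in> h ` Pos" unfolding s_def using finPos Pos_nonempty by (intro Min_in) auto
    then obtain k0 where k0: "k0 \<in> Pos" "s = h k0" by blast
    have sle: "s \<le> h k" if "k \<in> Pos" for k unfolding s_def using finPos that by simp
    have s0: "s \<ge> 0" using k0 c(2) PosD[OF k0(1)] by (simp add: h_def)
    have rp: "(0::real) < of_int (\<rho> k)" if "k \<in> Pos" for k using PosD[OF that] by simp
    define c' where "c' k = c k + (- s) * of_int (\<rho> k)" for k
    have "c' k \<ge> 0" if "k \<in> K" for k
    proof (cases "k \<in> Pos")
      case True
      have "s * of_int (\<rho> k) \<le> h k * of_int (\<rho> k)"
        using sle[OF True] rp[OF True] by (intro mult_right_mono) auto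
      then show ?thesis using rp[OF True] by (simp add: c'_def h_def)
    next
      case False
      then have "\<rho> k < 0" using that K_eq NegD by blast
      then have "s * of_int (\<rho> k) \<le> 0" using s0 by (simp add: mult_nonneg_nonpos)
      moreover have "c k \<ge> 0" using c(2) that by blast
      ultimately show ?thesis unfolding c'_def by linarith
    qed
    moreover have "c' k0 = 0" using rp[OF k0(1)] by (simp add: c'_def k0(2) h_def)
    moreover have "x = rcomb c'" unfolding c'_def rcomb_shift by (rule c(1))
    moreover have "(\<Sum>k\<in>K. c' k) \<le> 1" unfolding c'_def sum_shift by (rule c(3))
    ultimately have "x \<in> T k0" using T[of k0] PosD[OF k0(1)] by blast
    then show "x \<in> (\<Union>k\<in>Pos. T k)" using k0(1) by blast
  next
    fix x assume "x \<in> (\<Union>k\<in>Pos. T k)"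
    then obtain k where "x \<in> T k" by blast
    moreover have "T k \<subseteq> convex hull (insert 0 (real_vec ` g ` K))"
      unfolding T_def by (rule hull_mono) auto
    ultimately show "x \<in> convex hull (insert 0 (real_vec ` g ` K))" by blast
  qed
  finally have hull: "convex hull (insert 0 (cayley_polytope J A)) = (\<Union>k\<in>Pos. T k)" .
  have neg: "negligible (T k \<inter> T l)" if k: "k \<in> Pos" and l: "l \<in> Pos" and kl: "k \<noteq> l" for k l
  proof -
    define B where "B = (\<lambda>k. real_vec (g k)) ` (K - {k, l})"
    have kK: "k \<in> K" "l \<in> K" using k l PosD by blast+
    have "T k \<inter> T l \<subseteq> span B"
    proof
      fix x assume "x \<in> T k \<inter> T l"
      then obtain c c' where c: "x = rcomb c" "\<forall>l\<in>K. c l \<ge> 0" "c k = 0"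
        and c': "x = rcomb c'" "\<forall>l\<in>K. c' l \<ge> 0" "c' l = 0"
        unfolding Int_iff T[OF kK(1)] T[OF kK(2)] by blast
      obtain s where s: "\<forall>k\<in>K. c' k = c k + s * of_int (\<rho> k)"
        using rcomb_eqD[of c c'] c(1) c'(1) by auto
      have "s * of_int (\<rho> k) \<ge> 0" using s kK c'(2) c(3) by fastforce
      then have "s \<ge> 0" using PosD[OF k] by (simp add: zero_le_mult_iff)
      have "0 = c l + s * of_int (\<rho> l)" using s kK c'(3) by simp
      moreover have "s * of_int (\<rho> l) \<ge> 0" using \<open>s \<ge> 0\<close> PosD[OF l] by simp
      ultimately have cl: "c l = 0" using c(2) kK by (metis add_nonneg_eq_0_iff)
      have "x = (\<Sum>k\<in>K - {k, l}. c k *\<^sub>R real_vec (g k))"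
        unfolding c(1) rcomb_def using finK cl c(3) by (intro sum.mono_neutral_right) auto
      also have "\<dots> \<in> span B" unfolding B_def by (intro span_sum span_scale span_base imageI)
      finally show "x \<in> span B" .
    qed
    moreover have "negligible (span B)"
    proof (rule negligible_lowdim)
      have "card (K - {k, l}) = card K - card {k, l}"
        using kK finK by (intro card_Diff_subset) auto
      then have "card (K - {k, l}) = CARD('m) - 1" using cardK kl by simp
      moreover have "dim (span B) \<le> card B" using finK by (simp add: B_def dim_le_card')
      moreover have "card B \<le> card (K - {k, l})" unfolding B_def using finK by (intro card_image_le) auto
      moreover have "CARD('m) > 0" by simp
      ultimately have "dim (span B) < CARD('m)" by linarith
      then show "dim (span B) < DIM(real ^ 'm)" by simp
    qed
    ultimately show ?thesis by (rule negligible_subset[rotated])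
  qed
  have "measure lebesgue (\<Union>k\<in>Pos. T k) = (\<Sum>k\<in>Pos. measure lebesgue (T k))"
  proof (rule measure_negligible_finite_Union_image[OF finPos])
    show "T k \<in> lmeasurable" for k
      unfolding T_def using finK by (intro lmeasurable_compact finite_imp_compact_convex_hull) auto
    show "pairwise (\<lambda>x y. negligible (T x \<inter> T y)) Pos" using neg by (auto simp: pairwise_def)
  qed
  also have "\<dots> = (\<Sum>k\<in>Pos. of_int (\<rho> k) / fact CARD('m))"
  proof (rule sum.cong[OF refl])
    fix k assume "k \<in> Pos"
    then show "measure lebesgue (T k) = of_int (\<rho> k) / fact CARD('m)"
      using PosD[of k] measure_facet_simplex[of k] by (simp add: T_def)
  qed
  also have "\<dots> = of_int total / fact CARD('m)" by (simp add: total_def flip: sum_divide_distrib)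
  finally have "measure lebesgue (convex hull (insert 0 (cayley_polytope J A))) = of_int total / fact CARD('m)"
    unfolding hull .
  moreover have "fact (CARD('m) - 1) * real CARD('m) = fact CARD('m)"
    by (simp add: fact_reduce[of "CARD('m)"] mult.commute)
  ultimately show ?thesis by (simp add: Vol_def hyperplane_volume_def flip: mult.assoc)
qed

end

section \<open>Regularity: no critical point on the torus\<close>

lemma lookup_single_mult:
  fixes h :: "'a::ab_group_add \<Rightarrow>\<^sub>0 complex"
  shows "lookup (single v c * h) u = c * lookup h (u - v)"
proof -
  have "lookup (single v c * h) u
      = lin_ext (\<lambda>x. if x = u then 1 else 0) (single v c * h)"
    by (auto simp: lin_ext_def in_keys_iff if_distrib cong: if_cong)
  also have "\<dots> = (\<Sum>x\<in>keys h. if x = u - v then c * lookup h (u - v) else 0)"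
    unfolding lin_ext_single_mult by (intro sum.cong refl) (auto simp: algebra_simps)
  also have "\<dots> = c * lookup h (u - v)"
    by (auto simp: in_keys_iff)
  finally show ?thesis .
qed

lemma lin_ext_mult:
  assumes "\<And>u v. f (u + v) = f u * f v"
  shows "lin_ext f (h * h') = lin_ext f h * lin_ext f h'"
proof -
  have "lin_ext f (h * h') = (\<Sum>u\<in>keys h. lin_ext f (single u (lookup h u) * h'))"
    by (subst monomial_expansion[of h]) (simp only: sum_distrib_right lin_ext_sum)
  then show ?thesis
    unfolding lin_ext_single_mult assms by (simp add: lin_ext_def sum_product mult_ac)
qed

text \<open>
  Telescoping \<open>\<Prod> z\<^sub>k^p\<^sub>k - z\<^sub>0^(\<Sum> p\<^sub>k)\<close> factor by factor. The cofactor of \<open>z\<^sub>k - z\<^sub>0\<close> has \<open>p\<^sub>k\<close> terms, each of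
  which is a product of factors \<open>z\<close> and hence is mapped to 1.
\<close>

lemma power_product_difference:
  fixes z :: "'k \<Rightarrow> 'a::comm_ring_1" and ev :: "'a \<Rightarrow> complex"
  assumes "finite S"
    and R: "1 \<in> R" "\<And>x y. x \<in> R \<Longrightarrow> y \<in> R \<Longrightarrow> x + y \<in> R" "\<And>x y. x \<in> R \<Longrightarrow> y \<in> R \<Longrightarrow> x * y \<in> R" "0 \<in> R"
    and ev: "ev 0 = 0" "ev 1 = 1" "\<And>x y. ev (x + y) = ev x + ev y" "\<And>x y. ev (x * y) = ev x * ev y"
    and z0: "z0 \<in> R" "ev z0 = 1" and z: "\<And>k. k \<in> S \<Longrightarrow> z k \<in> R \<and> ev (z k) = 1"
  shows "\<exists>T. (\<forall>k\<in>S. T k \<in> R \<and> ev (T k) = of_nat (p k))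
     \<and> (\<Prod>k\<in>S. z k ^ p k) - z0 ^ (\<Sum>k\<in>S. p k) = (\<Sum>k\<in>S. (z k - z0) * T k)"
  using assms(1) z
proof (induction S rule: finite_induct)
  case (insert x S)
  have Rpow: "y ^ n \<in> R" if "y \<in> R" for y n using that by (induction n) (auto simp: R)
  have Rprod: "(\<Prod>k\<in>X. f k) \<in> R" if "\<And>k. k \<in> X \<Longrightarrow> f k \<in> R" for f :: "'k \<Rightarrow> 'a" and X
    using that by (induction X rule: infinite_finite_induct) (auto simp: R)
  have Rsum: "(\<Sum>i<n. f i) \<in> R" if "\<And>i. f i \<in> R" for f :: "nat \<Rightarrow> 'a" and n
    using that by (induction n) (auto simp: R)
  have evpow: "ev (y ^ n) = ev y ^ n" for y n by (induction n) (auto simp: ev)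
  have evprod: "ev (\<Prod>k\<in>X. f k) = (\<Prod>k\<in>X. ev (f k))" for f :: "'k \<Rightarrow> 'a" and X
    by (induction X rule: infinite_finite_induct) (auto simp: ev)
  have evsum: "ev (\<Sum>i<n. f i) = (\<Sum>i<n. ev (f i))" for f :: "nat \<Rightarrow> 'a" and n
    by (induction n) (auto simp: ev)
  from insert obtain T where T: "\<forall>k\<in>S. T k \<in> R \<and> ev (T k) = of_nat (p k)"
     "(\<Prod>k\<in>S. z k ^ p k) - z0 ^ (\<Sum>k\<in>S. p k) = (\<Sum>k\<in>S. (z k - z0) * T k)" by blast
  define P where "P = (\<Prod>k\<in>S. z k ^ p k)"
  define Q where "Q = (\<Sum>i<p x. z0 ^ (p x - Suc i) * z x ^ i)"
  define T' where "T' k = (if k = x then Q * P else z0 ^ p x * T k)" for k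
  have P: "P \<in> R" "ev P = 1" using insert.prems
    by (auto simp: P_def evprod evpow intro!: Rprod Rpow)
  have Q: "Q \<in> R" "ev Q = of_nat (p x)" using insert.prems z0
    by (auto simp: Q_def evsum evpow ev intro!: Rsum R Rpow)
  have eq: "z x ^ p x - z0 ^ p x = (z x - z0) * Q"
    unfolding Q_def by (rule power_diff_sumr2)
  have "(\<Prod>k\<in>insert x S. z k ^ p k) - z0 ^ (\<Sum>k\<in>insert x S. p k)
      = (z x ^ p x - z0 ^ p x) * P + z0 ^ p x * (P - z0 ^ (\<Sum>k\<in>S. p k))"
    using insert.hyps by (simp add: P_def power_add algebra_simps)
  also have "\<dots> = (z x - z0) * (Q * P) + (\<Sum>k\<in>S. (z k - z0) * (z0 ^ p x * T k))"
    unfolding eq P_def T(2) by (simp add: sum_distrib_left mult_ac)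
  also have "\<dots> = (\<Sum>k\<in>insert x S. (z k - z0) * T' k)"
  proof -
    have "(\<Sum>k\<in>S. (z k - z0) * T' k) = (\<Sum>k\<in>S. (z k - z0) * (z0 ^ p x * T k))"
      using insert.hyps by (intro sum.cong) (auto simp: T'_def)
    then show ?thesis using insert.hyps by (simp add: T'_def)
  qed
  finally have "(\<Prod>k\<in>insert x S. z k ^ p k) - z0 ^ (\<Sum>k\<in>insert x S. p k)
      = (\<Sum>k\<in>insert x S. (z k - z0) * T' k)" .
  moreover have "\<forall>k\<in>insert x S. T' k \<in> R \<and> ev (T' k) = of_nat (p k)"
    using P Q T(1) z0 by (auto simp: T'_def ev evpow intro!: R Rpow)
  ultimately show ?case by blast
qed simp

context circuit
begin

lemma character_exists:
  fixes \<gamma> :: "'k \<Rightarrow> complex"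
  assumes nz: "\<And>k. k \<in> K \<Longrightarrow> \<gamma> k \<noteq> 0" and one: "(\<Prod>k\<in>K. \<gamma> k powi \<rho> k) = 1"
  shows "\<exists>ch. (\<forall>u v. ch (u + v) = ch u * ch v) \<and> ch 0 = 1 \<and> (\<forall>k\<in>K. ch (g k) = \<gamma> k)"
proof -
  define ch where "ch u = (\<Prod>k\<in>K. \<gamma> k powi (SOME c. u = comb c) k)" for u
  have *: "ch (comb c) = (\<Prod>k\<in>K. \<gamma> k powi c k)" for c
  proof -
    define c' where "c' = (SOME c'. comb c = comb c')"
    have "comb c = comb c'" unfolding c'_def by (rule someI[of _ c]) simp
    then obtain s where s: "\<forall>k\<in>K. c' k = c k + s * \<rho> k" using comb_eqD by blast
    have "ch (comb c) = (\<Prod>k\<in>K. \<gamma> k powi c' k)" by (simp add: ch_def c'_def)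
    also have "\<dots> = (\<Prod>k\<in>K. \<gamma> k powi c k * (\<gamma> k powi \<rho> k) powi s)"
    proof (rule prod.cong[OF refl])
      fix k assume k: "k \<in> K"
      have "\<gamma> k powi c' k = \<gamma> k powi (c k + \<rho> k * s)" using s k by (simp add: mult.commute)
      also have "\<dots> = \<gamma> k powi c k * \<gamma> k powi (\<rho> k * s)" using nz[OF k] by (intro power_int_add) simp
      finally show "\<gamma> k powi c' k = \<gamma> k powi c k * (\<gamma> k powi \<rho> k) powi s"
        by (simp only: power_int_mult)
    qed
    also have "\<dots> = (\<Prod>k\<in>K. \<gamma> k powi c k) * (\<Prod>k\<in>K. \<gamma> k powi \<rho> k) powi s"
    proof -
      have "(\<Prod>k\<in>X. f k powi s) = (\<Prod>k\<in>X. f k) powi s" for X :: "'k set" and f :: "'k \<Rightarrow> complex"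
        by (induction X rule: infinite_finite_induct) (simp_all add: power_int_mult_distrib)
      then show ?thesis by (simp add: prod.distrib)
    qed
    finally show ?thesis by (simp add: one)
  qed
  have "ch (u + v) = ch u * ch v" for u v
  proof -
    obtain c c' where c: "u = comb c" "v = comb c'" using comb_surj by metis
    show ?thesis unfolding c comb_linear(1)[symmetric] * prod.distrib[symmetric]
      using nz by (intro prod.cong) (auto simp: power_int_add)
  qed
  moreover have "ch 0 = 1" using *[of "\<lambda>k. 0"] by (simp add: comb_def)
  moreover have "ch (g k) = \<gamma> k" if "k \<in> K" for k
  proof -
    have "ch (g k) = (\<Prod>l\<in>K. \<gamma> l powi (if l = k then 1 else 0))"
      using *[of "\<lambda>l. if l = k then 1 else 0"] comb_single[OF that, of 1] by simp
    also have "\<dots> = (\<Prod>l\<in>K. if l = k then \<gamma> k else 1)" by (intro prod.cong) auto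
    finally show ?thesis using that finK by simp
  qed
  ultimately show ?thesis by blast
qed

lemma inC_deg: "inC u \<Longrightarrow> deg u \<ge> 0"
proof -
  assume u: "inC u"
  obtain c where c: "u = comb c" using comb_surj by blast
  obtain s :: real where s: "\<forall>k\<in>K. of_int (c k) + s * of_int (\<rho> k) \<ge> 0"
    using u unfolding c inC_comb by blast
  have "0 \<le> (\<Sum>k\<in>K. of_int (c k) + s * of_int (\<rho> k))" using s by (intro sum_nonneg) blast
  also have "\<dots> = of_int (\<Sum>k\<in>K. c k)"
    using sum_rho by (simp add: sum.distrib flip: sum_distrib_left of_int_sum)
  finally have "0 \<le> (\<Sum>k\<in>K. c k)" by (simp only: of_int_0_le_iff)
  then show ?thesis by (simp add: c deg_comb)
qed

end

context circuit_polynomial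
begin

lemma S_closed:
  "0 \<in> S_ring J A" "1 \<in> S_ring J A"
  "h \<in> S_ring J A \<Longrightarrow> h' \<in> S_ring J A \<Longrightarrow> h + h' \<in> S_ring J A"
  "h \<in> S_ring J A \<Longrightarrow> - h \<in> S_ring J A"
  "h \<in> S_ring J A \<Longrightarrow> h' \<in> S_ring J A \<Longrightarrow> h * h' \<in> S_ring J A"
proof -
  show "h + h' \<in> S_ring J A" if "h \<in> S_ring J A" "h' \<in> S_ring J A"
    using that keys_add[of h h'] unfolding S_ring_iff by blast
  show "h * h' \<in> S_ring J A" if "h \<in> S_ring J A" "h' \<in> S_ring J A"
    using that keys_mult[of h h'] inC_add unfolding S_ring_iff by blast
qed (auto simp: S_ring_iff inC_0 in_keys_iff lookup_one when_def split: if_splits)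

lemma S_sum: "(\<And>i. i \<in> X \<Longrightarrow> f i \<in> S_ring J A) \<Longrightarrow> sum f X \<in> S_ring J A"
  by (induction X rule: infinite_finite_induct) (auto simp: S_closed)

lemma S_single: "inC u \<Longrightarrow> single u c \<in> S_ring J A"
  by (simp add: S_ring_iff)

lemma S_lconst: "lconst c \<in> S_ring J A"
  unfolding lconst_def by (rule S_single[OF inC_0])

text \<open>
  The order in which the \<open>F\<^sub>m\<close> form a regular sequence disappears from the statement.
\<close>

lemma koszul:
  assumes reg: "Delta_regular J A F" and hS: "\<And>m. h m \<in> S_ring J A"
    and syz: "(\<Sum>m\<in>UNIV. log_deriv m F * h m) = 0"
  shows "\<exists>B. (\<forall>m m'. B m m' \<in> S_ring J A) \<and> (\<forall>m m'. B m m' = - B m' m)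
    \<and> (\<forall>m. h m = (\<Sum>m'\<in>UNIV. B m m' * log_deriv m' F))"
proof -
  obtain ms where ms: "distinct ms" "set ms = UNIV"
    and rs: "regular_sequence (S_ring J A) (map (\<lambda>m. log_deriv m F) ms)"
    using reg by (auto simp: Delta_regular_def)
  have bij: "bij_betw ((!) ms) {..<length ms} UNIV" using ms by (intro bij_betw_nth) auto
  define ix where "ix = inv_into {..<length ms} ((!) ms)"
  have ix: "ix m < length ms" "ms ! ix m = m" for m
    using bij_betw_inv_into_right[OF bij, of m] bij_betwE[OF bij_betw_inv_into[OF bij]] by (auto simp: ix_def)
  have reindex: "(\<Sum>l<length ms. f (ms ! l)) = (\<Sum>m\<in>UNIV. f m)" for f :: "'m \<Rightarrow> 'm laurent"
    by (rule sum.reindex_bij_betw[OF bij])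
  have "(\<Sum>l<length ms. h (ms ! l) * log_deriv (ms ! l) F) = 0"
    using reindex[of "\<lambda>m. h m * log_deriv m F"] syz by (simp add: mult.commute)
  then have syz': "(\<Sum>l<length (map (\<lambda>m. log_deriv m F) ms). h (ms ! l) * map (\<lambda>m. log_deriv m F) ms ! l) = 0"
    by simp
  from regular_sequence_koszul[where h = "\<lambda>l. h (ms ! l)", OF rs S_closed(1,3,4,5) hS syz']
  obtain B where B: "\<forall>k l. B k l \<in> S_ring J A" "\<forall>k l. B k l = - B l k"
    and B3: "\<forall>l<length (map (\<lambda>m. log_deriv m F) ms). h (ms ! l)
      = (\<Sum>k<length (map (\<lambda>m. log_deriv m F) ms). B l k * map (\<lambda>m. log_deriv m F) ms ! k)"
    by blast
  have "h m = (\<Sum>m'\<in>UNIV. B (ix m) (ix m') * log_deriv m' F)" for m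
  proof -
    have "h m = (\<Sum>k<length ms. B (ix m) k * log_deriv (ms ! k) F)" 
      using B3[rule_format, of "ix m"] ix[of m] by simp
    also have "\<dots> = (\<Sum>k<length ms. B (ix m) (ix (ms ! k)) * log_deriv (ms ! k) F)"
      using bij_betw_inv_into_left[OF bij] by (intro sum.cong) (auto simp: ix_def)
    finally show ?thesis unfolding reindex[of "\<lambda>m'. B (ix m) (ix m') * log_deriv m' F"] .
  qed
  then show ?thesis using B(1,2) by (intro exI[of _ "\<lambda>m m'. B (ix m) (ix m')"]) blast
qed

definition z :: "'k \<Rightarrow> 'm laurent" where "z k = single (g k) (a k)"

lemma lconst_single: "lconst c * single u b = single u (c * b)"
  by (simp add: lconst_def mult_single)

lemma lconst_sum: "lconst (sum f X) = (\<Sum>i\<in>X. lconst (f i))"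
  unfolding lconst_def by (rule poly_mapping_eqI) (simp add: lookup_sum lookup_single when_def)

lemma lconst_mult: "lconst c * lconst b = lconst (c * b)"
  by (simp add: lconst_def mult_single)

lemma log_deriv_F_z: "log_deriv m F = (\<Sum>k\<in>K. lconst (of_int (g k $ m)) * z k)"
  unfolding log_deriv_F z_def lconst_single ..

lemma functional_F:
  assumes "\<And>k. k \<in> K \<Longrightarrow> (\<Sum>m\<in>UNIV. c m * of_int (g k $ m)) = \<kappa> k"
  shows "(\<Sum>m\<in>UNIV. lconst (c m) * log_deriv m F) = (\<Sum>k\<in>K. lconst (\<kappa> k) * z k)"
proof -
  have "(\<Sum>m\<in>UNIV. lconst (c m) * log_deriv m F)
      = (\<Sum>m\<in>UNIV. \<Sum>k\<in>K. lconst (c m * of_int (g k $ m)) * z k)"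
    unfolding log_deriv_F_z sum_distrib_left by (simp add: mult.assoc flip: lconst_mult)
  also have "\<dots> = (\<Sum>k\<in>K. \<Sum>m\<in>UNIV. lconst (c m * of_int (g k $ m)) * z k)"
    by (rule sum.swap)
  also have "\<dots> = (\<Sum>k\<in>K. lconst (\<kappa> k) * z k)"
    by (intro sum.cong refl) (simp add: assms flip: sum_distrib_right lconst_sum)
  finally show ?thesis .
qed

text \<open>
  If the product is 1, then \<open>\<gamma>\<^sub>k = -\<rho>\<^sub>k / a\<^sub>k\<close> is the restriction of a character of the lattice, that is,
  a point of the torus, and all \<open>F\<^sub>m\<close> vanish there. In terms of \<open>\<zeta>\<^sub>k = t^g\<^sub>k / \<gamma>\<^sub>k\<close>, the span of the
  \<open>F\<^sub>m\<close> is that of the differences \<open>\<zeta>\<^sub>k - \<zeta>\<^sub>l\<close>, and the relation between the generators reads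
  \<open>\<Prod> \<zeta>\<^sub>k^\<rho>\<^sub>k = 1\<close>. Telescoped, it becomes a syzygy of the \<open>F\<^sub>m\<close> whose coefficients do not
  all vanish at the point, whereas the coefficients of a Koszul syzygy do.
\<close>

lemma regular_no_torus_zero:
  assumes reg: "Delta_regular J A F" and nz: "\<And>k. k \<in> K \<Longrightarrow> a k \<noteq> 0"
  shows "(\<Prod>k\<in>K. (- of_int (\<rho> k) / a k) powi \<rho> k) \<noteq> 1"
proof
  define \<gamma> where "\<gamma> k = - of_int (\<rho> k) / a k" for k
  assume "(\<Prod>k\<in>K. (- of_int (\<rho> k) / a k) powi \<rho> k) = 1"
  then have one: "(\<Prod>k\<in>K. \<gamma> k powi \<rho> k) = 1" by (simp add: \<gamma>_def)
  have gnz: "\<gamma> k \<noteq> 0" if "k \<in> K" for k using nz[OF that] rho_nz[OF that] by (simp add: \<gamma>_def)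
  obtain ch where ch: "\<And>u v. ch (u + v) = ch u * ch v" "ch 0 = 1" "\<And>k. k \<in> K \<Longrightarrow> ch (g k) = \<gamma> k"
    using character_exists[OF gnz one] by blast
  define ev where "ev = lin_ext ch"
  have ev: "ev 0 = 0" "ev 1 = 1" "ev (x + y) = ev x + ev y" "ev (x * y) = ev x * ev y" for x y
    using lin_ext_single[of ch 0 1] by (simp_all add: ev_def lin_ext_add lin_ext_mult ch)
  have ev_lconst: "ev (lconst c * x) = c * ev x" for c x by (simp add: ev_def lin_ext_lconst_mult)
  have ev_sum: "ev (sum f X) = (\<Sum>i\<in>X. ev (f i))" for f :: "'c \<Rightarrow> 'm laurent" and X
    by (simp add: ev_def lin_ext_sum)
  have evF: "ev (log_deriv m F) = 0" for m
  proof -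
    have "ev (log_deriv m F) = (\<Sum>k\<in>K. - (of_int (\<rho> k) * of_int (g k $ m)))"
      unfolding log_deriv_F ev_def lin_ext_sum lin_ext_single
      using nz by (intro sum.cong refl) (simp add: ch(3) \<gamma>_def)
    also have "\<dots> = - of_int ((\<Sum>k\<in>K. \<rho> k *s g k) $ m)"
      by (simp add: sum_component sum_negf)
    finally show ?thesis using relation by simp
  qed
  define \<zeta> where "\<zeta> k = single (g k) (1 / \<gamma> k)" for k
  have \<zeta>S: "\<zeta> k \<in> S_ring J A" "ev (\<zeta> k) = 1" if "k \<in> K" for k
    using that gnz[OF that] by (simp_all add: \<zeta>_def S_single inC_gen ev_def ch(3))
  obtain k0 where k0: "k0 \<in> K" "k0 \<in> Neg" using Neg_nonempty NegD by blast
  obtain k1 where "k1 \<in> Pos" using Pos_nonempty by blast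
  then have k1: "k1 \<in> K" "k1 \<noteq> k0" using PosD[of k1] NegD[OF k0(2)] by auto
  have telescope: "\<exists>T. (\<forall>k\<in>S. T k \<in> S_ring J A \<and> ev (T k) = of_nat (p k))
     \<and> (\<Prod>k\<in>S. \<zeta> k ^ p k) - \<zeta> k0 ^ (\<Sum>k\<in>S. p k) = (\<Sum>k\<in>S. (\<zeta> k - \<zeta> k0) * T k)"
    if "finite S" "\<And>k. k \<in> S \<Longrightarrow> \<zeta> k \<in> S_ring J A \<and> ev (\<zeta> k) = 1" for S p
    by (rule power_product_difference[where R = "S_ring J A" and ev = ev])
      (simp_all add: that S_closed ev \<zeta>S k0(1))
  have "\<zeta> k \<in> S_ring J A \<and> ev (\<zeta> k) = 1" if "k \<in> Pos" for k using \<zeta>S PosD[OF that] by blast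
  from telescope[OF finPos this, of "\<lambda>k. nat (\<rho> k)"]
  obtain T where T: "\<forall>k\<in>Pos. T k \<in> S_ring J A \<and> ev (T k) = of_nat (nat (\<rho> k))"
     "(\<Prod>k\<in>Pos. \<zeta> k ^ nat (\<rho> k)) - \<zeta> k0 ^ (\<Sum>k\<in>Pos. nat (\<rho> k)) = (\<Sum>k\<in>Pos. (\<zeta> k - \<zeta> k0) * T k)"
    by blast
  have "\<zeta> k \<in> S_ring J A \<and> ev (\<zeta> k) = 1" if "k \<in> Neg" for k using \<zeta>S NegD[OF that] by blast
  from telescope[OF finNeg this, of "\<lambda>k. nat (- \<rho> k)"]
  obtain T' where T': "\<forall>k\<in>Neg. T' k \<in> S_ring J A \<and> ev (T' k) = of_nat (nat (- \<rho> k))"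
     "(\<Prod>k\<in>Neg. \<zeta> k ^ nat (- \<rho> k)) - \<zeta> k0 ^ (\<Sum>k\<in>Neg. nat (- \<rho> k)) = (\<Sum>k\<in>Neg. (\<zeta> k - \<zeta> k0) * T' k)"
    by blast
  define U where "U k = (if k \<in> Pos then T k else - T' k)" for k
  have US: "U k \<in> S_ring J A" "ev (U k) = of_int (\<rho> k)" if "k \<in> K" for k
  proof -
    have neg: "ev (- x) = - ev x" for x
    proof -
      have "ev x + ev (- x) = 0" using ev(3)[of x "- x"] ev(1) by simp
      then show ?thesis by (simp add: eq_neg_iff_add_eq_0 add.commute)
    qed
    have "U k \<in> S_ring J A \<and> ev (U k) = of_int (\<rho> k)"
    proof (cases "k \<in> Pos")
      case True
      then show ?thesis using T(1) PosD[OF True] by (simp add: U_def)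
    next
      case False
      then have "k \<in> Neg" using that K_eq by blast
      then show ?thesis using T'(1) NegD[of k] False S_closed(4) by (simp add: U_def neg)
    qed
    then show "U k \<in> S_ring J A" "ev (U k) = of_int (\<rho> k)" by blast+
  qed
  have "int (\<Sum>k\<in>Pos. nat (\<rho> k)) = (\<Sum>k\<in>Pos. \<rho> k)"
    unfolding of_nat_sum using PosD by (intro sum.cong refl) force
  moreover have "int (\<Sum>k\<in>Neg. nat (- \<rho> k)) = - (\<Sum>k\<in>Neg. \<rho> k)"
    unfolding of_nat_sum sum_negf[symmetric] using NegD by (intro sum.cong refl) force
  ultimately have degs: "(\<Sum>k\<in>Pos. nat (\<rho> k)) = (\<Sum>k\<in>Neg. nat (- \<rho> k))"
    using sum_Neg total_def by linarith
  have rp: "0 \<le> \<rho> k" if "k \<in> Pos" for k using PosD[OF that] by simp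
  have rn: "\<not> 0 \<le> \<rho> k" "\<rho> k \<le> 0" if "k \<in> Neg" for k using NegD[OF that] by simp_all
  have prods: "(\<Prod>k\<in>Pos. \<zeta> k ^ nat (\<rho> k)) = (\<Prod>k\<in>Neg. \<zeta> k ^ nat (- \<rho> k))"
  proof -
    have pw: "\<zeta> k ^ n = single (int n *s g k) ((1 / \<gamma> k) ^ n)" for k n
      by (induction n) (simp_all add: \<zeta>_def mult_single vec_eq_iff algebra_simps)
    have exps: "(\<Sum>k\<in>Pos. int (nat (\<rho> k)) *s g k) = (\<Sum>k\<in>Neg. int (nat (- \<rho> k)) *s g k)"
    proof -
      have 1: "(\<Sum>k\<in>Pos. int (nat (\<rho> k)) *s g k) = (\<Sum>k\<in>Pos. \<rho> k *s g k)"
        by (intro sum.cong) (auto simp: rp)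
      have 2: "(\<Sum>k\<in>Neg. int (nat (- \<rho> k)) *s g k) = - (\<Sum>k\<in>Neg. \<rho> k *s g k)"
        unfolding sum_negf[symmetric] by (intro sum.cong) (auto simp: vec_eq_iff rn)
      have "(\<Sum>k\<in>Pos. \<rho> k *s g k) + (\<Sum>k\<in>Neg. \<rho> k *s g k) = 0"
        using relation by (simp add: sum_K[of "\<lambda>k. \<rho> k *s g k"])
      then show ?thesis unfolding 1 2 by (simp add: eq_neg_iff_add_eq_0)
    qed
    have coeffs: "(\<Prod>k\<in>Pos. (1 / \<gamma> k) ^ nat (\<rho> k)) = (\<Prod>k\<in>Neg. (1 / \<gamma> k) ^ nat (- \<rho> k))"
    proof -
      have "(\<Prod>k\<in>Pos. \<gamma> k powi \<rho> k) * (\<Prod>k\<in>Neg. \<gamma> k powi \<rho> k) = 1" using one by (simp add: prod_K)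
      moreover have "(\<Prod>k\<in>Pos. \<gamma> k powi \<rho> k) = inverse (\<Prod>k\<in>Pos. (1 / \<gamma> k) ^ nat (\<rho> k))"
        unfolding prod_inversef[symmetric] o_def
        by (intro prod.cong) (auto simp: power_int_def rp field_simps)
      moreover have "(\<Prod>k\<in>Neg. \<gamma> k powi \<rho> k) = (\<Prod>k\<in>Neg. (1 / \<gamma> k) ^ nat (- \<rho> k))"
        by (intro prod.cong) (auto simp: power_int_def rn field_simps)
      moreover have "(\<Prod>k\<in>Pos. (1 / \<gamma> k) ^ nat (\<rho> k)) \<noteq> 0"
        using gnz PosD finPos by auto
      ultimately show ?thesis by (simp add: field_simps)
    qed
    show ?thesis unfolding pw prod_single[OF finPos] prod_single[OF finNeg] exps coeffs ..
  qed
  have U0: "(\<Sum>k\<in>K. (\<zeta> k - \<zeta> k0) * U k) = 0"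
  proof -
    have "(\<Sum>k\<in>Pos. (\<zeta> k - \<zeta> k0) * U k) = (\<Sum>k\<in>Pos. (\<zeta> k - \<zeta> k0) * T k)"
      by (intro sum.cong) (auto simp: U_def)
    moreover have "(\<Sum>k\<in>Neg. (\<zeta> k - \<zeta> k0) * U k) = - (\<Sum>k\<in>Neg. (\<zeta> k - \<zeta> k0) * T' k)"
      unfolding sum_negf[symmetric] using Pos_Neg_disjoint by (intro sum.cong) (auto simp: U_def)
    ultimately show ?thesis unfolding sum_K T(2)[symmetric] T'(2)[symmetric] prods degs by simp
  qed
  \<comment> \<open>The functional that turns \<open>F\<close> into \<open>\<zeta>\<^sub>k - \<zeta>\<^bsub>k0\<^esub>\<close>, because \<open>a\<^sub>l t^g\<^sub>l = -\<rho>\<^sub>l \<zeta>\<^sub>l\<close>.\<close>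
  define \<kappa> where "\<kappa> k l = ((if l = k0 then 1 else 0) - (if l = k then 1 else 0)) / (of_int (\<rho> l) :: complex)" for k l
  have "\<exists>c. \<forall>l\<in>K. (\<Sum>m\<in>UNIV. c m * of_int (g l $ m)) = \<kappa> k l" if k: "k \<in> K" for k
  proof (rule functional_exists)
    have "(\<Sum>l\<in>K. of_int (\<rho> l) * \<kappa> k l) = (\<Sum>l\<in>K. (if l = k0 then 1 else 0) - (if l = k then 1 else 0))"
      using rho_nz by (intro sum.cong) (auto simp: \<kappa>_def)
    then show "(\<Sum>l\<in>K. of_int (\<rho> l) * \<kappa> k l) = 0" using k k0(1) finK by (simp add: sum_subtractf)
  qed
  then obtain c where c: "\<And>k l. k \<in> K \<Longrightarrow> l \<in> K \<Longrightarrow> (\<Sum>m\<in>UNIV. c k m * of_int (g l $ m)) = \<kappa> k l"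
    by metis
  have Fc: "(\<Sum>m\<in>UNIV. lconst (c k m) * log_deriv m F) = \<zeta> k - \<zeta> k0" if k: "k \<in> K" for k
  proof -
    have "(\<Sum>m\<in>UNIV. lconst (c k m) * log_deriv m F) = (\<Sum>l\<in>K. lconst (\<kappa> k l) * z l)"
      by (rule functional_F) (rule c[OF k])
    also have "\<dots> = (\<Sum>l\<in>K. (if l = k then \<zeta> k else 0) - (if l = k0 then \<zeta> k0 else 0))"
    proof (rule sum.cong[OF refl])
      fix l assume l: "l \<in> K"
      have "a l / of_int (\<rho> l) = - (1 / \<gamma> l)" using nz[OF l] rho_nz[OF l] by (simp add: \<gamma>_def)
      then have "\<kappa> k l * a l = ((if l = k then 1 else 0) - (if l = k0 then 1 else 0)) * (1 / \<gamma> l)"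
        by (auto simp: \<kappa>_def)
      then show "lconst (\<kappa> k l) * z l = (if l = k then \<zeta> k else 0) - (if l = k0 then \<zeta> k0 else 0)"
        unfolding z_def lconst_single by (auto simp: \<zeta>_def single_uminus)
    qed
    also have "\<dots> = \<zeta> k - \<zeta> k0" using k k0(1) finK by (simp add: sum_subtractf)
    finally show ?thesis .
  qed
  define h where "h m = (\<Sum>k\<in>K. lconst (c k m) * U k)" for m
  have "(\<Sum>m\<in>UNIV. log_deriv m F * h m) = (\<Sum>m\<in>UNIV. \<Sum>k\<in>K. lconst (c k m) * log_deriv m F * U k)"
    unfolding h_def sum_distrib_left by (simp only: mult_ac)
  also have "\<dots> = (\<Sum>k\<in>K. \<Sum>m\<in>UNIV. lconst (c k m) * log_deriv m F * U k)" by (rule sum.swap)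
  also have "\<dots> = (\<Sum>k\<in>K. (\<zeta> k - \<zeta> k0) * U k)"
    by (intro sum.cong refl) (simp add: Fc flip: sum_distrib_right)
  finally have syz: "(\<Sum>m\<in>UNIV. log_deriv m F * h m) = 0" using U0 by simp
  have "h m \<in> S_ring J A" for m unfolding h_def by (intro S_sum S_closed(5) S_lconst US)
  then obtain B where "\<And>m. h m = (\<Sum>m'\<in>UNIV. B m m' * log_deriv m' F)"
    using koszul[OF reg _ syz] by metis
  then have evh: "ev (h m) = 0" for m by (simp add: ev_sum ev evF)
  have cm: "(\<Sum>k\<in>K. c k m * of_int (\<rho> k)) = 0" for m
    using evh[of m] US(2) by (simp add: h_def ev_sum ev_lconst)
  have "0 = (\<Sum>m\<in>UNIV. (\<Sum>k\<in>K. c k m * of_int (\<rho> k)) * of_int (g k1 $ m))" by (simp add: cm)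
  also have "\<dots> = (\<Sum>m\<in>UNIV. \<Sum>k\<in>K. of_int (\<rho> k) * (c k m * of_int (g k1 $ m)))"
    unfolding sum_distrib_right by (simp only: mult_ac)
  also have "\<dots> = (\<Sum>k\<in>K. \<Sum>m\<in>UNIV. of_int (\<rho> k) * (c k m * of_int (g k1 $ m)))" by (rule sum.swap)
  also have "\<dots> = (\<Sum>k\<in>K. of_int (\<rho> k) * \<kappa> k k1)"
    by (intro sum.cong refl) (simp add: c k1(1) flip: sum_distrib_left)
  also have "\<dots> = (\<Sum>k\<in>K. if k = k1 then -1 else 0)"
    using rho_nz k1 by (intro sum.cong) (auto simp: \<kappa>_def)
  also have "\<dots> = -1" using k1(1) finK by simp
  finally show False by simp
qed

end

section \<open>Regularity: no vanishing coefficient at a vertex\<close>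

context circuit_polynomial
begin

text \<open>
  The sum equals its own negative.
\<close>

lemma lookup_antisymmetric_sum:
  fixes E :: "'c \<Rightarrow> 'c \<Rightarrow> 'm laurent" and y :: "'c \<Rightarrow> 'm laurent"
  assumes "\<And>i j. E i j = - E j i"
  shows "lookup (\<Sum>i\<in>X. \<Sum>j\<in>X. y i * y j * E i j) u = 0"
proof -
  define Q where "Q = (\<Sum>i\<in>X. \<Sum>j\<in>X. y i * y j * E i j)"
  have "Q = (\<Sum>i\<in>X. \<Sum>j\<in>X. y j * y i * E j i)" unfolding Q_def by (rule sum.swap)
  also have "\<dots> = (\<Sum>i\<in>X. \<Sum>j\<in>X. - (y i * y j * E i j))"
  proof (intro sum.cong refl)
    fix i j
    show "y j * y i * E j i = - (y i * y j * E i j)"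
      unfolding assms[of j i] by (simp add: mult.commute[of "y j"])
  qed
  also have "\<dots> = - Q" by (simp add: Q_def sum_negf)
  finally have "lookup Q u = - lookup Q u" by (metis lookup_uminus)
  then show ?thesis by (simp add: Q_def)
qed

text \<open>
  Suppose \<open>a\<^sub>k\<^sub>0 = 0\<close> with \<open>k\<^sub>0\<close> in the positive part. Then the span of the \<open>F\<^sub>m\<close> contains the terms
  \<open>z\<^sub>k = a\<^sub>k t^g\<^sub>k\<close> for all \<open>k \<noteq> k\<^sub>0\<close>. Let \<open>k\<^sub>1 \<noteq> k\<^sub>0\<close> have maximal \<open>\<rho>\<close> in the positive part and let
  \<open>u = \<Sum> (-\<rho>\<^sub>l / \<rho>\<^bsub>k1\<^esub>) g\<^sub>l\<close>, summed over the negative part. Both \<open>u - g\<^bsub>k1\<^esub>\<close> and \<open>u - g\<^sub>l\<close> lie in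
  the cone, so writing \<open>t^u\<close> in two ways gives a syzygy between \<open>z\<^bsub>k1\<^esub>\<close> and \<open>z\<^sub>l\<close>. It is not a
  Koszul syzygy: by maximality, \<open>u - g\<^sub>l - g\<^sub>k\<close> is outside the cone for every \<open>k \<noteq> k\<^sub>0\<close> in the positive
  part, so for a Koszul syzygy the part that belongs to the negative generators has coefficient 0
  at \<open>t^u\<close>.
\<close>

lemma regular_vertex_nonzero:
  assumes reg: "Delta_regular J A F" and Neg_nz: "\<And>l. l \<in> Neg \<Longrightarrow> a l \<noteq> 0"
    and two: "card Pos > 1" and k0: "k0 \<in> Pos"
  shows "a k0 \<noteq> 0"
proof
  assume ak0: "a k0 = 0"
  have k0K: "k0 \<in> K" and rk0: "\<rho> k0 > 0" using PosD[OF k0] by auto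
  define N where "N = Max (\<rho> ` (Pos - {k0}))"
  have ne: "Pos - {k0} \<noteq> {}"
  proof
    assume "Pos - {k0} = {}"
    then have "Pos = {k0}" using k0 by blast
    then show False using two by simp
  qed
  have "N \<in> \<rho> ` (Pos - {k0})" unfolding N_def using finPos ne by (intro Max_in) auto
  then obtain k1 where k1: "k1 \<in> Pos" "k1 \<noteq> k0" "\<rho> k1 = N" by auto
  have max: "\<rho> k \<le> \<rho> k1" if "k \<in> Pos" "k \<noteq> k0" for k
    unfolding k1(3) N_def using finPos that by (intro Max_ge) auto
  have k1K: "k1 \<in> K" and rk1: "\<rho> k1 > 0" using PosD[OF k1(1)] by auto
  have functional: "\<exists>c. (\<forall>i\<in>K. (\<Sum>m\<in>UNIV. c m * of_int (g i $ m))
      = (if i = k then 1 else if i = k0 then - of_int (\<rho> k) / of_int (\<rho> k0) else 0))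
      \<and> (\<Sum>m\<in>UNIV. lconst (c m) * log_deriv m F) = z k"
    if k: "k \<in> K" "k \<noteq> k0" for k
  proof -
    define \<kappa> where "\<kappa> i = (if i = k then 1 else if i = k0 then - of_int (\<rho> k) / of_int (\<rho> k0) else 0 :: complex)" for i
    have "(\<Sum>i\<in>K. of_int (\<rho> i) * \<kappa> i) = (\<Sum>i\<in>{k, k0}. of_int (\<rho> i) * \<kappa> i)"
      using k k0K finK by (intro sum.mono_neutral_right) (auto simp: \<kappa>_def)
    also have "\<dots> = 0" using k rk0 by (simp add: \<kappa>_def)
    finally obtain c where c: "\<And>i. i \<in> K \<Longrightarrow> (\<Sum>m\<in>UNIV. c m * of_int (g i $ m)) = \<kappa> i"
      using functional_exists[of \<kappa>] by blast
    have "(\<Sum>m\<in>UNIV. lconst (c m) * log_deriv m F) = (\<Sum>i\<in>K. lconst (\<kappa> i) * z i)"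
      by (rule functional_F) (rule c)
    also have "\<dots> = (\<Sum>i\<in>K. if i = k then z k else 0)"
      using ak0 by (intro sum.cong) (auto simp: \<kappa>_def z_def lconst_single)
    also have "\<dots> = z k" using k finK by simp
    finally show ?thesis using c unfolding \<kappa>_def by blast
  qed
  obtain c where c: "\<And>i. i \<in> K \<Longrightarrow> (\<Sum>m\<in>UNIV. c m * of_int (g i $ m))
      = (if i = k1 then 1 else if i = k0 then - of_int (\<rho> k1) / of_int (\<rho> k0) else 0 :: complex)"
    and Fc: "(\<Sum>m\<in>UNIV. lconst (c m) * log_deriv m F) = z k1"
    using functional[OF k1K k1(2)] by blast
  \<comment> \<open>Two vanishing coefficients would make the \<open>F\<^sub>m\<close> linearly dependent: a syzygy with constant coefficients, which are not in the ideal of the \<open>F\<^sub>m\<close> for reasons of degree.\<close>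
  have ak1: "a k1 \<noteq> 0"
  proof
    assume "a k1 = 0"
    then have "(\<Sum>m\<in>UNIV. log_deriv m F * lconst (c m)) = 0"
      using Fc by (simp add: z_def mult.commute)
    from koszul[OF reg S_lconst this] obtain B
      where BS: "\<And>m m'. B m m' \<in> S_ring J A"
        and B: "\<And>m. lconst (c m) = (\<Sum>m'\<in>UNIV. B m m' * log_deriv m' F)" by blast
    have "c m = 0" for m
    proof -
      have "lookup (B m m' * log_deriv m' F) 0 = 0" for m'
      proof -
        have "B m m' * log_deriv m' F
            = (\<Sum>k\<in>K. single (g k) (of_int (g k $ m') * a k) * B m m')"
          unfolding log_deriv_F by (simp add: sum_distrib_left mult.commute)
        moreover have "lookup (B m m') (0 - g k) = 0" if "k \<in> K" for k
        proof (rule ccontr)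
          assume "lookup (B m m') (0 - g k) \<noteq> 0"
          then have "inC (0 - g k)" using BS by (auto simp: S_ring_iff in_keys_iff)
          then have "deg (0 - g k) \<ge> 0" by (rule inC_deg)
          moreover have "deg (0 - g k) + deg (g k) = deg 0" by (simp flip: deg_add)
          ultimately show False using deg_gen[OF that] by (simp add: deg_def)
        qed
        ultimately show ?thesis by (simp add: lookup_sum lookup_single_mult)
      qed
      moreover have "lookup (lconst (c m) :: 'm laurent) 0
          = (\<Sum>m'\<in>UNIV. lookup (B m m' * log_deriv m' F) 0)"
        by (subst B) (rule lookup_sum)
      ultimately have "lookup (lconst (c m) :: 'm laurent) 0 = 0" by simp
      then show ?thesis by (simp add: lconst_def)
    qed
    then show False using c[OF k1K] by simp
  qed
  obtain l1 where l1: "l1 \<in> Neg" using Neg_nonempty by blast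
  have l1K: "l1 \<in> K" using NegD[OF l1] by simp
  have ne1: "l1 \<noteq> k0" "l1 \<noteq> k1" using l1 k0 k1 Pos_Neg_disjoint by blast+
  obtain c' where c': "\<And>i. i \<in> K \<Longrightarrow> (\<Sum>m\<in>UNIV. c' m * of_int (g i $ m))
      = (if i = l1 then 1 else if i = k0 then - of_int (\<rho> l1) / of_int (\<rho> k0) else 0 :: complex)"
    and Fc': "(\<Sum>m\<in>UNIV. lconst (c' m) * log_deriv m F) = z l1"
    using functional[OF l1K ne1(1)] by blast
  define e where "e k = (if k \<in> Neg then (- \<rho> k) div \<rho> k1 else 0)" for k
  define u where "u = comb e"
  have e: "e l * \<rho> k1 = - \<rho> l" "e l \<ge> 1" if "l \<in> Neg" for l
  proof -
    have "\<rho> k1 dvd - \<rho> l" using rho_dvd[OF k1K _ rk1] NegD[OF that] by simp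
    then show 1: "e l * \<rho> k1 = - \<rho> l" using that by (simp add: e_def)
    show "e l \<ge> 1"
    proof (rule ccontr)
      assume "\<not> e l \<ge> 1"
      then have "e l * \<rho> k1 \<le> 0" using rk1 by (simp add: mult_nonpos_nonneg)
      then show False using 1 NegD[OF that] by simp
    qed
  qed
  have ePos: "e k = 0" if "k \<in> Pos" for k using that Pos_Neg_disjoint by (auto simp: e_def)
  \<comment> \<open>The shift by \<open>t\<close> makes the coordinates of \<open>u\<close> on the negative part vanish.\<close>
  define t :: real where "t = 1 / of_int (\<rho> k1)"
  have t: "t > 0" "t * of_int (\<rho> k1) = 1" using rk1 by (simp_all add: t_def)
  have et: "of_int (e l) + t * of_int (\<rho> l) = 0" if "l \<in> Neg" for l
  proof -
    have "of_int (e l) * (t * of_int (\<rho> k1)) = t * (of_int (e l) * of_int (\<rho> k1))"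
      by (rule mult.left_commute)
    also have "\<dots> = - t * (of_int (\<rho> l) :: real)"
      using arg_cong[OF e(1)[OF that], of real_of_int] by simp
    finally show ?thesis using t(2) by simp
  qed
  have uA: "inC (u - g k1)"
  proof -
    have *: "u - g k1 = comb (e(k1 := e k1 + -1))"
      unfolding u_def comb_add_gen[OF k1K] by (simp add: vec_eq_iff)
    have "of_int ((e(k1 := e k1 + -1)) k) + t * of_int (\<rho> k) \<ge> 0" if "k \<in> K" for k
    proof (cases "k \<in> Pos")
      case True
      have "t * of_int (\<rho> k) \<ge> 0" using t(1) PosD[OF True] by simp
      then show ?thesis using ePos[OF True] t(2) by (cases "k = k1") auto
    next
      case False
      then have "k \<in> Neg" "k \<noteq> k1" using that K_eq k1(1) by blast+
      then show ?thesis using et by simp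
    qed
    then show ?thesis unfolding * inC_comb by blast
  qed
  have uB: "inC (u - g l1)"
  proof -
    have *: "u - g l1 = comb (e(l1 := e l1 + -1))"
      unfolding u_def comb_add_gen[OF l1K] by (simp add: vec_eq_iff)
    have "(e(l1 := e l1 + -1)) k \<ge> 0" if "k \<in> K" for k
      using that K_eq e(2)[of k] e(2)[OF l1] ePos[of k] by (cases "k \<in> Pos") auto
    then show ?thesis unfolding * inC_comb by (intro exI[of _ 0]) simp
  qed
  have separated: "\<not> inC (u - g l - g k)" if l: "l \<in> Neg" and k: "k \<in> Pos" "k \<noteq> k0" for l k
  proof
    define e' where "e' = e(l := e l + -1)"
    define e'' where "e'' = e'(k := e' k + -1)"
    have lK: "l \<in> K" "k \<in> K" "l \<noteq> k" using NegD[OF l] PosD[OF k(1)] by auto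
    have "u - g l - g k = comb e''"
      unfolding e''_def comb_add_gen[OF lK(2)] e'_def comb_add_gen[OF lK(1)] u_def by (simp add: vec_eq_iff)
    moreover assume "inC (u - g l - g k)"
    ultimately obtain s :: real where s: "\<forall>i\<in>K. of_int (e'' i) + s * of_int (\<rho> i) \<ge> 0"
      using inC_comb by metis
    have "of_int (e'' k) + s * of_int (\<rho> k) \<ge> 0" using s lK by blast
    then have sk: "s * of_int (\<rho> k) \<ge> 1" using ePos[OF k(1)] lK by (simp add: e''_def e'_def)
    have sl: "of_int (e l) - 1 + s * of_int (\<rho> l) \<ge> 0"
      using s lK by (auto simp: e''_def e'_def dest!: bspec[of _ _ l])
    have "s * of_int (\<rho> l) > t * of_int (\<rho> l)" using sl et[OF l] by linarith
    then have "s < t" using NegD[OF l] by simp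
    then have "s * of_int (\<rho> k) < t * of_int (\<rho> k)" using PosD[OF k(1)] by simp
    also have "\<dots> \<le> t * of_int (\<rho> k1)" using max[OF k] t(1) by simp
    finally show False using sk t(2) by simp
  qed
  define h where "h m = lconst (c m) * single (u - g k1) (a l1)
      - lconst (c' m) * single (u - g l1) (a k1)" for m
  have hS: "h m \<in> S_ring J A" for m
  proof -
    have 1: "lconst (c m) * single (u - g k1) (a l1) \<in> S_ring J A"
      by (intro S_closed(5) S_lconst S_single uA)
    have 2: "lconst (c' m) * single (u - g l1) (a k1) \<in> S_ring J A"
      by (intro S_closed(5) S_lconst S_single uB)
    show ?thesis using S_closed(3)[OF 1 S_closed(4)[OF 2]] by (simp add: h_def)
  qed
  have "(\<Sum>m\<in>UNIV. log_deriv m F * h m)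
      = (\<Sum>m\<in>UNIV. lconst (c m) * log_deriv m F) * single (u - g k1) (a l1)
        - (\<Sum>m\<in>UNIV. lconst (c' m) * log_deriv m F) * single (u - g l1) (a k1)"
    unfolding h_def sum_distrib_right sum_subtractf[symmetric] by (simp only: right_diff_distrib mult_ac)
  also have "\<dots> = 0" unfolding Fc Fc' z_def by (simp add: mult_single mult.commute)
  finally have syz: "(\<Sum>m\<in>UNIV. log_deriv m F * h m) = 0" .
  from koszul[OF reg hS syz] obtain B where BS: "\<And>m m'. B m m' \<in> S_ring J A"
    and Banti: "\<And>m m'. B m m' = - B m' m"
    and Bh: "\<And>m. h m = (\<Sum>m'\<in>UNIV. B m m' * log_deriv m' F)" by blast
  define E where "E i j = (\<Sum>m\<in>UNIV. \<Sum>m'\<in>UNIV. lconst (of_int (g i $ m)) * lconst (of_int (g j $ m')) * B m m')" for i j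
  have ES: "E i j \<in> S_ring J A" for i j
    unfolding E_def by (intro S_sum S_closed(5) S_lconst BS)
  have Eanti: "E i j = - E j i" for i j
  proof -
    have "E i j = (\<Sum>m'\<in>UNIV. \<Sum>m\<in>UNIV. lconst (of_int (g i $ m)) * lconst (of_int (g j $ m')) * B m m')"
      unfolding E_def by (rule sum.swap)
    also have "\<dots> = (\<Sum>m'\<in>UNIV. \<Sum>m\<in>UNIV. - (lconst (of_int (g j $ m')) * lconst (of_int (g i $ m)) * B m' m))"
    proof (intro sum.cong refl)
      fix m m'
      show "lconst (of_int (g i $ m)) * lconst (of_int (g j $ m')) * B m m'
        = - (lconst (of_int (g j $ m')) * lconst (of_int (g i $ m)) * B m' m)"
        unfolding Banti[of m m'] by (simp add: mult.commute[of "lconst (of_int (g i $ m))"])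
    qed
    finally show ?thesis by (simp add: E_def sum_negf)
  qed
  have gh: "(\<Sum>m\<in>UNIV. lconst (of_int (g l $ m)) * h m) = (\<Sum>k\<in>K. z k * E l k)" for l
  proof -
    have "(\<Sum>m\<in>UNIV. lconst (of_int (g l $ m)) * h m)
      = (\<Sum>m\<in>UNIV. \<Sum>m'\<in>UNIV. \<Sum>k\<in>K. z k * (lconst (of_int (g l $ m)) * lconst (of_int (g k $ m')) * B m m'))"
      unfolding Bh log_deriv_F_z sum_distrib_left by (simp only: mult_ac)
    also have "\<dots> = (\<Sum>m\<in>UNIV. \<Sum>k\<in>K. \<Sum>m'\<in>UNIV. z k * (lconst (of_int (g l $ m)) * lconst (of_int (g k $ m')) * B m m'))"
      by (intro sum.cong refl sum.swap)
    also have "\<dots> = (\<Sum>k\<in>K. \<Sum>m\<in>UNIV. \<Sum>m'\<in>UNIV. z k * (lconst (of_int (g l $ m)) * lconst (of_int (g k $ m')) * B m m'))"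
      by (rule sum.swap)
    finally show ?thesis by (simp only: E_def sum_distrib_left)
  qed
  define Q where "Q = (\<Sum>l\<in>Neg. z l * (\<Sum>m\<in>UNIV. lconst (of_int (g l $ m)) * h m))"
  have "lookup Q u = 0"
  proof -
    have "Q = (\<Sum>l\<in>Neg. \<Sum>k\<in>Pos. z l * z k * E l k) + (\<Sum>l\<in>Neg. \<Sum>k\<in>Neg. z l * z k * E l k)"
      unfolding Q_def gh sum_K[of "\<lambda>k. z k * E _ k"] distrib_left sum.distrib sum_distrib_left
      by (simp only: mult.assoc)
    moreover have "lookup (z l * z k * E l k) u = 0" if "l \<in> Neg" "k \<in> Pos" for l k
    proof (cases "k = k0")
      case True
      then show ?thesis using ak0 by (simp add: z_def)
    next
      case False
      have "lookup (E l k) (u - g l - g k) = 0"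
        using separated[OF that False] ES[of l k] unfolding S_ring_iff by (meson in_keys_iff)
      then show ?thesis by (simp add: z_def mult.assoc lookup_single_mult)
    qed
    ultimately show ?thesis
      using lookup_antisymmetric_sum[OF Eanti, where y = z and X = Neg and u = u] by (simp add: lookup_add lookup_sum)
  qed
  moreover have "Q = single u (- (a l1 * a k1))"
  proof -
    have *: "(\<Sum>m\<in>UNIV. lconst (of_int (g l $ m)) * h m)
        = (if l = l1 then single (u - g l1) (- a k1) else 0)" if l: "l \<in> Neg" for l
    proof -
      have lK: "l \<in> K" "l \<noteq> k0" "l \<noteq> k1" using l NegD[OF l] k0 k1 Pos_Neg_disjoint by blast+
      have "(\<Sum>m\<in>UNIV. lconst (of_int (g l $ m)) * h m)
        = lconst (\<Sum>m\<in>UNIV. c m * of_int (g l $ m)) * single (u - g k1) (a l1)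
          - lconst (\<Sum>m\<in>UNIV. c' m * of_int (g l $ m)) * single (u - g l1) (a k1)"
        unfolding h_def lconst_sum sum_distrib_right sum_subtractf[symmetric]
        by (simp only: right_diff_distrib lconst_mult[symmetric] mult_ac)
      then have "(\<Sum>m\<in>UNIV. lconst (of_int (g l $ m)) * h m)
          = - (lconst (if l = l1 then 1 else 0) * single (u - g l1) (a k1))"
        using lK by (simp add: c[OF lK(1)] c'[OF lK(1)] lconst_single)
      then show ?thesis by (simp add: lconst_single single_uminus)
    qed
    have "Q = (\<Sum>l\<in>Neg. if l = l1 then z l1 * single (u - g l1) (- a k1) else 0)"
      unfolding Q_def by (intro sum.cong refl) (simp add: *)
    also have "\<dots> = z l1 * single (u - g l1) (- a k1)" using l1 finNeg by simp
    also have "\<dots> = single u (- (a l1 * a k1))" by (simp add: z_def mult_single)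
    finally show ?thesis .
  qed
  ultimately show False using Neg_nz[OF l1] ak1 by simp
qed

end

context circuit_residue
begin

text \<open>
  If \<open>\<Lambda> = 1\<close>, no coefficient vanishes and \<open>\<Prod> (-\<rho>\<^sub>k / a\<^sub>k)^\<rho>\<^sub>k = 1 / \<Lambda> = 1\<close>.
\<close>

lemma regular_Lambda_ne_1:
  assumes reg: "Delta_regular J A F" shows "\<Lambda> \<noteq> 1"
proof
  assume L: "\<Lambda> = 1"
  have Pos_nz: "a k \<noteq> 0" if k: "k \<in> Pos" for k
  proof
    assume "a k = 0"
    then have "(a k / - of_int (\<rho> k)) ^ nat (\<rho> k) = 0" using PosD[OF k] by simp
    then have "(\<Prod>k\<in>Pos. (a k / - of_int (\<rho> k)) ^ nat (\<rho> k)) = 0"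
      using k by (intro prod_zero[OF finPos] bexI)
    then have "\<Lambda> = 0" unfolding \<Lambda>_def by simp
    then show False using L by simp
  qed
  have Neg_nz: "a k \<noteq> 0" if "k \<in> Neg" for k using a_gamma_Neg[OF that] NegD[OF that] by auto
  have nz: "a k \<noteq> 0" if "k \<in> K" for k using that K_eq Pos_nz Neg_nz by blast
  have "(\<Prod>k\<in>Pos. (- of_int (\<rho> k) / a k) powi \<rho> k) = inverse (\<Prod>k\<in>Pos. (a k / - of_int (\<rho> k)) ^ nat (\<rho> k))"
    unfolding prod_inversef[symmetric] o_def
  proof (rule prod.cong[OF refl])
    fix k assume "k \<in> Pos"
    then show "(- of_int (\<rho> k) / a k) powi \<rho> k = inverse ((a k / - of_int (\<rho> k)) ^ nat (\<rho> k))"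
      using PosD[of k] by (simp add: power_int_def flip: power_inverse)
  qed
  moreover have "(\<Prod>k\<in>Neg. (- of_int (\<rho> k) / a k) powi \<rho> k) = inverse (\<Prod>k\<in>Neg. \<gamma> k ^ nat (- \<rho> k))"
    unfolding prod_inversef[symmetric] o_def
  proof (rule prod.cong[OF refl])
    fix k assume k: "k \<in> Neg"
    have "- of_int (\<rho> k) / a k = \<gamma> k" using a_gamma_Neg[OF k] Neg_nz[OF k] by (simp add: field_simps)
    then show "(- of_int (\<rho> k) / a k) powi \<rho> k = inverse (\<gamma> k ^ nat (- \<rho> k))"
      using NegD[OF k] by (simp add: power_int_def power_inverse)
  qed
  ultimately have "(\<Prod>k\<in>K. (- of_int (\<rho> k) / a k) powi \<rho> k) = inverse \<Lambda>"
    unfolding prod_K \<Lambda>_def by simp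
  then show False using regular_no_torus_zero[OF reg nz] L by simp
qed

lemma R_nz: "R \<noteq> 0"
  unfolding R_def using finK rho_nz by simp

theorem toric_residue_value:
  assumes "Delta_regular J A F" "h \<in> I_degree J A CARD('m)"
  shows "toric_residue J A F h = - res h / (R * (1 - \<Lambda>))"
proof -
  have "res (hessian F) \<noteq> 0"
    unfolding res_hessian using R_nz total_pos regular_Lambda_ne_1[OF assms(1)] by simp
  from toric_residue_eq[OF hessian_in_I this assms(2)]
  have "toric_residue J A F h = of_int total / (of_int total * - (R * (1 - \<Lambda>))) * res h"
    unfolding res_hessian Vol_eq by (simp add: mult_ac)
  also have "\<dots> = - res h / (R * (1 - \<Lambda>))" using total_pos by simp
  finally show ?thesis .
qed

end

section \<open>Weighted nef-partitions as circuits\<close>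

locale weighted_nef_partition =
  fixes J :: "'m::finite set" and w :: "'n::finite \<Rightarrow> nat" and v :: "'n \<Rightarrow> int ^ 'm"
    and A :: "'m \<Rightarrow> (int ^ 'm) set"
  assumes n_eq: "CARD('n) = card (- J) + 1"
    and w_pos: "\<And>i. w i > 0"
    and w_gcd: "Gcd (range w) = 1"
    and v_in_M: "\<And>i. v i \<in> M_lattice J"
    and v_generate: "\<And>u. u \<in> M_lattice J \<Longrightarrow> \<exists>c. u = (\<Sum>i\<in>UNIV. c i *s v i)"
    and v_relation: "(\<Sum>i\<in>UNIV. int (w i) *s v i) = 0"
    and partition_cover: "range v = (\<Union>j\<in>J. A j)"
    and partition_disjoint: "disjoint_family_on A J"
    and partition_nonempty: "\<And>j. j \<in> J \<Longrightarrow> A j \<noteq> {}"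
    and w_dvd_part: "\<And>i j. j \<in> J \<Longrightarrow> w i dvd part_weight A v w j"
begin

definition block :: "'n \<Rightarrow> 'm" where "block i = (SOME j. j \<in> J \<and> v i \<in> A j)"

lemma block: "block i \<in> J" "v i \<in> A (block i)"
proof -
  have "\<exists>j. j \<in> J \<and> v i \<in> A j" using partition_cover by blast
  then have "block i \<in> J \<and> v i \<in> A (block i)" unfolding block_def by (rule someI_ex)
  then show "block i \<in> J" "v i \<in> A (block i)" by auto
qed

lemma block_iff: "j \<in> J \<Longrightarrow> v i \<in> A j \<longleftrightarrow> block i = j"
  using block[of i] partition_disjoint unfolding disjoint_family_on_def by blast

lemma part_weight_block: "j \<in> J \<Longrightarrow> part_weight A v w j = (\<Sum>i | block i = j. w i)"
  by (simp add: part_weight_def block_iff)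

lemma part_weight_pos: "j \<in> J \<Longrightarrow> part_weight A v w j > 0"
proof -
  assume j: "j \<in> J"
  obtain x where x: "x \<in> A j" using partition_nonempty[OF j] by blast
  then have "x \<in> range v" using partition_cover j by blast
  then obtain i where "v i \<in> A j" using x by auto
  then have "w i \<le> part_weight A v w j" unfolding part_weight_def by (intro member_le_sum) auto
  then show ?thesis using w_pos[of i] by simp
qed

lemma sum_blocks: "(\<Sum>j\<in>J. \<Sum>i | block i = j. f j i) = (\<Sum>i\<in>UNIV. f (block i) i)"
proof -
  have "(\<Sum>j\<in>J. \<Sum>i | block i = j. f j i) = (\<Sum>j\<in>J. \<Sum>i\<in>{i\<in>UNIV. block i = j}. f (block i) i)"
    by (intro sum.cong) auto
  also have "\<dots> = (\<Sum>i\<in>UNIV. f (block i) i)" using block(1) by (intro sum.group) auto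
  finally show ?thesis .
qed

definition idx :: "('n + 'm) set" where "idx = range Inl \<union> Inr ` J"

definition gen :: "'n + 'm \<Rightarrow> int ^ 'm" where
  "gen = case_sum (\<lambda>i. v i + axis (block i) 1) (\<lambda>j. axis j 1)"

definition wgt :: "'n + 'm \<Rightarrow> int" where
  "wgt = case_sum (\<lambda>i. int (w i)) (\<lambda>j. - int (part_weight A v w j))"

lemma gen_simps [simp]: "gen (Inl i) = v i + axis (block i) 1" "gen (Inr j) = axis j 1"
  by (simp_all add: gen_def)

lemma wgt_simps [simp]: "wgt (Inl i) = int (w i)" "wgt (Inr j) = - int (part_weight A v w j)"
  by (simp_all add: wgt_def)

lemma sum_idx: "(\<Sum>k\<in>idx. f k) = (\<Sum>i\<in>UNIV. f (Inl i)) + (\<Sum>j\<in>J. f (Inr j))"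
  unfolding idx_def by (subst sum.union_disjoint) (auto simp: sum.reindex)

lemma prod_idx: "(\<Prod>k\<in>idx. f k) = (\<Prod>i\<in>UNIV. f (Inl i)) * (\<Prod>j\<in>J. f (Inr j))"
  unfolding idx_def by (subst prod.union_disjoint) (auto simp: prod.reindex)

lemma v_coord: "j \<in> J \<Longrightarrow> v i $ j = 0"
  using v_in_M[of i] by (simp add: M_lattice_def)

lemma gen_combination:
  "(\<Sum>k\<in>idx. c k *s gen k) $ m = (\<Sum>i\<in>UNIV. c (Inl i) * v i $ m)
     + (if m \<in> J then (\<Sum>i | block i = m. c (Inl i)) + c (Inr m) else 0)"
proof -
  have 1: "(\<Sum>i\<in>UNIV. c (Inl i) * axis (block i) 1 $ m) = (if m \<in> J then \<Sum>i | block i = m. c (Inl i) else 0)"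
  proof -
    have "(\<Sum>i\<in>UNIV. c (Inl i) * axis (block i) 1 $ m) = (\<Sum>i\<in>UNIV. if block i = m then c (Inl i) else 0)"
      by (intro sum.cong) (auto simp: axis_def)
    also have "\<dots> = (\<Sum>i | block i = m. c (Inl i))" by (simp add: sum.If_cases)
    finally show ?thesis using block(1) by (auto intro!: sum.neutral)
  qed
  have 2: "(\<Sum>j\<in>J. c (Inr j) * axis j 1 $ m) = (if m \<in> J then c (Inr m) else 0)"
  proof -
    have "(\<Sum>j\<in>J. c (Inr j) * axis j 1 $ m) = (\<Sum>j\<in>J. if j = m then c (Inr m) else 0)"
      by (intro sum.cong) (auto simp: axis_def)
    then show ?thesis by simp
  qed
  have "(\<Sum>k\<in>idx. c k *s gen k) $ m = (\<Sum>i\<in>UNIV. c (Inl i) * v i $ m)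
      + (\<Sum>i\<in>UNIV. c (Inl i) * axis (block i) 1 $ m) + (\<Sum>j\<in>J. c (Inr j) * axis j 1 $ m)"
    by (simp add: sum_idx sum_component distrib_left sum.distrib)
  then show ?thesis unfolding 1 2 by simp
qed

lemma polytope_eq: "cayley_polytope J A = convex hull (real_vec ` gen ` idx)"
proof
  have conv: "convex (convex hull (real_vec ` gen ` idx))" by simp
  have "(\<lambda>p. p + axis j 1) ` Delta_part A j \<subseteq> convex hull (real_vec ` gen ` idx)" if j: "j \<in> J" for j
  proof -
    have "(\<lambda>p. p + axis j 1) ` Delta_part A j = convex hull ((\<lambda>p. axis j 1 + p) ` ({0} \<union> real_vec ` A j))"
      unfolding Delta_part_def convex_hull_translation by (simp add: add.commute)
    also have "\<dots> \<subseteq> convex hull (real_vec ` gen ` idx)"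
    proof (rule hull_mono, rule subsetI)
      fix x assume "x \<in> (\<lambda>p. axis j 1 + p) ` ({0} \<union> real_vec ` A j)"
      then consider "x = axis j 1" | y where "y \<in> A j" "x = axis j 1 + real_vec y" by auto
      then show "x \<in> real_vec ` gen ` idx"
      proof cases
        case 1
        then have "x = real_vec (gen (Inr j))" by simp
        then show ?thesis using j unfolding idx_def by blast
      next
        case 2
        then obtain i where i: "y = v i" using partition_cover j by blast
        then have "block i = j" using 2 block_iff[OF j] by simp
        then have "x = real_vec (gen (Inl i))" using 2 i by simp
        then show ?thesis unfolding idx_def by blast
      qed
    qed
    finally show ?thesis .
  qed
  then show "cayley_polytope J A \<subseteq> convex hull (real_vec ` gen ` idx)"
    unfolding cayley_polytope_def by (intro hull_minimal conv) blast
  show "convex hull (real_vec ` gen ` idx) \<subseteq> cayley_polytope J A"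
    unfolding cayley_polytope_def
  proof (rule hull_mono, rule subsetI)
    fix x assume "x \<in> real_vec ` gen ` idx"
    then consider i where "x = real_vec (gen (Inl i))" | j where "j \<in> J" "x = real_vec (gen (Inr j))"
      unfolding idx_def by blast
    then show "x \<in> (\<Union>j\<in>J. (\<lambda>p. p + axis j 1) ` Delta_part A j)"
    proof cases
      case 1
      have "real_vec (v i) \<in> Delta_part A (block i)"
        unfolding Delta_part_def using block(2) by (intro hull_inc) blast
      then show ?thesis using 1 block(1) by auto
    next
      case 2
      have "0 \<in> Delta_part A j" unfolding Delta_part_def by (intro hull_inc) blast
      then show ?thesis using 2 by force
    qed
  qed
qed

sublocale circuit J A idx gen wgt
proof
  show "finite idx" by (simp add: idx_def)
  have "card idx = CARD('n) + card J"
    unfolding idx_def by (subst card_Un_disjoint) (auto simp: card_image)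
  moreover have "card J + card (- J) = CARD('m)"
    by (metis Compl_disjoint Compl_partition card_Un_disjoint finite)
  ultimately show "card idx = CARD('m) + 1" using n_eq by simp
  show "\<exists>c. u = (\<Sum>k\<in>idx. c k *s gen k)" for u
  proof -
    define u' where "u' = (\<chi> m. if m \<in> J then 0 else u $ m)"
    have "u' \<in> M_lattice J" by (simp add: u'_def M_lattice_def)
    then obtain c where c: "u' = (\<Sum>i\<in>UNIV. c i *s v i)" using v_generate by blast
    define c' where "c' = case_sum c (\<lambda>j. u $ j - (\<Sum>i | block i = j. c i))"
    have "(\<Sum>k\<in>idx. c' k *s gen k) $ m = u $ m" for m
    proof -
      have "(\<Sum>i\<in>UNIV. c i * v i $ m) = u' $ m" unfolding c by (simp add: sum_component)
      then show ?thesis unfolding gen_combination by (simp add: c'_def u'_def)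
    qed
    then show ?thesis by (intro exI[of _ c']) (simp add: vec_eq_iff)
  qed
  show "(\<Sum>k\<in>idx. wgt k *s gen k) = 0"
  proof -
    have "(\<Sum>k\<in>idx. wgt k *s gen k) $ m = 0" for m
    proof -
      have "(\<Sum>i\<in>UNIV. int (w i) * v i $ m) = (\<Sum>i\<in>UNIV. int (w i) *s v i) $ m" by (simp add: sum_component)
      then show ?thesis unfolding gen_combination using v_relation by (simp add: part_weight_block)
    qed
    then show ?thesis by (simp add: vec_eq_iff)
  qed
  show "wgt k \<noteq> 0" if "k \<in> idx" for k
  proof (cases k)
    case (Inl i)
    then show ?thesis using w_pos[of i] by simp
  next
    case (Inr j)
    then show ?thesis using that part_weight_pos[of j] by (auto simp: idx_def)
  qed
  show "(\<Sum>j\<in>J. gen k $ j) = 1" if "k \<in> idx" for k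
  proof -
    have ax: "(\<Sum>j\<in>J. axis j' 1 $ j) = (1::int)" if "j' \<in> J" for j'
      using that by (simp add: axis_def)
    show ?thesis using that block(1) by (auto simp: idx_def sum.distrib v_coord ax)
  qed
  show "wgt k dvd wgt l" if "k \<in> idx" "l \<in> idx" "wgt k > 0" "wgt l < 0" for k l
    using that w_dvd_part by (auto simp: idx_def)
  show "b dvd 1" if b: "\<And>k. k \<in> idx \<Longrightarrow> wgt k > 0 \<Longrightarrow> b dvd wgt k" for b
  proof -
    have "b dvd int (w i)" for i using b[of "Inl i"] w_pos[of i] by (simp add: idx_def)
    then have "nat \<bar>b\<bar> dvd w i" for i by (simp add: nat_abs_dvd_iff)
    then have "nat \<bar>b\<bar> dvd Gcd (range w)" by (intro Gcd_greatest) auto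
    then show ?thesis using w_gcd by (simp add: nat_abs_dvd_iff)
  qed
  show "cayley_polytope J A = convex hull (real_vec ` gen ` idx)" by (rule polytope_eq)
qed

lemma Pos_eq: "Pos = range Inl"
  unfolding Pos_def by (auto simp: idx_def w_pos)

lemma Neg_eq: "Neg = Inr ` J"
  unfolding Neg_def by (auto simp: idx_def part_weight_pos)

lemma card_Pos: "card Pos = CARD('n)"
  unfolding Pos_eq by (simp add: card_image)

definition coef :: "('n \<Rightarrow> complex) \<Rightarrow> 'n + 'm \<Rightarrow> complex" where
  "coef a = case_sum (\<lambda>i. - a i) (\<lambda>j. 1)"

text \<open>
  The value for \<open>a i = 0\<close> is an arbitrary nonzero number; by regularity it occurs for \<open>d = 0\<close> only.
\<close>

definition gam :: "('n \<Rightarrow> complex) \<Rightarrow> 'n + 'm \<Rightarrow> complex" where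
  "gam a = case_sum (\<lambda>i. if a i = 0 then 1 else of_nat (w i) / a i) (\<lambda>j. of_nat (part_weight A v w j))"

lemma coef_simps [simp]: "coef a (Inl i) = - a i" "coef a (Inr j) = 1"
  by (simp_all add: coef_def)

lemma F_eq: "F_poly J A v a = circuit_polynomial.F idx gen (coef a)"
proof -
  interpret circuit_polynomial J A idx gen wgt "coef a" by unfold_locales
  have "F_poly J A v a = (\<Sum>j\<in>J. single (axis j 1) 1)
      - (\<Sum>j\<in>J. \<Sum>i | block i = j. single (v i + axis j 1) (a i))"
    unfolding F_poly_def f_poly_def tvar_def right_diff_distrib sum_subtractf
    by (simp add: block_iff sum_distrib_left mult_single add.commute)
  also have "\<dots> = (\<Sum>j\<in>J. single (axis j 1) 1)
      - (\<Sum>i\<in>UNIV. single (v i + axis (block i) 1) (a i))"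
    unfolding sum_blocks ..
  also have "\<dots> = F" unfolding F_def by (simp add: sum_idx single_uminus sum_negf)
  finally show ?thesis .
qed

lemma monomial_rep:
  assumes "\<And>j. j \<in> J \<Longrightarrow> (\<Sum>i | block i = j. \<alpha> i) = k j"
  shows "(\<Sum>j\<in>J. int (k j) *s axis j 1) + (\<Sum>i\<in>UNIV. int (\<alpha> i) *s v i)
    = comb (case_sum (\<lambda>i. int (\<alpha> i)) (\<lambda>j. 0))"
proof -
  have "((\<Sum>j\<in>J. int (k j) *s axis j 1) + (\<Sum>i\<in>UNIV. int (\<alpha> i) *s v i)) $ m
     = comb (case_sum (\<lambda>i. int (\<alpha> i)) (\<lambda>j. 0)) $ m" for m
  proof -
    have "(\<Sum>j\<in>J. int (k j) * axis j 1 $ m) = (\<Sum>j\<in>J. if j = m then int (k m) else 0)"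
      by (intro sum.cong) (auto simp: axis_def)
    then show ?thesis unfolding comb_def gen_combination
      using assms[of m] by (simp add: sum_component flip: of_nat_sum)
  qed
  then show ?thesis by (simp add: vec_eq_iff)
qed

end

section \<open>The mixed toric residue\<close>

context weighted_nef_partition
begin

lemma monomial_expansion_eval:
  "(\<Prod>j\<in>J. tvar j ^ k j) * mpoly_eval lconst P (\<lambda>i. single (v i) (a i))
   = (\<Sum>\<alpha>\<in>keys P. single
        ((\<Sum>j\<in>J. int (k j) *s axis j 1) + (\<Sum>i\<in>UNIV. int (lookup \<alpha> i) *s v i))
        (lookup P \<alpha> * (\<Prod>i\<in>UNIV. a i ^ lookup \<alpha> i)))"
proof -
  have pw: "single u c ^ n = single (int n *s u) (c ^ n)" for u :: "int ^ 'm" and c :: complex and n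
    by (induction n) (simp_all add: mult_single vec_eq_iff algebra_simps)
  have t: "(\<Prod>j\<in>J. tvar j ^ k j) = single (\<Sum>j\<in>J. int (k j) *s axis j 1) 1"
    unfolding tvar_def pw by (simp add: prod_single)
  show ?thesis
    unfolding mpoly_eval_def t sum_distrib_left pw
    by (simp add: prod_single lconst_def mult_single)
qed

text \<open>
  With \<open>s = 0\<close> these are coordinates of the monomial of the numerator that comes from \<open>x^\<alpha>\<close>; with
  \<open>s = 1\<close>, after multiplication by \<open>t\<^bsub>d+1\<^esub> \<cdots> t\<^bsub>d+r\<^esub>\<close>.
\<close>

definition expo :: "('n \<Rightarrow>\<^sub>0 nat) \<Rightarrow> int \<Rightarrow> 'n + 'm \<Rightarrow> int" where
  "expo \<alpha> s = case_sum (\<lambda>i. int (lookup \<alpha> i)) (\<lambda>j. s)"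

definition numerator :: "('n \<Rightarrow> complex) \<Rightarrow> ('m \<Rightarrow> nat) \<Rightarrow> 'n mpolynomial \<Rightarrow> 'm laurent" where
  "numerator a k P = (\<Prod>j\<in>J. tvar j ^ k j) * mpoly_eval lconst P (\<lambda>i. single (v i) (a i))"

context
  fixes a :: "'n \<Rightarrow> complex" and k :: "'m \<Rightarrow> nat" and P :: "'n mpolynomial"
  assumes k_sum: "(\<Sum>j\<in>J. k j) = card (- J)"
    and P_homogeneous: "multihomogeneous J A v k P"
begin

lemma exponent_blocks:
  assumes "\<alpha> \<in> keys P" "j \<in> J"
  shows "(\<Sum>i | block i = j. lookup \<alpha> i) = k j"
proof -
  have "(\<Sum>i | v i \<in> A j. lookup \<alpha> i) = k j"
    using P_homogeneous assms unfolding multihomogeneous_def by blast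
  then show ?thesis using assms(2) by (simp add: block_iff)
qed

lemma exponent_sum:
  assumes "\<alpha> \<in> keys P"
  shows "(\<Sum>i\<in>UNIV. lookup \<alpha> i) = card (- J)"
proof -
  have "(\<Sum>i\<in>UNIV. lookup \<alpha> i) = (\<Sum>j\<in>J. \<Sum>i | block i = j. lookup \<alpha> i)"
    by (rule sum_blocks[symmetric])
  then show ?thesis using exponent_blocks[OF assms] k_sum by simp
qed

lemma numerator_eq:
  "numerator a k P = (\<Sum>\<alpha>\<in>keys P. single (comb (expo \<alpha> 0))
     (lookup P \<alpha> * (\<Prod>i\<in>UNIV. a i ^ lookup \<alpha> i)))"
  unfolding numerator_def monomial_expansion_eval expo_def
  by (intro sum.cong refl) (simp add: monomial_rep exponent_blocks)

lemma shifted_numerator_eq: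
  "(\<Prod>j\<in>J. tvar j) * numerator a k P = (\<Sum>\<alpha>\<in>keys P. single (comb (expo \<alpha> 1))
     (lookup P \<alpha> * (\<Prod>i\<in>UNIV. a i ^ lookup \<alpha> i)))"
proof -
  have t: "(\<Prod>j\<in>J. tvar j) = single (\<Sum>j\<in>J. axis j 1) 1"
    unfolding tvar_def by (simp add: prod_single)
  have "(\<Sum>j\<in>J. axis j 1) + comb (expo \<alpha> 0) = comb (expo \<alpha> 1)" for \<alpha>
    unfolding comb_def by (simp add: sum_idx expo_def)
  then show ?thesis unfolding t numerator_eq sum_distrib_left mult_single by simp
qed

lemma numerator_in_S: "numerator a k P \<in> S_multidegree J A k"
proof -
  have "inC u \<and> (\<forall>j\<in>J. u $ j = int (k j))" if u: "u \<in> keys (numerator a k P)" for u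
  proof -
    obtain \<alpha> where \<alpha>: "\<alpha> \<in> keys P" "u = comb (expo \<alpha> 0)"
      using keys_sum_monomials[OF u[unfolded numerator_eq]] by blast
    have "\<forall>l\<in>idx. of_int (expo \<alpha> 0 l) + 0 * of_int (wgt l) \<ge> (0::real)"
      by (auto simp: idx_def expo_def)
    then have "inC u" unfolding \<alpha>(2) inC_comb by blast
    moreover have "u $ j = int (k j)" if "j \<in> J" for j
      unfolding \<alpha>(2) comb_def gen_combination using that exponent_blocks[OF \<alpha>(1) that]
      by (simp add: expo_def v_coord flip: of_nat_sum)
    ultimately show ?thesis by blast
  qed
  then show ?thesis unfolding S_multidegree_def S_ring_def inC_def by blast
qed

text \<open>
  The \<open>d + 1\<close> exponents add up to \<open>d\<close>, so one of them is 0.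
\<close>

lemma expo_normal:
  assumes "\<alpha> \<in> keys P" shows "normal (expo \<alpha> 1)"
proof -
  have "\<exists>i. lookup \<alpha> i = 0"
  proof (rule ccontr)
    assume "\<not> ?thesis"
    then have "(\<Sum>i\<in>(UNIV :: 'n set). 1) \<le> (\<Sum>i\<in>UNIV. lookup \<alpha> i)"
      by (intro sum_mono) (auto simp: Suc_le_eq)
    then show False using exponent_sum[OF assms] n_eq by simp
  qed
  moreover have "- int (w i) < int (lookup \<alpha> i)" for i using w_pos[of i] by simp
  ultimately show ?thesis unfolding normal_def Pos_eq by (auto simp: expo_def)
qed

lemma expo_interior:
  assumes "\<alpha> \<in> keys P"
  shows "inI (comb (expo \<alpha> 1))" "deg (comb (expo \<alpha> 1)) = int CARD('m)"
proof -
  have "chamber 0 (expo \<alpha> 1)" unfolding chamber_def Pos_eq Neg_eq by (auto simp: expo_def)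
  then show "inI (comb (expo \<alpha> 1))" by (rule chamber_inI)
  have "deg (comb (expo \<alpha> 1)) = int (\<Sum>i\<in>UNIV. lookup \<alpha> i) + int (card J)"
    unfolding deg_comb sum_idx by (simp add: expo_def)
  then show "deg (comb (expo \<alpha> 1)) = int CARD('m)"
    using exponent_sum[OF assms] n_eq cardK card_K card_Pos Neg_eq by (simp add: card_image)
qed

lemma shifted_numerator_in_I: "(\<Prod>j\<in>J. tvar j) * numerator a k P \<in> I_degree J A CARD('m)"
proof -
  interpret circuit_polynomial J A idx gen wgt "coef a" by unfold_locales
  show ?thesis unfolding I_degree_iff shifted_numerator_eq
    by (rule ballI, drule keys_sum_monomials) (use expo_interior in blast)
qed

text \<open>
  Each monomial \<open>x^\<alpha>\<close> of \<open>P\<close> contributes \<open>\<Prod> (a\<^sub>i \<gamma>\<^sub>i)^\<alpha>\<^sub>i \<Prod> d\<^sub>j = \<Prod> w\<^sub>i^\<alpha>\<^sub>i \<Prod> d\<^sub>j\<close>, and the product of the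
  \<open>d\<^sub>j\<close> cancels against the one in the value of the Hessian.
\<close>

theorem mixed_residue_value:
  assumes reg: "Delta_regular J A (F_poly J A v a)"
  shows "(- 1) ^ card (- J) * mixed_toric_residue J A (F_poly J A v a) k (numerator a k P)
    = mpoly_eval id P (\<lambda>i. of_nat (w i)) / ((\<Prod>i\<in>UNIV. of_nat (w i)) *
       (1 - (\<Prod>i\<in>UNIV. (a i / of_nat (w i)) ^ w i)
          * (\<Prod>j\<in>J. of_nat (part_weight A v w j) ^ part_weight A v w j)))"
proof -
  interpret P: circuit_polynomial J A idx gen wgt "coef a" by unfold_locales
  have reg': "Delta_regular J A P.F" using reg by (simp add: F_eq)
  have neg: "coef a l \<noteq> 0" if "l \<in> Neg" for l using that unfolding Neg_eq by auto
  have a_nz: "a i \<noteq> 0" if "card Pos > 1" for i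
    using P.regular_vertex_nonzero[OF reg' neg that, of "Inl i"] by (simp add: Pos_eq)
  interpret R: circuit_residue J A idx gen wgt "coef a" "gam a"
  proof
    show "gam a l \<noteq> 0" if "l \<in> idx" for l
    proof (cases l)
      case (Inl i)
      then show ?thesis using w_pos[of i] by (simp add: gam_def)
    next
      case (Inr j)
      then show ?thesis using that part_weight_pos[of j] by (auto simp: idx_def gam_def)
    qed
    show "coef a l * gam a l = - of_int (wgt l)" if "l \<in> Neg" for l
      using that unfolding Neg_eq by (auto simp: gam_def)
    show "coef a l * gam a l = - of_int (wgt l)" if "l \<in> Pos" "card Pos > 1" for l
      using that a_nz unfolding Pos_eq by (auto simp: gam_def)
  qed
  define D where "D = (\<Prod>j\<in>J. of_nat (part_weight A v w j) :: complex)"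
  define W where "W = (\<Prod>i\<in>UNIV. of_nat (w i) :: complex)"
  have D: "D \<noteq> 0" using part_weight_pos by (fastforce simp: D_def)
  have L: "R.\<Lambda> = (\<Prod>i\<in>UNIV. (a i / of_nat (w i)) ^ w i)
      * (\<Prod>j\<in>J. of_nat (part_weight A v w j) ^ part_weight A v w j)"
    unfolding R.\<Lambda>_def Pos_eq Neg_eq by (simp add: prod.reindex gam_def)
  have Rv: "R.R = - ((- 1) ^ card (- J) * W * D)"
    unfolding R.R_def prod_idx by (simp add: W_def D_def n_eq prod_uminus)
  have "R.res ((\<Prod>j\<in>J. tvar j) * numerator a k P) = D * mpoly_eval id P (\<lambda>i. of_nat (w i))"
  proof -
    have "R.res ((\<Prod>j\<in>J. tvar j) * numerator a k P)
        = (\<Sum>\<alpha>\<in>keys P. lookup P \<alpha>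
             * (\<Prod>i\<in>UNIV. a i ^ lookup \<alpha> i) * R.wt (comb (expo \<alpha> 1)))"
      unfolding R.res_def shifted_numerator_eq lin_ext_sum lin_ext_single
      using expo_interior(2) by (intro sum.cong) auto
    also have "\<dots> = (\<Sum>\<alpha>\<in>keys P. D * (id (lookup P \<alpha>)
             * (\<Prod>i\<in>UNIV. of_nat (w i) ^ lookup \<alpha> i)))"
    proof (rule sum.cong[OF refl])
      fix \<alpha> assume \<alpha>: "\<alpha> \<in> keys P"
      have wt: "R.wt (comb (expo \<alpha> 1)) = (\<Prod>i\<in>UNIV. gam a (Inl i) ^ lookup \<alpha> i) * D"
        unfolding R.wt_comb[OF expo_normal[OF \<alpha>]] prod_idx D_def
        by (simp add: expo_def gam_def)
      have "a i ^ lookup \<alpha> i * gam a (Inl i) ^ lookup \<alpha> i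
          = of_nat (w i) ^ lookup \<alpha> i" for i
      proof (cases "card Pos > 1")
        case True
        then have "a i * gam a (Inl i) = of_nat (w i)" using a_nz by (simp add: gam_def)
        then show ?thesis by (simp flip: power_mult_distrib)
      next
        case False
        then have "card (- J) = 0" using card_Pos n_eq by simp
        then have "lookup \<alpha> i = 0" using exponent_sum[OF \<alpha>] by simp
        then show ?thesis by simp
      qed
      then have pr: "(\<Prod>i\<in>UNIV. a i ^ lookup \<alpha> i) * (\<Prod>i\<in>UNIV. gam a (Inl i) ^ lookup \<alpha> i)
          = (\<Prod>i\<in>UNIV. of_nat (w i) ^ lookup \<alpha> i)"
        unfolding prod.distrib[symmetric] by simp
      show "lookup P \<alpha> * (\<Prod>i\<in>UNIV. a i ^ lookup \<alpha> i) * R.wt (comb (expo \<alpha> 1))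
          = D * (id (lookup P \<alpha>) * (\<Prod>i\<in>UNIV. of_nat (w i) ^ lookup \<alpha> i))"
        unfolding wt pr[symmetric] by (simp add: mult_ac)
    qed
    finally show ?thesis by (simp add: mpoly_eval_def sum_distrib_left)
  qed
  then have "toric_residue J A (F_poly J A v a) ((\<Prod>j\<in>J. tvar j) * numerator a k P)
      = D * mpoly_eval id P (\<lambda>i. of_nat (w i)) / ((- 1) ^ card (- J) * W * D * (1 - R.\<Lambda>))"
    unfolding F_eq R.toric_residue_value[OF reg' shifted_numerator_in_I] Rv by simp
  moreover have "mixed_toric_residue J A (F_poly J A v a) k (numerator a k P)
      = toric_residue J A (F_poly J A v a) ((\<Prod>j\<in>J. tvar j) * numerator a k P)"
    using numerator_in_S by (simp add: mixed_toric_residue_def)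
  moreover have "s * (D * x / (s * W * D * y)) = x / (W * y)" if "s \<noteq> 0" for s x y :: complex
    using that D by simp
  ultimately show ?thesis unfolding L W_def[symmetric] by simp
qed

end

end

theorem theorem5p3:
  fixes d r :: nat
    and J :: "'m::finite set"
    and w :: "'n::finite \<Rightarrow> nat"
    and v :: "'n \<Rightarrow> int ^ 'm"
    and A :: "'m \<Rightarrow> (int ^ 'm) set"
    and a :: "'n \<Rightarrow> complex"
    and k :: "'m \<Rightarrow> nat"
    and P :: "'n mpolynomial"
  assumes card_J: "card J = r" and card_M: "card (- J) = d"
    and n_eq: "CARD('n) = d + 1"
    and w_pos: "\<forall>i. w i > 0"
    and w_gcd: "Gcd (range w) = 1"
    and w_dvd: "\<forall>i. w i dvd (\<Sum>i'\<in>UNIV. w i')"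
    and v_in_M: "\<forall>i. v i \<in> M_lattice J"
    and v_generate: "\<forall>u\<in>M_lattice J. \<exists>c :: 'n \<Rightarrow> int. u = (\<Sum>i\<in>UNIV. c i *s v i)"
    and v_relation: "(\<Sum>i\<in>UNIV. int (w i) *s v i) = 0"
    and partition_cover: "range v = (\<Union>j\<in>J. A j)"
    and partition_disjoint: "disjoint_family_on A J"
    and partition_nonempty: "\<forall>j\<in>J. A j \<noteq> {}"
    and w_dvd_part: "\<forall>i. \<forall>j\<in>J. w i dvd part_weight A v w j"
    and generic: "Delta_regular J A (F_poly J A v a)"
    and k_sum: "(\<Sum>j\<in>J. k j) = d"
    and P_homogeneous: "multihomogeneous J A v k P"
  shows "(- 1) ^ d * mixed_toric_residue J A (F_poly J A v a) k
           ((\<Prod>j\<in>J. tvar j ^ k j)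
             * mpoly_eval lconst P (\<lambda>i. Poly_Mapping.single (v i) (a i)))
         = (let \<nu> = 1 / (\<Prod>i\<in>UNIV. of_nat (w i));
                \<mu> = (\<Prod>j\<in>J. of_nat (part_weight A v w j) ^ part_weight A v w j)
                      / (\<Prod>i\<in>UNIV. of_nat (w i) ^ w i);
                y = (\<Prod>i\<in>UNIV. a i ^ w i)
            in \<nu> * mpoly_eval id P (\<lambda>i. of_nat (w i)) / (1 - \<mu> * y))"
proof -
  interpret weighted_nef_partition J w v A
    using n_eq card_M w_pos w_gcd v_in_M v_generate v_relation partition_cover
      partition_disjoint partition_nonempty w_dvd_part
    by unfold_locales auto
  have "(\<Sum>j\<in>J. k j) = card (- J)" using k_sum card_M by simp
  from mixed_residue_value[OF this P_homogeneous generic, unfolded numerator_def card_M]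
  show ?thesis
    by (simp add: Let_def power_divide prod_dividef mult.commute)
qed

end
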